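(* Let $\mathbf Y\in\mathscr C^{0,\alpha,1}$. Let $\mu:[0,T]\to\mathcal M_F(\mathbb R^{d_X})$ be a measure-valued solution of the rough Zakai equation $$\mu_t(\varphi)=\mu_0(\varphi)+\int_0^t\mu_r(A_r^{\mathbf Y}\varphi)\,dr+\int_0^t\mu_r(\Gamma_r^{\mathbf Y}\varphi)\,d\mathbf Y_r$$ (in the sense defined in the context) such that $\mu_t(1)>0$ for any $t\in[0,T]$. Define $\varsigma:[0,T]\to\mathcal M_F(\mathbb R^{d_X})$ by $\varsigma_t(\varphi):=\mu_t(\varphi)/\mu_t(1)$ for any bounded measurable $\varphi:\mathbb R^{d_X}\to\mathbb R$. Then $\varsigma$ is a measure-valued solution (in the sense defined in the context) of the rough Kushner–Stratonovich equation $$\varsigma_t(\varphi)=\varsigma_0(\varphi)+\int_0^t\varsigma_r(A_r^{\mathbf Y}\varphi)\,dr+\int_0^t\big(\varsigma_r(\Gamma_r^{\mathbf Y}\varphi)-\varsigma_r(\varphi)\varsigma_r(h(r,\cdot;\mathbf Y))\big)\big(d\mathbf Y_r-\dot{[\mathbf Y]}_r\,\varsigma_r(h(r,\cdot;\mathbf Y)^\top)\,dr\big).$$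
   Context: **Rough paths.** Fix $T>0$, $\alpha\in(1/3,1/2]$. An $\alpha$-Hölder rough path over $\mathbb R^{d_Y}$ on $[0,T]$ is a pair $\mathbf Y=(Y,\mathbb Y)$, $Y:[0,T]\to\mathbb R^{d_Y}$, $\mathbb Y_{s,t}\in\mathbb R^{d_Y}\otimes\mathbb R^{d_Y}$ ($0\le s\le t\le T$), with Chen's relation $\mathbb Y_{s,t}=\mathbb Y_{s,u}+\mathbb Y_{u,t}+\delta Y_{s,u}\otimes\delta Y_{u,t}$ and $|\delta Y|_\alpha+|\mathbb Y|_{2\alpha}<\infty$, where $\delta Y_{s,t}=Y_t-Y_s$ and $|\Xi|_\gamma=\sup_{s<t}|\Xi_{s,t}|/|t-s|^\gamma$. Metric: $\rho_\alpha(\mathbf Y,\bar{\mathbf Y})=|\delta Y-\delta\bar Y|_\alpha+|\mathbb Y-\bar{\mathbb Y}|_{2\alpha}$. The bracket $[\mathbf Y]$ is defined by $\delta Y\otimes\delta Y=\mathbb Y+\mathbb Y^\top+\delta[\mathbf Y]$. $\mathscr C^{0,\alpha,1}$ is the set of rough paths in the $\rho_\alpha$-closure of smooth rough paths (smooth pairs satisfying Chen's relation) for which $t\mapsto\delta[\mathbf Y]_{0,t}$ is $C^1$; $\dot{[\mathbf Y]}_t=d[\mathbf Y]_t/dt$. **Function spaces.** For $N\in\{0,1,\dots\}$, $\kappa\in(0,1]$, $\mathcal C^{N+\kappa}_b$ is the space of bounded $N$-times continuously differentiable functions with bounded derivatives up to order $N$ and $\kappa$-Hölder $N$-th derivative,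 with the usual norm (so $\mathcal C^3_b$ means $C^2$ with bounded Lipschitz second derivative). $\mathcal M_F(\mathbb R^d)$: finite Borel measures; $\mu(\psi)=\int\psi\,d\mu$. **Controlled vector fields.** Let $\beta=N+\kappa>1$. A pair of measurable maps $g:[0,T]\to\mathcal C^\beta_b(\mathbb R^{d_X};\mathrm{Lin}(\mathbb R^{d_Y},V))$, $g':[0,T]\to\mathcal C^{\beta-1}_b(\mathbb R^{d_X};\mathrm{Lin}(\mathbb R^{d_Y},\mathrm{Lin}(\mathbb R^{d_Y},V)))$ ($V=\mathbb R^{d_X}$ or $\mathbb R$) is in $\mathscr D_Y^{2\alpha}\mathcal C_b^\beta$ if $\sup_t|g_t|_{\mathcal C^\beta_b}+\sup_t|g'_t|_{\mathcal C_b^{\beta-1}}<\infty$ and $\sum_{j=0}^N[\delta D_x^jg]_\alpha+\sum_{j=0}^{N-1}([\delta D_x^jg']_\alpha+[R^{D_x^jg}]_{2\alpha})<\infty$, where $R^{D_x^jg}_{s,t}=D_x^jg_t-D_x^jg_s-D_x^jg'_s\,\delta Y_{s,t}$ and $[\zeta]_\gamma=\sup_{s<t}\sup_x|\zeta_{s,t}(x)|/|t-s|^\gamma$. Components: $g_\kappa$ is $g$ applied to the $\kappa$-th basis vector; $g'_{\kappa\lambda}$ is such that $g_\kappa(t,\cdot)-g_\kappa(s,\cdot)\approx\sum_\lambda g'_{\kappa\lambda}(s,\cdot)\delta Y^\lambda_{s,t}$. **Standing Assumption E on the coefficients.** For any $\mathbf Y\in\mathscr C^{0,\alpha,1}$,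 the measurable functions $b(\cdot,\cdot;\mathbf Y):[0,T]\times\mathbb R^{d_X}\to\mathbb R^{d_X}$, $\sigma(\cdot,\cdot;\mathbf Y)\in\mathrm{Lin}(\mathbb R^{d_B},\mathbb R^{d_X})$, $f(\cdot,\cdot;\mathbf Y)\in\mathrm{Lin}(\mathbb R^{d_Y},\mathbb R^{d_X})$, $h(\cdot,\cdot;\mathbf Y)\in\mathrm{Lin}(\mathbb R^{d_Y},\mathbb R)$ satisfy: $b,\sigma$ are bounded and Lipschitz in $x$ uniformly in $t$; there are a measurable $f'(\cdot,\cdot;\mathbf Y)$ and $\beta\in(1/\alpha,3]$ with $(f,f')\in\mathscr D_Y^{2\alpha}\mathcal C^\beta_b$; there is a measurable $h'(\cdot,\cdot;\mathbf Y)$ with $(h,h')\in\mathscr D_Y^{2\alpha}\mathcal C^2_b$. **Operators** (coefficients evaluated at $(t,x;\mathbf Y)$): $A_t^{\mathbf Y}\varphi=\sum_i\big(b^i+\sum_{\kappa,\lambda}f_\kappa^i\dot{[\mathbf Y]}^{\kappa\lambda}_th_\lambda\big)\partial_i\varphi+\frac12\sum_{i,j}\big(\sum_\theta\sigma^i_\theta\sigma^j_\theta+\sum_{\kappa,\lambda}f^i_\kappa\dot{[\mathbf Y]}_t^{\kappa\lambda}f^j_\lambda\big)\partial^2_{ij}\varphi$; $(\Gamma_t^{\mathbf Y})_\kappa\varphi=\sum_if^i_\kappa\partial_i\varphi+h_\kappa\varphi$; $(\Gamma_t^{\mathbf Y})'_{\kappa\lambda}\varphi=\sum_i(f'_{\kappa\lambda})^i\partial_i\varphi+h'_{\kappa\lambda}\varphi$.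 The superscript $\mathbf Y$ on $\Gamma$ is omitted below. **Solution of the rough Zakai equation.** A weakly continuous curve $\mu:[0,T]\to\mathcal M_F(\mathbb R^{d_X})$ (i.e. $t\mapsto\mu_t(\varphi)$ continuous for bounded continuous $\varphi$) such that for every $\varphi\in\mathcal C^3_b(\mathbb R^{d_X};\mathbb R)$: (i) $t\mapsto\mu_t(A_t^{\mathbf Y}\varphi)\in L_1([0,T],dt)$; (ii) there is $C_\varphi>0$, uniform over bounded sets of $\varphi$ in $\mathcal C_b^3$, such that for $0\le s\le t\le T$ and all $\kappa,\lambda$, $|\mu_t((\Gamma_t)_\kappa(\Gamma_t)_\lambda\varphi+(\Gamma_t)'_{\lambda\kappa}\varphi)-\mu_s((\Gamma_s)_\kappa(\Gamma_s)_\lambda\varphi+(\Gamma_s)'_{\lambda\kappa}\varphi)|\le C_\varphi|t-s|^\alpha$ and $|\mu_t((\Gamma_t)_\kappa\varphi)-\mu_s((\Gamma_s)_\kappa\varphi)-\sum_\eta\mu_s((\Gamma_s)_\eta(\Gamma_s)_\kappa\varphi+(\Gamma_s)'_{\kappa\eta}\varphi)\delta Y^\eta_{s,t}|\le C_\varphi|t-s|^{2\alpha}$; (iii) $\mu_t(\varphi)-\mu_s(\varphi)=\int_s^t\mu_r(A^{\mathbf Y}_r\varphi)dr+\sum_\kappa\mu_s((\Gamma_s)_\kappa\varphi)\delta Y^\kappa_{s,t}+\sum_{\kappa,\lambda}\mu_s((\Gamma_s)_\kappa(\Gamma_s)_\lambda\varphi+(\Gamma_s)'_{\lambda\kappa}\varphi)\mathbb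 Y^{\kappa\lambda}_{s,t}+o(|t-s|)$ as $|t-s|\to0$, $s\le t$. **Solution of the rough Kushner–Stratonovich equation.** For $\varsigma:[0,T]\to\mathcal M_F(\mathbb R^{d_X})$ and a test function $\varphi$ put $h_\kappa(t)=h_\kappa(t,\cdot;\mathbf Y)=(\Gamma_t)_\kappa1$ and $(\Phi^{\varsigma,\varphi}_t)_\kappa=\varsigma_t((\Gamma_t)_\kappa\varphi)-\varsigma_t(\varphi)\varsigma_t(h_\kappa(t))$; $\varsigma_t((\Gamma_t)_\kappa\varphi)'_\eta=\varsigma_t((\Gamma_t)_\eta(\Gamma_t)_\kappa\varphi+(\Gamma_t)'_{\kappa\eta}\varphi)-\varsigma_t((\Gamma_t)_\kappa\varphi)\varsigma_t(h_\eta(t))$; $\varsigma_t(\varphi)'_\eta=\varsigma_t((\Gamma_t)_\eta\varphi)-\varsigma_t(\varphi)\varsigma_t(h_\eta(t))$; $(\Phi^{\varsigma,\varphi}_t)'_{\kappa\lambda}=\varsigma_t((\Gamma_t)_\kappa\varphi)'_\lambda-\varsigma_t(\varphi)'_\lambda\varsigma_t(h_\kappa(t))-\varsigma_t(\varphi)\varsigma_t((\Gamma_t)_\kappa1)'_\lambda$. A measure-valued solution is a weakly continuous curve $\varsigma:[0,T]\to\mathcal M_F(\mathbb R^{d_X})$ such that for every $\varphi\in\mathcal C_b^3(\mathbb R^{d_X};\mathbb R)$: (1) $t\mapsto\varsigma_t(A^{\mathbf Y}_t\varphi)$ and $t\mapsto\sum_{\kappa,\lambda}(\Phi_t^{\varsigma,\varphi})_\kappa\dot{[\mathbf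 Y]}^{\kappa\lambda}_t\varsigma_t(h_\lambda(t))$ are in $L^1([0,T],dt)$; (2) there is $C_\varphi>0$, uniform over bounded sets of $\varphi$ in $\mathcal C_b^3$, with $|(\Phi_t^{\varsigma,\varphi})'_{\kappa\lambda}-(\Phi_s^{\varsigma,\varphi})'_{\kappa\lambda}|\le C_\varphi|t-s|^\alpha$ and $|(\Phi_t^{\varsigma,\varphi})_\kappa-(\Phi_s^{\varsigma,\varphi})_\kappa-\sum_\eta(\Phi^{\varsigma,\varphi}_s)'_{\kappa\eta}\delta Y^\eta_{s,t}|\le C_\varphi|t-s|^{2\alpha}$; (3) for $s\le t$, $\varsigma_t(\varphi)-\varsigma_s(\varphi)=\int_s^t\big(\varsigma_r(A_r^{\mathbf Y}\varphi)-\sum_{\kappa,\lambda}(\Phi_r^{\varsigma,\varphi})_\kappa\dot{[\mathbf Y]}^{\kappa\lambda}_r\varsigma_r(h_\lambda(r))\big)dr+\sum_\kappa(\Phi_s^{\varsigma,\varphi})_\kappa\delta Y^\kappa_{s,t}+\sum_{\kappa,\lambda}(\Phi_s^{\varsigma,\varphi})'_{\lambda\kappa}\mathbb Y^{\kappa\lambda}_{s,t}+o(|t-s|)$ as $|t-s|\to0$. *)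

theory Defs
  imports "HOL-Analysis.Analysis"
begin

section \<open>Hoelder spaces of functions on Euclidean space\<close>

fun times_cont_diff :: "nat \<Rightarrow> ('a::euclidean_space \<Rightarrow> 'v::real_normed_vector) \<Rightarrow> bool" where
  "times_cont_diff 0 f \<longleftrightarrow> continuous_on UNIV f"
| "times_cont_diff (Suc n) f \<longleftrightarrow>
     (\<forall>x. f differentiable (at x)) \<and> (\<forall>v. times_cont_diff n (\<lambda>x. frechet_derivative f (at x) v))"

text \<open>The \<open>j\<close>-th derivative at \<open>x\<close> is represented by the map sending a list of \<open>j\<close> directions
  to the iterated directional derivative of \<open>f\<close> at \<open>x\<close>, and its size is the operator norm of this
  multilinear map. Norms and suprema that are not known to be finite take values in \<^typ>\<open>ennreal\<close>.\<close>

fun dirderivs :: "'a::euclidean_space list \<Rightarrow> ('a \<Rightarrow> 'v::real_normed_vector) \<Rightarrow> 'a \<Rightarrow> 'v" where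
  "dirderivs [] f x = f x"
| "dirderivs (v # vs) f x = frechet_derivative (dirderivs vs f) (at x) v"

definition multi_norm :: "nat \<Rightarrow> ('a::euclidean_space list \<Rightarrow> 'v::real_normed_vector) \<Rightarrow> ennreal" where
  "multi_norm j M = (SUP vs\<in>{vs. length vs = j \<and> (\<forall>v\<in>set vs. norm v \<le> 1)}. ennreal (norm (M vs)))"

text \<open>A regularity index \<open>\<beta> > 0\<close> is split as \<open>\<beta> = N + \<kappa>\<close> with \<open>N\<close> a natural number and
  \<open>\<kappa> \<in> (0,1]\<close>; for an integer \<open>\<beta>\<close> this means \<open>N = \<beta> - 1\<close> and \<open>\<kappa> = 1\<close>.\<close>

definition hoelder_order :: "real \<Rightarrow> nat" where
  "hoelder_order \<beta> = nat (\<lceil>\<beta>\<rceil> - 1)"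

definition hoelder_exponent :: "real \<Rightarrow> real" where
  "hoelder_exponent \<beta> = \<beta> - real (hoelder_order \<beta>)"

definition Cb_norm :: "real \<Rightarrow> ('a::euclidean_space \<Rightarrow> 'v::real_normed_vector) \<Rightarrow> ennreal" where
  "Cb_norm \<beta> f =
     (\<Sum>j\<le>hoelder_order \<beta>. SUP x. multi_norm j (\<lambda>vs. dirderivs vs f x))
     + (SUP x. SUP y\<in>- {x}. multi_norm (hoelder_order \<beta>) (\<lambda>vs. dirderivs vs f x - dirderivs vs f y)
          / ennreal (dist x y powr hoelder_exponent \<beta>))"

definition Cb :: "real \<Rightarrow> ('a::euclidean_space \<Rightarrow> 'v::real_normed_vector) set" where
  "Cb \<beta> = {f. times_cont_diff (hoelder_order \<beta>) f \<and> Cb_norm \<beta> f < \<infinity>}"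

text \<open>The Borel sigma-algebra of the normed space \<open>Cb \<beta>\<close>.\<close>

definition Cb_borel :: "real \<Rightarrow> ('a::euclidean_space \<Rightarrow> 'v::real_normed_vector) measure" where
  "Cb_borel \<beta> = sigma (Cb \<beta>)
     {U. U \<subseteq> Cb \<beta> \<and>
         (\<forall>u\<in>U. \<exists>e>0. \<forall>v\<in>Cb \<beta>. Cb_norm \<beta> (\<lambda>x. v x - u x) < ennreal e \<longrightarrow> v \<in> U)}"


section \<open>Rough paths\<close>

text \<open>Only the values on \<open>[0,T]\<close>, respectively for \<open>0 \<le> s \<le> t \<le> T\<close>, are meaningful.
  Elements of the tensor product are matrices.\<close>

type_synonym 'dy rough = "(real \<Rightarrow> real ^ 'dy) \<times> (real \<Rightarrow> real \<Rightarrow> real ^ 'dy ^ 'dy)"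

definition tensor :: "real ^ 'n \<Rightarrow> real ^ 'n \<Rightarrow> real ^ 'n ^ 'n" where
  "tensor x y = (\<chi> i j. x $ i * y $ j)"

definition incr :: "(real \<Rightarrow> 'v::real_normed_vector) \<Rightarrow> real \<Rightarrow> real \<Rightarrow> 'v" where
  "incr Y s t = Y t - Y s"

text \<open>The seminorm \<open>sup\<^bsub>s<t\<^esub> Z\<^bsub>s,t\<^esub> / |t - s|\<^sup>\<gamma>\<close> of a nonnegative two-parameter quantity \<open>Z\<close>.\<close>

definition two_param_sup :: "real \<Rightarrow> real \<Rightarrow> (real \<Rightarrow> real \<Rightarrow> ennreal) \<Rightarrow> ennreal" where
  "two_param_sup T \<gamma> Z = (SUP s\<in>{0..T}. SUP t\<in>{s<..T}. Z s t / ennreal ((t - s) powr \<gamma>))"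

definition hnorm :: "real \<Rightarrow> real \<Rightarrow> (real \<Rightarrow> real \<Rightarrow> 'v::real_normed_vector) \<Rightarrow> ennreal" where
  "hnorm T \<gamma> \<Xi> = two_param_sup T \<gamma> (\<lambda>s t. ennreal (norm (\<Xi> s t)))"

definition chen :: "real \<Rightarrow> ('dy::finite) rough \<Rightarrow> bool" where
  "chen T \<Y> \<longleftrightarrow> (\<forall>s u t. 0 \<le> s \<and> s \<le> u \<and> u \<le> t \<and> t \<le> T \<longrightarrow>
     snd \<Y> s t = snd \<Y> s u + snd \<Y> u t + tensor (incr (fst \<Y>) s u) (incr (fst \<Y>) u t))"

definition rough_paths :: "real \<Rightarrow> real \<Rightarrow> ('dy::finite) rough set" where
  "rough_paths T \<alpha> = {\<Y>. chen T \<Y> \<and> hnorm T \<alpha> (incr (fst \<Y>)) + hnorm T (2 * \<alpha>) (snd \<Y>) < \<infinity>}"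

definition rough_dist :: "real \<Rightarrow> real \<Rightarrow> ('dy::finite) rough \<Rightarrow> 'dy rough \<Rightarrow> ennreal" where
  "rough_dist T \<alpha> \<Y> \<Z> =
     hnorm T \<alpha> (\<lambda>s t. incr (fst \<Y>) s t - incr (fst \<Z>) s t)
     + hnorm T (2 * \<alpha>) (\<lambda>s t. snd \<Y> s t - snd \<Z> s t)"

text \<open>Smoothness on the closed interval and on the closed simplex means being the restriction
  of a smooth function on the full space. The second level is not assumed to be the
  iterated integral of the first.\<close>

definition smooth_rough_paths :: "real \<Rightarrow> ('dy::finite) rough set" where
  "smooth_rough_paths T = {\<Y>. chen T \<Y> \<and>
     (\<exists>G :: real \<Rightarrow> real ^ 'dy. (\<forall>n. times_cont_diff n G) \<and> (\<forall>t\<in>{0..T}. fst \<Y> t = G t)) \<and>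
     (\<exists>F :: real \<times> real \<Rightarrow> real ^ 'dy ^ 'dy. (\<forall>n. times_cont_diff n F) \<and>
        (\<forall>s t. 0 \<le> s \<and> s \<le> t \<and> t \<le> T \<longrightarrow> snd \<Y> s t = F (s, t)))}"

text \<open>The bracket is normalised to vanish at time 0, i.e. it is the path \<open>t \<mapsto> \<delta>[Y]\<^bsub>0,t\<^esub>\<close>.\<close>

definition bracket :: "('dy::finite) rough \<Rightarrow> real \<Rightarrow> real ^ 'dy ^ 'dy" where
  "bracket \<Y> t =
     tensor (incr (fst \<Y>) 0 t) (incr (fst \<Y>) 0 t) - snd \<Y> 0 t - transpose (snd \<Y> 0 t)"

definition bracket_deriv :: "real \<Rightarrow> ('dy::finite) rough \<Rightarrow> real \<Rightarrow> real ^ 'dy ^ 'dy" where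
  "bracket_deriv T \<Y> t = vector_derivative (bracket \<Y>) (at t within {0..T})"

definition rough_paths_C1 :: "real \<Rightarrow> real \<Rightarrow> ('dy::finite) rough set" where
  "rough_paths_C1 T \<alpha> = {\<Y> \<in> rough_paths T \<alpha>.
     (\<forall>e>0. \<exists>\<Z>\<in>smooth_rough_paths T. rough_dist T \<alpha> \<Y> \<Z> < ennreal e) \<and>
     (\<forall>t\<in>{0..T}. bracket \<Y> differentiable (at t within {0..T})) \<and>
     continuous_on {0..T} (bracket_deriv T \<Y>)}"


section \<open>Controlled vector fields and coefficients\<close>

text \<open>In \<open>g'\<close> the first argument of the bilinear map is the one contracted with the increment of \<open>Y\<close>.\<close>

definition controlled_vf ::
  "real \<Rightarrow> real \<Rightarrow> real \<Rightarrow> (real \<Rightarrow> real ^ 'dy)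
   \<Rightarrow> (real \<Rightarrow> 'a::euclidean_space \<Rightarrow> ((real ^ 'dy) \<Rightarrow>\<^sub>L 'v::real_normed_vector))
   \<Rightarrow> (real \<Rightarrow> 'a \<Rightarrow> ((real ^ 'dy) \<Rightarrow>\<^sub>L ((real ^ 'dy) \<Rightarrow>\<^sub>L 'v))) \<Rightarrow> bool" where
  "controlled_vf T \<alpha> \<beta> Y g g' \<longleftrightarrow> 1 < \<beta> \<and>
     g \<in> restrict_space borel {0..T} \<rightarrow>\<^sub>M Cb_borel \<beta> \<and>
     g' \<in> restrict_space borel {0..T} \<rightarrow>\<^sub>M Cb_borel (\<beta> - 1) \<and>
     (SUP t\<in>{0..T}. Cb_norm \<beta> (g t)) + (SUP t\<in>{0..T}. Cb_norm (\<beta> - 1) (g' t)) < \<infinity> \<and>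
     (\<Sum>j\<le>hoelder_order \<beta>. two_param_sup T \<alpha>
        (\<lambda>s t. SUP x. multi_norm j (\<lambda>vs. dirderivs vs (g t) x - dirderivs vs (g s) x)))
     + (\<Sum>j<hoelder_order \<beta>.
          two_param_sup T \<alpha>
            (\<lambda>s t. SUP x. multi_norm j (\<lambda>vs. dirderivs vs (g' t) x - dirderivs vs (g' s) x))
        + two_param_sup T (2 * \<alpha>)
            (\<lambda>s t. SUP x. multi_norm j (\<lambda>vs. dirderivs vs (g t) x - dirderivs vs (g s) x
               - blinfun_apply (dirderivs vs (g' s) x) (incr Y s t)))) < \<infinity>"

record ('dx, 'dy, 'db) coeffs =
  coef_b  :: "real \<Rightarrow> real ^ 'dx \<Rightarrow> real ^ 'dx"
  coef_\<sigma>  :: "real \<Rightarrow> real ^ 'dx \<Rightarrow> ((real ^ 'db) \<Rightarrow>\<^sub>L (real ^ 'dx))"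
  coef_f  :: "real \<Rightarrow> real ^ 'dx \<Rightarrow> ((real ^ 'dy) \<Rightarrow>\<^sub>L (real ^ 'dx))"
  coef_f' :: "real \<Rightarrow> real ^ 'dx \<Rightarrow> ((real ^ 'dy) \<Rightarrow>\<^sub>L ((real ^ 'dy) \<Rightarrow>\<^sub>L (real ^ 'dx)))"
  coef_h  :: "real \<Rightarrow> real ^ 'dx \<Rightarrow> ((real ^ 'dy) \<Rightarrow>\<^sub>L real)"
  coef_h' :: "real \<Rightarrow> real ^ 'dx \<Rightarrow> ((real ^ 'dy) \<Rightarrow>\<^sub>L ((real ^ 'dy) \<Rightarrow>\<^sub>L real))"

definition jointly_measurable ::
  "real \<Rightarrow> (real \<Rightarrow> 'a::euclidean_space \<Rightarrow> 'w::real_normed_vector) \<Rightarrow> bool" where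
  "jointly_measurable T g \<longleftrightarrow>
     (\<lambda>(t, x). g t x) \<in> borel_measurable (restrict_space borel ({0..T} \<times> UNIV))"

definition bounded_uniformly_lipschitz ::
  "real \<Rightarrow> (real \<Rightarrow> 'a::euclidean_space \<Rightarrow> 'w::real_normed_vector) \<Rightarrow> bool" where
  "bounded_uniformly_lipschitz T g \<longleftrightarrow>
     (\<exists>K. \<forall>t\<in>{0..T}. \<forall>x. norm (g t x) \<le> K) \<and> (\<exists>L. \<forall>t\<in>{0..T}. L-lipschitz_on UNIV (g t))"

text \<open>The coefficients are a family indexed by rough paths. The Gubinelli derivatives
  \<open>f'\<close> and \<open>h'\<close> belong to the data, because the operators below depend on their choice, whereas
  \<open>\<beta>\<close> is only required to exist.\<close>

definition assumption_E ::
  "real \<Rightarrow> real \<Rightarrow> (('dy::finite) rough \<Rightarrow> ('dx::finite, 'dy, 'db::finite) coeffs) \<Rightarrow> bool" where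
  "assumption_E T \<alpha> C \<longleftrightarrow> (\<forall>\<Y>\<in>rough_paths_C1 T \<alpha>.
     jointly_measurable T (coef_b (C \<Y>)) \<and> jointly_measurable T (coef_\<sigma> (C \<Y>)) \<and>
     jointly_measurable T (coef_f (C \<Y>)) \<and> jointly_measurable T (coef_f' (C \<Y>)) \<and>
     jointly_measurable T (coef_h (C \<Y>)) \<and> jointly_measurable T (coef_h' (C \<Y>)) \<and>
     bounded_uniformly_lipschitz T (coef_b (C \<Y>)) \<and>
     bounded_uniformly_lipschitz T (coef_\<sigma> (C \<Y>)) \<and>
     (\<exists>\<beta>. 1 / \<alpha> < \<beta> \<and> \<beta> \<le> 3 \<and>
        controlled_vf T \<alpha> \<beta> (fst \<Y>) (coef_f (C \<Y>)) (coef_f' (C \<Y>))) \<and>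
     controlled_vf T \<alpha> 2 (fst \<Y>) (coef_h (C \<Y>)) (coef_h' (C \<Y>)))"


section \<open>Operators\<close>

definition cmp :: "((real ^ 'n) \<Rightarrow>\<^sub>L 'v::real_normed_vector) \<Rightarrow> 'n \<Rightarrow> 'v" where
  "cmp L \<kappa> = blinfun_apply L (axis \<kappa> 1)"

text \<open>\<open>cmp2 M \<kappa> \<eta>\<close> is the component \<open>g'\<^bsub>\<kappa>\<eta>\<^esub>\<close>, for which
  \<open>\<delta>(g\<^sub>\<kappa>) \<approx> \<Sum>\<^sub>\<eta> g'\<^bsub>\<kappa>\<eta>\<^esub> \<delta>Y\<^sup>\<eta>\<close>; hence the second index enters the first slot of \<open>M\<close>.\<close>

definition cmp2 :: "((real ^ 'n) \<Rightarrow>\<^sub>L ((real ^ 'n) \<Rightarrow>\<^sub>L 'v::real_normed_vector)) \<Rightarrow> 'n \<Rightarrow> 'n \<Rightarrow> 'v" where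
  "cmp2 M \<kappa> \<eta> = blinfun_apply (blinfun_apply M (axis \<eta> 1)) (axis \<kappa> 1)"

definition opA :: "real \<Rightarrow> ('dx::finite, 'dy::finite, 'db::finite) coeffs \<Rightarrow> 'dy rough \<Rightarrow> real
    \<Rightarrow> (real ^ 'dx \<Rightarrow> real) \<Rightarrow> real ^ 'dx \<Rightarrow> real" where
  "opA T c \<Y> t \<phi> x =
     (\<Sum>i\<in>UNIV. (coef_b c t x $ i
         + (\<Sum>k\<in>UNIV. \<Sum>l\<in>UNIV.
              cmp (coef_f c t x) k $ i * bracket_deriv T \<Y> t $ k $ l * cmp (coef_h c t x) l))
       * dirderivs [axis i 1] \<phi> x)
     + 1 / 2 * (\<Sum>i\<in>UNIV. \<Sum>j\<in>UNIV.
         ((\<Sum>\<theta>\<in>UNIV. cmp (coef_\<sigma> c t x) \<theta> $ i * cmp (coef_\<sigma> c t x) \<theta> $ j)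
          + (\<Sum>k\<in>UNIV. \<Sum>l\<in>UNIV.
               cmp (coef_f c t x) k $ i * bracket_deriv T \<Y> t $ k $ l * cmp (coef_f c t x) l $ j))
         * dirderivs [axis i 1, axis j 1] \<phi> x)"

definition opG :: "('dx::finite, 'dy::finite, 'db::finite) coeffs \<Rightarrow> real \<Rightarrow> 'dy
    \<Rightarrow> (real ^ 'dx \<Rightarrow> real) \<Rightarrow> real ^ 'dx \<Rightarrow> real" where
  "opG c t k \<phi> x =
     (\<Sum>i\<in>UNIV. cmp (coef_f c t x) k $ i * dirderivs [axis i 1] \<phi> x) + cmp (coef_h c t x) k * \<phi> x"

definition opG' :: "('dx::finite, 'dy::finite, 'db::finite) coeffs \<Rightarrow> real \<Rightarrow> 'dy \<Rightarrow> 'dy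
    \<Rightarrow> (real ^ 'dx \<Rightarrow> real) \<Rightarrow> real ^ 'dx \<Rightarrow> real" where
  "opG' c t k l \<phi> x =
     (\<Sum>i\<in>UNIV. cmp2 (coef_f' c t x) k l $ i * dirderivs [axis i 1] \<phi> x)
     + cmp2 (coef_h' c t x) k l * \<phi> x"

text \<open>The combination \<open>\<Gamma>\<^sub>\<kappa> \<Gamma>\<^sub>\<lambda> \<phi> + \<Gamma>'\<^bsub>\<lambda>\<kappa>\<^esub> \<phi>\<close>; note the swapped indices in the second summand.\<close>

definition opGG :: "('dx::finite, 'dy::finite, 'db::finite) coeffs \<Rightarrow> real \<Rightarrow> 'dy \<Rightarrow> 'dy
    \<Rightarrow> (real ^ 'dx \<Rightarrow> real) \<Rightarrow> real ^ 'dx \<Rightarrow> real" where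
  "opGG c t k l \<phi> x = opG c t k (opG c t l \<phi>) x + opG' c t l k \<phi> x"


section \<open>The rough Zakai and Kushner--Stratonovich equations\<close>

definition finite_borel :: "'a::topological_space measure \<Rightarrow> bool" where
  "finite_borel M \<longleftrightarrow> finite_measure M \<and> sets M = sets borel"

definition weakly_continuous_curve ::
  "real \<Rightarrow> (real \<Rightarrow> 'a::euclidean_space measure) \<Rightarrow> bool" where
  "weakly_continuous_curve T \<mu> \<longleftrightarrow> (\<forall>t\<in>{0..T}. finite_borel (\<mu> t)) \<and>
     (\<forall>\<phi> :: 'a \<Rightarrow> real. continuous_on UNIV \<phi> \<and> bounded (range \<phi>) \<longrightarrow>
        continuous_on {0..T} (\<lambda>t. \<integral>x. \<phi> x \<partial>\<mu> t))"

text \<open>\<open>R\<^bsub>s,t\<^esub> = o(|t - s|)\<close> as \<open>|t - s| \<rightarrow> 0\<close>, uniformly over \<open>0 \<le> s \<le> t \<le> T\<close>.\<close>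

definition little_o_increment :: "real \<Rightarrow> (real \<Rightarrow> real \<Rightarrow> real) \<Rightarrow> bool" where
  "little_o_increment T R \<longleftrightarrow> (\<forall>e>0. \<exists>d>0. \<forall>s t.
     0 \<le> s \<and> s \<le> t \<and> t \<le> T \<and> t - s < d \<longrightarrow> \<bar>R s t\<bar> \<le> e * (t - s))"

definition zakai_solution ::
  "real \<Rightarrow> real \<Rightarrow> ('dx::finite, 'dy::finite, 'db::finite) coeffs \<Rightarrow> 'dy rough
   \<Rightarrow> (real \<Rightarrow> (real ^ 'dx) measure) \<Rightarrow> bool" where
  "zakai_solution T \<alpha> c \<Y> \<mu> \<longleftrightarrow>
     weakly_continuous_curve T \<mu> \<and>
     (\<forall>\<phi>\<in>Cb 3. set_integrable lborel {0..T} (\<lambda>t. \<integral>x. opA T c \<Y> t \<phi> x \<partial>\<mu> t)) \<and>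
     (\<forall>B::real. \<exists>K>0. \<forall>\<phi>\<in>Cb 3. Cb_norm 3 \<phi> \<le> ennreal B \<longrightarrow>
        (\<forall>s t. 0 \<le> s \<and> s \<le> t \<and> t \<le> T \<longrightarrow>
           (\<forall>k l. \<bar>(\<integral>x. opGG c t k l \<phi> x \<partial>\<mu> t) - (\<integral>x. opGG c s k l \<phi> x \<partial>\<mu> s)\<bar>
                    \<le> K * (t - s) powr \<alpha>) \<and>
           (\<forall>k. \<bar>(\<integral>x. opG c t k \<phi> x \<partial>\<mu> t) - (\<integral>x. opG c s k \<phi> x \<partial>\<mu> s)
                    - (\<Sum>m\<in>UNIV. (\<integral>x. opGG c s m k \<phi> x \<partial>\<mu> s) * incr (fst \<Y>) s t $ m)\<bar>
                    \<le> K * (t - s) powr (2 * \<alpha>)))) \<and>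
     (\<forall>\<phi>\<in>Cb 3. little_o_increment T (\<lambda>s t.
        (\<integral>x. \<phi> x \<partial>\<mu> t) - (\<integral>x. \<phi> x \<partial>\<mu> s)
        - (LINT r:{s..t}|lborel. (\<integral>x. opA T c \<Y> r \<phi> x \<partial>\<mu> r))
        - (\<Sum>k\<in>UNIV. (\<integral>x. opG c s k \<phi> x \<partial>\<mu> s) * incr (fst \<Y>) s t $ k)
        - (\<Sum>k\<in>UNIV. \<Sum>l\<in>UNIV. (\<integral>x. opGG c s k l \<phi> x \<partial>\<mu> s) * snd \<Y> s t $ k $ l)))"

context
  fixes c :: "('dx::finite, 'dy::finite, 'db::finite) coeffs"
    and \<zeta> :: "real \<Rightarrow> (real ^ 'dx) measure"
begin

definition mean_h :: "real \<Rightarrow> 'dy \<Rightarrow> real" where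
  "mean_h t k = (\<integral>x. cmp (coef_h c t x) k \<partial>\<zeta> t)"

definition Phi :: "(real ^ 'dx \<Rightarrow> real) \<Rightarrow> real \<Rightarrow> 'dy \<Rightarrow> real" where
  "Phi \<phi> t k = (\<integral>x. opG c t k \<phi> x \<partial>\<zeta> t) - (\<integral>x. \<phi> x \<partial>\<zeta> t) * mean_h t k"

text \<open>The Gubinelli derivatives of \<open>\<zeta>(\<Gamma>\<^sub>k \<phi>)\<close> and of \<open>\<zeta>(\<phi>)\<close> in direction \<open>m\<close>.\<close>

definition mean_G_deriv :: "(real ^ 'dx \<Rightarrow> real) \<Rightarrow> real \<Rightarrow> 'dy \<Rightarrow> 'dy \<Rightarrow> real" where
  "mean_G_deriv \<phi> t k m =
     (\<integral>x. opGG c t m k \<phi> x \<partial>\<zeta> t) - (\<integral>x. opG c t k \<phi> x \<partial>\<zeta> t) * mean_h t m"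

definition mean_deriv :: "(real ^ 'dx \<Rightarrow> real) \<Rightarrow> real \<Rightarrow> 'dy \<Rightarrow> real" where
  "mean_deriv \<phi> t m = (\<integral>x. opG c t m \<phi> x \<partial>\<zeta> t) - (\<integral>x. \<phi> x \<partial>\<zeta> t) * mean_h t m"

definition Phi' :: "(real ^ 'dx \<Rightarrow> real) \<Rightarrow> real \<Rightarrow> 'dy \<Rightarrow> 'dy \<Rightarrow> real" where
  "Phi' \<phi> t k l = mean_G_deriv \<phi> t k l - mean_deriv \<phi> t l * mean_h t k
     - (\<integral>x. \<phi> x \<partial>\<zeta> t) * mean_G_deriv (\<lambda>_. 1) t k l"

end

definition kushner_stratonovich_solution ::
  "real \<Rightarrow> real \<Rightarrow> ('dx::finite, 'dy::finite, 'db::finite) coeffs \<Rightarrow> 'dy rough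
   \<Rightarrow> (real \<Rightarrow> (real ^ 'dx) measure) \<Rightarrow> bool" where
  "kushner_stratonovich_solution T \<alpha> c \<Y> \<zeta> \<longleftrightarrow>
     weakly_continuous_curve T \<zeta> \<and>
     (\<forall>\<phi>\<in>Cb 3.
        set_integrable lborel {0..T} (\<lambda>t. \<integral>x. opA T c \<Y> t \<phi> x \<partial>\<zeta> t) \<and>
        set_integrable lborel {0..T} (\<lambda>t. \<Sum>k\<in>UNIV. \<Sum>l\<in>UNIV.
          Phi c \<zeta> \<phi> t k * bracket_deriv T \<Y> t $ k $ l * mean_h c \<zeta> t l)) \<and>
     (\<forall>B::real. \<exists>K>0. \<forall>\<phi>\<in>Cb 3. Cb_norm 3 \<phi> \<le> ennreal B \<longrightarrow>
        (\<forall>s t. 0 \<le> s \<and> s \<le> t \<and> t \<le> T \<longrightarrow>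
           (\<forall>k l. \<bar>Phi' c \<zeta> \<phi> t k l - Phi' c \<zeta> \<phi> s k l\<bar> \<le> K * (t - s) powr \<alpha>) \<and>
           (\<forall>k. \<bar>Phi c \<zeta> \<phi> t k - Phi c \<zeta> \<phi> s k
                    - (\<Sum>m\<in>UNIV. Phi' c \<zeta> \<phi> s k m * incr (fst \<Y>) s t $ m)\<bar>
                    \<le> K * (t - s) powr (2 * \<alpha>)))) \<and>
     (\<forall>\<phi>\<in>Cb 3. little_o_increment T (\<lambda>s t.
        (\<integral>x. \<phi> x \<partial>\<zeta> t) - (\<integral>x. \<phi> x \<partial>\<zeta> s)
        - (LINT r:{s..t}|lborel. (\<integral>x. opA T c \<Y> r \<phi> x \<partial>\<zeta> r)
             - (\<Sum>k\<in>UNIV. \<Sum>l\<in>UNIV.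
                  Phi c \<zeta> \<phi> r k * bracket_deriv T \<Y> r $ k $ l * mean_h c \<zeta> r l))
        - (\<Sum>k\<in>UNIV. Phi c \<zeta> \<phi> s k * incr (fst \<Y>) s t $ k)
        - (\<Sum>k\<in>UNIV. \<Sum>l\<in>UNIV. Phi' c \<zeta> \<phi> s l k * snd \<Y> s t $ k $ l)))"

definition normalized :: "'a measure \<Rightarrow> 'a measure" where
  "normalized M = scale_measure (1 / emeasure M (space M)) M"

end

theory Submission
  imports Defs
begin

text \<open>Fix a test function \<open>\<phi>\<close> and write \<open>p\<^sub>t = \<mu>\<^sub>t(\<phi>)\<close>, \<open>m\<^sub>t = \<mu>\<^sub>t(1)\<close>, \<open>q = p / m\<close>. The Zakai equation
  says that \<open>p\<close> and \<open>m\<close> have second-order expansions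
  \<open>\<delta>p = \<integral> a dr + \<Sum> G\<^sub>k \<delta>Y\<^sup>k + \<Sum> GG\<^sub>k\<^sub>l YY\<^sup>k\<^sup>l + o(|t - s|)\<close> and
  \<open>\<delta>m = \<Sum> H\<^sub>k \<delta>Y\<^sup>k + \<Sum> HH\<^sub>k\<^sub>l YY\<^sup>k\<^sup>l + o(|t - s|)\<close>, where \<open>m\<close> has no drift because \<open>A 1 = 0\<close>.
  With \<open>D = (\<delta>p - q \<delta>m) / m\<close> and \<open>d = \<delta>m / m\<close>, the quotient has the exact expansion
  \<open>\<delta>q = D - D d + D d \<delta>m / m\<^sub>t\<close>, whose last term is \<open>O(|t - s|\<^sup>3\<^sup>\<alpha>)\<close> and hence negligible, as
  \<open>3 \<alpha> > 1\<close>. The term \<open>D\<close> carries the first-order coefficient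
  \<open>\<Phi>\<^sub>k = G\<^sub>k / m - q H\<^sub>k / m\<close>. Up to \<open>O(|t - s|\<^sup>3\<^sup>\<alpha>)\<close>, the term \<open>D d\<close> equals
  \<open>\<Sum> \<Phi>\<^sub>k (H\<^sub>l / m) \<delta>Y\<^sup>k \<delta>Y\<^sup>l\<close>, and the bracket identity \<open>\<delta>Y \<otimes> \<delta>Y = YY + YY\<^sup>T + \<delta>[Y]\<close> splits it
  into a correction of the second-order coefficients and the drift
  \<open>\<Sum> \<Phi>\<^sub>k (d[Y]\<^sup>k\<^sup>l/dr) H\<^sub>l / m\<close>. Comparing coefficients shows that the result is the
  Kushner--Stratonovich equation; this is the content of \<open>quot_expansion_identity\<close> and
  \<open>quot_rough_expansion\<close>.\<close>

text \<open>The regularity of \<open>\<Phi>\<close> is a matter of calculus for controlled paths: \<open>p\<close>, \<open>m\<close>, \<open>G\<close> and \<open>H\<close> are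
  controlled by \<open>Y\<close>, and controlled paths are closed under products and under inverses of functions
  that stay away from zero. The Gubinelli derivative produced by these rules is \<open>\<Phi>'\<close>.
  The delicate point is uniformity over bounded sets of test functions, since
  the \<open>o(|t - s|)\<close> in the Zakai equation may depend on \<open>\<phi>\<close> in an arbitrary way. Chen's relation
  shows that the remainder of the expansion is almost additive, with a defect of order \<open>|t - s|\<^sup>3\<^sup>\<alpha>\<close>
  that is uniform in \<open>\<phi>\<close>. By dyadic bisection (\<open>sewing_remainder\<close>) a remainder that is
  \<open>o(|t - s|)\<close> and has such a defect is itself bounded by the defect, so the remainder is
  \<open>O(|t - s|\<^sup>3\<^sup>\<alpha>)\<close> uniformly in \<open>\<phi>\<close>. To keep track of this uniformity all estimates are made for
  families of paths with common constants. The uniform bounds on \<open>a\<close>, \<open>G\<close> and \<open>GG\<close> needed to start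
  come from pointwise bounds on the operators \<open>A\<close>, \<open>\<Gamma>\<close> and \<open>\<Gamma>\<Gamma> + \<Gamma>'\<close>.\<close>

section \<open>Families of paths with common bounds\<close>

definition bounded_family :: "real \<Rightarrow> 'i set \<Rightarrow> ('i \<Rightarrow> real \<Rightarrow> real) \<Rightarrow> bool" where
  "bounded_family T S F \<longleftrightarrow> (\<exists>K. \<forall>i\<in>S. \<forall>t\<in>{0..T}. \<bar>F i t\<bar> \<le> K)"

text \<open>Since \<open>0 powr \<gamma> = 0\<close>, the bound includes \<open>Z\<^sub>s\<^sub>s = 0\<close>.\<close>

definition order_family :: "real \<Rightarrow> real \<Rightarrow> 'i set \<Rightarrow> ('i \<Rightarrow> real \<Rightarrow> real \<Rightarrow> real) \<Rightarrow> bool" where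
  "order_family T \<gamma> S Z \<longleftrightarrow>
     (\<exists>K. \<forall>i\<in>S. \<forall>s t. 0 \<le> s \<and> s \<le> t \<and> t \<le> T \<longrightarrow> \<bar>Z i s t\<bar> \<le> K * (t - s) powr \<gamma>)"

lemma bounded_familyI: "(\<And>i t. i \<in> S \<Longrightarrow> 0 \<le> t \<Longrightarrow> t \<le> T \<Longrightarrow> \<bar>F i t\<bar> \<le> K) \<Longrightarrow> bounded_family T S F"
  unfolding bounded_family_def by (intro exI[of _ K]) auto

lemma bounded_familyE:
  assumes "bounded_family T S F"
  obtains K where "K > 0" "\<forall>i t. i \<in> S \<longrightarrow> 0 \<le> t \<longrightarrow> t \<le> T \<longrightarrow> \<bar>F i t\<bar> \<le> K"
proof -
  obtain K where K: "\<forall>i\<in>S. \<forall>t\<in>{0..T}. \<bar>F i t\<bar> \<le> K"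
    using assms unfolding bounded_family_def by blast
  show ?thesis
  proof (rule that[of "max K 1"])
    show "max K 1 > 0" by simp
    show "\<forall>i t. i \<in> S \<longrightarrow> 0 \<le> t \<longrightarrow> t \<le> T \<longrightarrow> \<bar>F i t\<bar> \<le> max K 1"
      using K by (auto simp: le_max_iff_disj)
  qed
qed

lemma order_familyI:
  "(\<And>i s t. i \<in> S \<Longrightarrow> 0 \<le> s \<Longrightarrow> s \<le> t \<Longrightarrow> t \<le> T \<Longrightarrow> \<bar>Z i s t\<bar> \<le> K * (t - s) powr \<gamma>)
   \<Longrightarrow> order_family T \<gamma> S Z"
  unfolding order_family_def by (intro exI[of _ K]) auto

lemma order_familyE:
  assumes "order_family T \<gamma> S Z"
  obtains K where "K > 0"
    "\<forall>i s t. i \<in> S \<longrightarrow> 0 \<le> s \<longrightarrow> s \<le> t \<longrightarrow> t \<le> T \<longrightarrow> \<bar>Z i s t\<bar> \<le> K * (t - s) powr \<gamma>"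
proof -
  obtain K where K: "\<forall>i\<in>S. \<forall>s t. 0 \<le> s \<and> s \<le> t \<and> t \<le> T \<longrightarrow> \<bar>Z i s t\<bar> \<le> K * (t - s) powr \<gamma>"
    using assms unfolding order_family_def by blast
  show ?thesis
  proof (rule that[of "max K 1"])
    show "max K 1 > 0" by simp
    show "\<forall>i s t. i \<in> S \<longrightarrow> 0 \<le> s \<longrightarrow> s \<le> t \<longrightarrow> t \<le> T
        \<longrightarrow> \<bar>Z i s t\<bar> \<le> max K 1 * (t - s) powr \<gamma>"
    proof (intro allI impI)
      fix i s t assume that: "i \<in> S" "0 \<le> s" "s \<le> t" "t \<le> T"
      have "\<bar>Z i s t\<bar> \<le> K * (t - s) powr \<gamma>" using K that by blast
      also have "\<dots> \<le> max K 1 * (t - s) powr \<gamma>" by (intro mult_right_mono) auto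
      finally show "\<bar>Z i s t\<bar> \<le> max K 1 * (t - s) powr \<gamma>" .
    qed
  qed
qed

lemma bounded_family_add:
  assumes "bounded_family T S F" "bounded_family T S G"
  shows "bounded_family T S (\<lambda>i t. F i t + G i t)"
proof -
  obtain K where K: "K > 0" "\<forall>i t. i \<in> S \<longrightarrow> 0 \<le> t \<longrightarrow> t \<le> T \<longrightarrow> \<bar>F i t\<bar> \<le> K"
    using bounded_familyE[OF assms(1)] by blast
  obtain L where L: "L > 0" "\<forall>i t. i \<in> S \<longrightarrow> 0 \<le> t \<longrightarrow> t \<le> T \<longrightarrow> \<bar>G i t\<bar> \<le> L"
    using bounded_familyE[OF assms(2)] by blast
  show ?thesis
  proof (rule bounded_familyI[where K="K + L"])
    fix i t assume *: "i \<in> S" "0 \<le> t" "t \<le> T"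
    show "\<bar>F i t + G i t\<bar> \<le> K + L" using K(2)[rule_format, OF *] L(2)[rule_format, OF *] by linarith
  qed
qed

lemma bounded_family_mult:
  assumes "bounded_family T S F" "bounded_family T S G"
  shows "bounded_family T S (\<lambda>i t. F i t * G i t)"
proof -
  obtain K where K: "K > 0" "\<forall>i t. i \<in> S \<longrightarrow> 0 \<le> t \<longrightarrow> t \<le> T \<longrightarrow> \<bar>F i t\<bar> \<le> K"
    using bounded_familyE[OF assms(1)] by blast
  obtain L where L: "L > 0" "\<forall>i t. i \<in> S \<longrightarrow> 0 \<le> t \<longrightarrow> t \<le> T \<longrightarrow> \<bar>G i t\<bar> \<le> L"
    using bounded_familyE[OF assms(2)] by blast
  show ?thesis
    by (intro bounded_familyI[where K="K * L"]) (use K L in \<open>auto simp: abs_mult intro!: mult_mono\<close>)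
qed

lemma bounded_family_uminus: "bounded_family T S F \<Longrightarrow> bounded_family T S (\<lambda>i t. - F i t)"
  unfolding bounded_family_def by simp

lemma bounded_family_diff:
  assumes "bounded_family T S F" "bounded_family T S G"
  shows "bounded_family T S (\<lambda>i t. F i t - G i t)"
  using bounded_family_add[OF assms(1) bounded_family_uminus[OF assms(2)]] by simp

lemma bounded_family_const: "bounded_family T S (\<lambda>_ _. c)"
  by (rule bounded_familyI[where K="\<bar>c\<bar>"]) simp

lemma bounded_family_sum:
  assumes "\<And>k. k \<in> A \<Longrightarrow> bounded_family T S (F k)"
  shows "bounded_family T S (\<lambda>i t. \<Sum>k\<in>A. F k i t)"
  using assms
  by (induction A rule: infinite_finite_induct) (auto intro: bounded_family_add bounded_family_const)

lemma order_family_add: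
  assumes "order_family T \<gamma> S F" "order_family T \<gamma> S G"
  shows "order_family T \<gamma> S (\<lambda>i s t. F i s t + G i s t)"
proof -
  obtain K where K: "K > 0" "\<forall>i s t. i \<in> S \<longrightarrow> 0 \<le> s \<longrightarrow> s \<le> t \<longrightarrow> t \<le> T \<longrightarrow> \<bar>F i s t\<bar> \<le> K * (t - s) powr \<gamma>"
    using order_familyE[OF assms(1)] by blast
  obtain L where L: "L > 0" "\<forall>i s t. i \<in> S \<longrightarrow> 0 \<le> s \<longrightarrow> s \<le> t \<longrightarrow> t \<le> T \<longrightarrow> \<bar>G i s t\<bar> \<le> L * (t - s) powr \<gamma>"
    using order_familyE[OF assms(2)] by blast
  show ?thesis
  proof (rule order_familyI[where K="K + L"])
    fix i s t assume *: "i \<in> S" "0 \<le> s" "s \<le> t" "t \<le> T"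
    show "\<bar>F i s t + G i s t\<bar> \<le> (K + L) * (t - s) powr \<gamma>"
      using K(2)[rule_format, OF *] L(2)[rule_format, OF *] by (simp add: algebra_simps)
  qed
qed

lemma order_family_uminus: "order_family T \<gamma> S F \<Longrightarrow> order_family T \<gamma> S (\<lambda>i s t. - F i s t)"
  unfolding order_family_def by simp

lemma order_family_diff:
  assumes "order_family T \<gamma> S F" "order_family T \<gamma> S G"
  shows "order_family T \<gamma> S (\<lambda>i s t. F i s t - G i s t)"
  using order_family_add[OF assms(1) order_family_uminus[OF assms(2)]] by simp

lemma order_family_zero: "order_family T \<gamma> S (\<lambda>_ _ _. 0)"
  by (rule order_familyI[where K=0]) simp

lemma order_family_sum:
  assumes "\<And>k. k \<in> A \<Longrightarrow> order_family T \<gamma> S (F k)"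
  shows "order_family T \<gamma> S (\<lambda>i s t. \<Sum>k\<in>A. F k i s t)"
  using assms
  by (induction A rule: infinite_finite_induct) (auto intro: order_family_add order_family_zero)

text \<open>Orders add under multiplication; this is what makes products of three increments negligible.\<close>

lemma order_family_mult:
  assumes "order_family T \<gamma> S F" "order_family T \<delta> S G"
  shows "order_family T (\<gamma> + \<delta>) S (\<lambda>i s t. F i s t * G i s t)"
proof -
  obtain K where K: "K > 0"
    "\<forall>i s t. i \<in> S \<longrightarrow> 0 \<le> s \<longrightarrow> s \<le> t \<longrightarrow> t \<le> T \<longrightarrow> \<bar>F i s t\<bar> \<le> K * (t - s) powr \<gamma>"
    using order_familyE[OF assms(1)] by blast
  obtain L where L: "L > 0"
    "\<forall>i s t. i \<in> S \<longrightarrow> 0 \<le> s \<longrightarrow> s \<le> t \<longrightarrow> t \<le> T \<longrightarrow> \<bar>G i s t\<bar> \<le> L * (t - s) powr \<delta>"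
    using order_familyE[OF assms(2)] by blast
  show ?thesis
  proof (rule order_familyI[where K="K * L"])
    fix i s t assume *: "i \<in> S" "0 \<le> s" "s \<le> t" "t \<le> T"
    have "\<bar>F i s t * G i s t\<bar> \<le> (K * (t - s) powr \<gamma>) * (L * (t - s) powr \<delta>)"
      unfolding abs_mult using K(2)[rule_format, OF *] L(2)[rule_format, OF *] K(1) by (intro mult_mono) auto
    then show "\<bar>F i s t * G i s t\<bar> \<le> (K * L) * (t - s) powr (\<gamma> + \<delta>)"
      by (simp add: powr_add mult_ac)
  qed
qed

lemma order_family_bounded_mult:
  assumes "bounded_family T S F" "order_family T \<gamma> S Z"
  shows "order_family T \<gamma> S (\<lambda>i s t. F i s * Z i s t)"
    and "order_family T \<gamma> S (\<lambda>i s t. F i t * Z i s t)"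
proof -
  obtain K where K: "K > 0" "\<forall>i t. i \<in> S \<longrightarrow> 0 \<le> t \<longrightarrow> t \<le> T \<longrightarrow> \<bar>F i t\<bar> \<le> K"
    using bounded_familyE[OF assms(1)] by blast
  obtain L where L: "L > 0"
    "\<forall>i s t. i \<in> S \<longrightarrow> 0 \<le> s \<longrightarrow> s \<le> t \<longrightarrow> t \<le> T \<longrightarrow> \<bar>Z i s t\<bar> \<le> L * (t - s) powr \<gamma>"
    using order_familyE[OF assms(2)] by blast
  have *: "\<bar>F i r * Z i s t\<bar> \<le> (K * L) * (t - s) powr \<gamma>"
    if "i \<in> S" "0 \<le> s" "s \<le> t" "t \<le> T" "0 \<le> r" "r \<le> T" for i r s t
    using mult_mono[OF K(2)[rule_format, OF that(1,5,6)] L(2)[rule_format, OF that(1-4)]] K(1) by (simp add: abs_mult mult_ac)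
  show "order_family T \<gamma> S (\<lambda>i s t. F i s * Z i s t)" by (rule order_familyI) (rule *; simp)
  show "order_family T \<gamma> S (\<lambda>i s t. F i t * Z i s t)" by (rule order_familyI) (rule *; simp)
qed

lemma order_family_mono:
  assumes "order_family T \<gamma> S Z" "\<delta> \<le> \<gamma>"
  shows "order_family T \<delta> S Z"
proof -
  obtain K where K: "K > 0"
    "\<forall>i s t. i \<in> S \<longrightarrow> 0 \<le> s \<longrightarrow> s \<le> t \<longrightarrow> t \<le> T \<longrightarrow> \<bar>Z i s t\<bar> \<le> K * (t - s) powr \<gamma>"
    using order_familyE[OF assms(1)] by blast
  show ?thesis
  proof (rule order_familyI[where K="K * T powr (\<gamma> - \<delta>)"])
    fix i s t assume *: "i \<in> S" "0 \<le> s" "s \<le> t" "t \<le> T"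
    have "(t - s) powr \<gamma> = (t - s) powr (\<gamma> - \<delta>) * (t - s) powr \<delta>" by (simp flip: powr_add)
    also have "\<dots> \<le> T powr (\<gamma> - \<delta>) * (t - s) powr \<delta>"
      using * assms(2) by (intro mult_right_mono powr_mono2) auto
    finally have "K * (t - s) powr \<gamma> \<le> K * (T powr (\<gamma> - \<delta>) * (t - s) powr \<delta>)"
      using K(1) by (intro mult_left_mono) auto
    then show "\<bar>Z i s t\<bar> \<le> (K * T powr (\<gamma> - \<delta>)) * (t - s) powr \<delta>"
      using K(2)[rule_format, OF *] by (simp add: mult.assoc)
  qed
qed

lemma order_family_cong:
  assumes "order_family T \<gamma> S Z"
    and "\<And>i s t. i \<in> S \<Longrightarrow> 0 \<le> s \<Longrightarrow> s \<le> t \<Longrightarrow> t \<le> T \<Longrightarrow> Z i s t = W i s t"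
  shows "order_family T \<gamma> S W"
proof -
  obtain K where K: "K > 0"
    "\<forall>i s t. i \<in> S \<longrightarrow> 0 \<le> s \<longrightarrow> s \<le> t \<longrightarrow> t \<le> T \<longrightarrow> \<bar>Z i s t\<bar> \<le> K * (t - s) powr \<gamma>"
    using order_familyE[OF assms(1)] by blast
  show ?thesis
  proof (rule order_familyI[where K=K])
    fix i s t assume *: "i \<in> S" "0 \<le> s" "s \<le> t" "t \<le> T"
    show "\<bar>W i s t\<bar> \<le> K * (t - s) powr \<gamma>"
      using K(2)[rule_format, OF *] unfolding assms(2)[OF *] .
  qed
qed

lemma order_family_increment_mult:
  assumes "bounded_family T S F" "bounded_family T S G"
    and "order_family T \<gamma> S (\<lambda>i s t. F i t - F i s)" "order_family T \<gamma> S (\<lambda>i s t. G i t - G i s)"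
  shows "order_family T \<gamma> S (\<lambda>i s t. F i t * G i t - F i s * G i s)"
proof -
  have "(\<lambda>i s t. F i t * G i t - F i s * G i s)
      = (\<lambda>i s t. F i t * (G i t - G i s) + G i s * (F i t - F i s))"
    by (intro ext) (simp add: algebra_simps)
  then show ?thesis
    using order_family_add[OF order_family_bounded_mult(2)[OF assms(1,4)]
        order_family_bounded_mult(1)[OF assms(2,3)]] by simp
qed

lemma order_family_abs: "order_family T \<gamma> S Z \<Longrightarrow> order_family T \<gamma> S (\<lambda>i s t. \<bar>Z i s t\<bar>)"
  unfolding order_family_def by simp

text \<open>The defect of additivity of a germ is a sum of products of one quantity on \<open>[s,u]\<close> and another on
  \<open>[u,t]\<close>. Both are estimated on the whole interval \<open>[s,t]\<close>.\<close>

lemma order_family_sum_mult_adjacent: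
  fixes Z W :: "'k \<Rightarrow> 'i \<Rightarrow> real \<Rightarrow> real \<Rightarrow> real"
  assumes A: "finite A"
    and Z: "\<And>k. k \<in> A \<Longrightarrow> order_family T \<gamma> S (Z k)"
    and W: "\<And>k. k \<in> A \<Longrightarrow> order_family T \<delta> S (W k)"
    and "\<gamma> > 0" "\<delta> > 0"
  shows "\<exists>K. \<forall>i s u t. i \<in> S \<longrightarrow> 0 \<le> s \<longrightarrow> s \<le> u \<longrightarrow> u \<le> t \<longrightarrow> t \<le> T \<longrightarrow>
           \<bar>\<Sum>k\<in>A. Z k i s u * W k i u t\<bar> \<le> K * (t - s) powr (\<gamma> + \<delta>)"
proof -
  have "order_family T \<gamma> S (\<lambda>i s t. \<Sum>k\<in>A. \<bar>Z k i s t\<bar>)"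
    using Z by (intro order_family_sum order_family_abs)
  then obtain K where K: "K > 0" "\<forall>i s t. i \<in> S \<longrightarrow> 0 \<le> s \<longrightarrow> s \<le> t \<longrightarrow> t \<le> T
      \<longrightarrow> \<bar>\<Sum>k\<in>A. \<bar>Z k i s t\<bar>\<bar> \<le> K * (t - s) powr \<gamma>"
    using order_familyE by blast
  have "order_family T \<delta> S (\<lambda>i s t. \<Sum>k\<in>A. \<bar>W k i s t\<bar>)"
    using W by (intro order_family_sum order_family_abs)
  then obtain L where L: "L > 0" "\<forall>i s t. i \<in> S \<longrightarrow> 0 \<le> s \<longrightarrow> s \<le> t \<longrightarrow> t \<le> T
      \<longrightarrow> \<bar>\<Sum>k\<in>A. \<bar>W k i s t\<bar>\<bar> \<le> L * (t - s) powr \<delta>"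
    using order_familyE by blast
  show ?thesis
  proof (intro exI[of _ "K * L"] allI impI)
    fix i s u t assume i: "i \<in> S" and t: "0 \<le> s" "s \<le> u" "u \<le> t" "t \<le> T"
    have "\<bar>\<Sum>k\<in>A. \<bar>Z k i s u\<bar>\<bar> \<le> K * (u - s) powr \<gamma>" using K(2) i t by simp
    also have "\<dots> \<le> K * (t - s) powr \<gamma>"
      using K(1) t assms(4) by (intro mult_left_mono powr_mono2) auto
    finally have Zb: "(\<Sum>k\<in>A. \<bar>Z k i s u\<bar>) \<le> K * (t - s) powr \<gamma>" by simp
    have "\<bar>\<Sum>k\<in>A. \<bar>W k i u t\<bar>\<bar> \<le> L * (t - u) powr \<delta>" using L(2) i t by simp
    also have "\<dots> \<le> L * (t - s) powr \<delta>"
      using L(1) t assms(5) by (intro mult_left_mono powr_mono2) auto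
    finally have Wb: "(\<Sum>k\<in>A. \<bar>W k i u t\<bar>) \<le> L * (t - s) powr \<delta>" by simp
    have "\<bar>\<Sum>k\<in>A. Z k i s u * W k i u t\<bar> \<le> (\<Sum>k\<in>A. \<bar>Z k i s u\<bar> * \<bar>W k i u t\<bar>)"
      by (rule order_trans[OF sum_abs]) (simp add: abs_mult)
    also have "\<dots> \<le> (\<Sum>k\<in>A. \<bar>Z k i s u\<bar> * (\<Sum>k\<in>A. \<bar>W k i u t\<bar>))"
      using A by (intro sum_mono mult_left_mono member_le_sum) auto
    also have "\<dots> = (\<Sum>k\<in>A. \<bar>Z k i s u\<bar>) * (\<Sum>k\<in>A. \<bar>W k i u t\<bar>)"
      by (simp add: sum_distrib_right)
    also have "\<dots> \<le> (K * (t - s) powr \<gamma>) * (L * (t - s) powr \<delta>)"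
      using Zb Wb K(1) by (intro mult_mono) (auto intro: sum_nonneg)
    finally show "\<bar>\<Sum>k\<in>A. Z k i s u * W k i u t\<bar> \<le> K * L * (t - s) powr (\<gamma> + \<delta>)"
      by (simp add: powr_add mult_ac)
  qed
qed

text \<open>Finitely many families can be given the same constant, so that components may be treated as
  part of the index.\<close>

lemma order_family_finite_index:
  fixes Z :: "'k::finite \<Rightarrow> 'i \<Rightarrow> real \<Rightarrow> real \<Rightarrow> real"
  assumes "\<And>k. order_family T \<gamma> S (Z k)"
  shows "order_family T \<gamma> (UNIV \<times> S) (\<lambda>x. Z (fst x) (snd x))"
proof -
  have "order_family T \<gamma> S (\<lambda>i s t. \<Sum>k\<in>UNIV. \<bar>Z k i s t\<bar>)"
    using assms by (intro order_family_sum order_family_abs)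
  then obtain K where K: "K > 0" "\<forall>i s t. i \<in> S \<longrightarrow> 0 \<le> s \<longrightarrow> s \<le> t \<longrightarrow> t \<le> T
      \<longrightarrow> \<bar>\<Sum>k\<in>UNIV. \<bar>Z k i s t\<bar>\<bar> \<le> K * (t - s) powr \<gamma>"
    by (rule order_familyE)
  show ?thesis
  proof (rule order_familyI[where K=K])
    fix x s t assume x: "x \<in> (UNIV :: 'k set) \<times> S" and t: "0 \<le> s" "s \<le> t" "t \<le> T"
    have "\<bar>Z (fst x) (snd x) s t\<bar> \<le> (\<Sum>k\<in>UNIV. \<bar>Z k (snd x) s t\<bar>)"
      by (rule member_le_sum) auto
    also have "\<dots> \<le> K * (t - s) powr \<gamma>" using K(2) x t by (force dest: abs_le_D1)
    finally show "\<bar>Z (fst x) (snd x) s t\<bar> \<le> K * (t - s) powr \<gamma>" .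
  qed
qed

lemma continuous_on_if_order_family_increment:
  assumes "order_family T \<gamma> S (\<lambda>i s t. F i t - F i s)" "\<gamma> > 0" "i \<in> S"
  shows "continuous_on {0..T} (F i)"
proof -
  obtain K where K: "K > 0"
    "\<forall>i s t. i \<in> S \<longrightarrow> 0 \<le> s \<longrightarrow> s \<le> t \<longrightarrow> t \<le> T \<longrightarrow> \<bar>F i t - F i s\<bar> \<le> K * (t - s) powr \<gamma>"
    using order_familyE[OF assms(1)] by blast
  have bnd: "\<bar>F i t - F i s\<bar> \<le> K * \<bar>t - s\<bar> powr \<gamma>" if "s \<in> {0..T}" "t \<in> {0..T}" for s t
  proof (cases "s \<le> t")
    case True
    then show ?thesis using K(2)[rule_format, of i s t] that assms(3) by simp
  next
    case False
    then show ?thesis using K(2)[rule_format, of i t s] that assms(3) by (simp add: abs_minus_commute)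
  qed
  show ?thesis
    unfolding continuous_on_def
  proof
    fix s assume s: "s \<in> {0..T}"
    have "((\<lambda>t. K * \<bar>t - s\<bar> powr \<gamma>) \<longlongrightarrow> K * \<bar>s - s\<bar> powr \<gamma>) (at s within {0..T})"
      using assms(2) by (intro tendsto_intros tendsto_powr' ) auto
    then have lim: "((\<lambda>t. K * \<bar>t - s\<bar> powr \<gamma>) \<longlongrightarrow> 0) (at s within {0..T})" by simp
    have "((\<lambda>t. F i t - F i s) \<longlongrightarrow> 0) (at s within {0..T})"
      by (rule Lim_null_comparison[OF _ lim])
        (use bnd s in \<open>auto simp: eventually_at_filter\<close>)
    then show "(F i \<longlongrightarrow> F i s) (at s within {0..T})" by (simp add: Lim_null[symmetric])
  qed
qed

lemma bounded_family_if_continuous_on: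
  assumes "continuous_on {0..T} F"
  shows "bounded_family T S (\<lambda>_. F)"
proof -
  have "bounded (F ` {0..T})" using assms by (intro compact_imp_bounded compact_continuous_image) auto
  then obtain K where "\<forall>t\<in>{0..T}. \<bar>F t\<bar> \<le> K" by (auto simp: bounded_iff)
  then show ?thesis by (intro bounded_familyI[where K=K]) auto
qed

lemma little_o_increment_if_order_family:
  assumes "order_family T \<gamma> S Z" "\<gamma> > 1" "i \<in> S"
  shows "little_o_increment T (Z i)"
  unfolding little_o_increment_def
proof (intro allI impI)
  fix e :: real assume e: "e > 0"
  obtain K where K: "K > 0"
    "\<forall>i s t. i \<in> S \<longrightarrow> 0 \<le> s \<longrightarrow> s \<le> t \<longrightarrow> t \<le> T \<longrightarrow> \<bar>Z i s t\<bar> \<le> K * (t - s) powr \<gamma>"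
    using order_familyE[OF assms(1)] by blast
  \<comment> \<open>Chosen such that \<open>K d\<^sup>\<gamma>\<^sup>-\<^sup>1 = e\<close>.\<close>
  define d where "d = (e / K) powr (1 / (\<gamma> - 1))"
  have d: "d > 0" and dK: "K * d powr (\<gamma> - 1) = e"
    using e K(1) assms(2) by (simp_all add: d_def powr_powr)
  have "\<bar>Z i s t\<bar> \<le> e * (t - s)" if "0 \<le> s \<and> s \<le> t \<and> t \<le> T \<and> t - s < d" for s t
  proof -
    have "(t - s) powr \<gamma> = (t - s) powr (\<gamma> - 1) * (t - s)"
      using that by (cases "t = s") (simp_all add: powr_diff)
    also have "\<dots> \<le> d powr (\<gamma> - 1) * (t - s)"
      using that assms(2) by (intro mult_right_mono powr_mono2) auto
    finally have "K * (t - s) powr \<gamma> \<le> K * (d powr (\<gamma> - 1) * (t - s))"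
      using K(1) by (intro mult_left_mono) auto
    also have "\<dots> = e * (t - s)" by (simp flip: dK)
    finally show ?thesis using K(2)[rule_format, OF assms(3), of s t] that by linarith
  qed
  then show "\<exists>d>0. \<forall>s t. 0 \<le> s \<and> s \<le> t \<and> t \<le> T \<and> t - s < d \<longrightarrow> \<bar>Z i s t\<bar> \<le> e * (t - s)"
    using d by blast
qed

lemma little_o_increment_add:
  assumes "little_o_increment T Z" "little_o_increment T W"
  shows "little_o_increment T (\<lambda>s t. Z s t + W s t)"
  unfolding little_o_increment_def
proof (intro allI impI)
  fix e :: real assume e: "e > 0"
  have e2: "e / 2 > 0" using e by simp
  obtain d1 where d1: "d1 > 0" "\<forall>s t. 0 \<le> s \<and> s \<le> t \<and> t \<le> T \<and> t - s < d1 \<longrightarrow> \<bar>Z s t\<bar> \<le> e / 2 * (t - s)"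
    using assms(1)[unfolded little_o_increment_def, rule_format, OF e2] by blast
  obtain d2 where d2: "d2 > 0" "\<forall>s t. 0 \<le> s \<and> s \<le> t \<and> t \<le> T \<and> t - s < d2 \<longrightarrow> \<bar>W s t\<bar> \<le> e / 2 * (t - s)"
    using assms(2)[unfolded little_o_increment_def, rule_format, OF e2] by blast
  show "\<exists>d>0. \<forall>s t. 0 \<le> s \<and> s \<le> t \<and> t \<le> T \<and> t - s < d \<longrightarrow> \<bar>Z s t + W s t\<bar> \<le> e * (t - s)"
  proof (intro exI[of _ "min d1 d2"] conjI allI impI)
    fix s t assume *: "0 \<le> s \<and> s \<le> t \<and> t \<le> T \<and> t - s < min d1 d2"
    then have "\<bar>Z s t\<bar> \<le> e / 2 * (t - s)" "\<bar>W s t\<bar> \<le> e / 2 * (t - s)" using d1(2) d2(2) by auto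
    then show "\<bar>Z s t + W s t\<bar> \<le> e * (t - s)" by linarith
  qed (use d1 d2 in auto)
qed

lemma little_o_increment_bounded_mult:
  assumes "little_o_increment T Z" "\<And>s. 0 \<le> s \<Longrightarrow> s \<le> T \<Longrightarrow> \<bar>F s\<bar> \<le> K"
  shows "little_o_increment T (\<lambda>s t. F s * Z s t)"
  unfolding little_o_increment_def
proof (intro allI impI)
  fix e :: real assume e: "e > 0"
  have K: "max K 1 > 0" by simp
  then have "e / max K 1 > 0" using e by simp
  then obtain d where d: "d > 0"
    "\<forall>s t. 0 \<le> s \<and> s \<le> t \<and> t \<le> T \<and> t - s < d \<longrightarrow> \<bar>Z s t\<bar> \<le> e / max K 1 * (t - s)"
    using assms(1)[unfolded little_o_increment_def, rule_format] by blast
  have "\<bar>F s * Z s t\<bar> \<le> e * (t - s)" if "0 \<le> s \<and> s \<le> t \<and> t \<le> T \<and> t - s < d" for s t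
  proof -
    have "\<bar>F s * Z s t\<bar> \<le> max K 1 * (e / max K 1 * (t - s))"
      unfolding abs_mult using assms(2)[of s] d(2) that by (intro mult_mono) auto
    then show ?thesis using K by simp
  qed
  then show "\<exists>d>0. \<forall>s t. 0 \<le> s \<and> s \<le> t \<and> t \<le> T \<and> t - s < d \<longrightarrow> \<bar>F s * Z s t\<bar> \<le> e * (t - s)"
    using d(1) by blast
qed

lemma little_o_increment_cong:
  assumes "little_o_increment T Z"
    and "\<And>s t. 0 \<le> s \<Longrightarrow> s \<le> t \<Longrightarrow> t \<le> T \<Longrightarrow> Z s t = W s t"
  shows "little_o_increment T W"
  unfolding little_o_increment_def
proof (intro allI impI)
  fix e :: real assume "e > 0"
  then obtain d where "d > 0"
    "\<forall>s t. 0 \<le> s \<and> s \<le> t \<and> t \<le> T \<and> t - s < d \<longrightarrow> \<bar>Z s t\<bar> \<le> e * (t - s)"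
    using assms(1) unfolding little_o_increment_def by blast
  then show "\<exists>d>0. \<forall>s t. 0 \<le> s \<and> s \<le> t \<and> t \<le> T \<and> t - s < d \<longrightarrow> \<bar>W s t\<bar> \<le> e * (t - s)"
    by (intro exI[of _ d]) (auto simp flip: assms(2))
qed

section \<open>Remainders with small additivity defect\<close>

text \<open>Bisecting \<open>[s,t]\<close> gives \<open>|R\<^sub>s\<^sub>t| \<le> |R\<^sub>s\<^sub>u| + |R\<^sub>u\<^sub>t| + K |t - s|\<^sup>\<gamma>\<close>. If both halves satisfy the bound
  \<open>C |t - s|\<^sup>\<gamma> + \<epsilon> |t - s|\<close>, then so does \<open>[s,t]\<close>, provided that \<open>2\<^sup>1\<^sup>-\<^sup>\<gamma> C + K = C\<close>. For intervals
  shorter than some \<open>d\<close> the bound is the assumed smallness of \<open>R\<close>, so it spreads by induction to all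
  intervals, and then \<open>\<epsilon>\<close> can be sent to zero. The constant \<open>C\<close> depends on \<open>K\<close> and \<open>\<gamma>\<close> alone and not
  on the rate in the \<open>o(|t - s|)\<close>; hence the conclusion is uniform even though the smallness is not.\<close>

lemma sewing_remainder:
  assumes "\<gamma> > 1"
    and small: "\<And>i. i \<in> S \<Longrightarrow> little_o_increment T (R i)"
    and defect: "\<And>i s u t. i \<in> S \<Longrightarrow> 0 \<le> s \<Longrightarrow> s \<le> u \<Longrightarrow> u \<le> t \<Longrightarrow> t \<le> T \<Longrightarrow>
        \<bar>R i s t - R i s u - R i u t\<bar> \<le> K * (t - s) powr \<gamma>"
  shows "order_family T \<gamma> S R"
proof -
  \<comment> \<open>The solution of \<open>2\<^sup>1\<^sup>-\<^sup>\<gamma> C + K = C\<close>; it has the sign of \<open>K\<close> because \<open>\<gamma> > 1\<close>.\<close>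
  define C where "C = K / (1 - 2 powr (1 - \<gamma>))"
  have "(2::real) powr (1 - \<gamma>) < 1" using assms(1) by (simp add: powr_less_one)
  then have "C * (1 - 2 powr (1 - \<gamma>)) = K" using assms(1) by (simp add: C_def)
  then have C: "C * 2 powr (1 - \<gamma>) + K = C" by (simp add: algebra_simps)
  show ?thesis
  proof (rule order_familyI[where K=C])
    fix i s t assume i: "i \<in> S" and st: "0 \<le> s" "s \<le> t" "t \<le> T"
    show "\<bar>R i s t\<bar> \<le> C * (t - s) powr \<gamma>"
    proof (rule field_le_epsilon)
      fix e' :: real assume "e' > 0"
      \<comment> \<open>All intervals have length at most \<open>T\<close>, so the error \<open>e (t - s)\<close> stays below \<open>e'\<close>.\<close>
      define e where "e = e' / (T + 1)"
      have T: "T + 1 > 0" using st by linarith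
      have e: "e > 0" using \<open>e' > 0\<close> T by (simp add: e_def)
      obtain d where d: "d > 0"
        "\<forall>s t. 0 \<le> s \<and> s \<le> t \<and> t \<le> T \<and> t - s < d \<longrightarrow> \<bar>R i s t\<bar> \<le> e * (t - s)"
        using small[OF i] e unfolding little_o_increment_def by blast
      have defect': "\<bar>R i a b - R i a ((a + b) / 2) - R i ((a + b) / 2) b\<bar> \<le> K * (b - a) powr \<gamma>"
        if "0 \<le> a" "a \<le> b" "b \<le> T" for a b
        using defect[OF i, of a "(a + b) / 2" b] that by simp
      have Kpos: "K * (b - a) powr \<gamma> \<ge> 0" if "0 \<le> a" "a \<le> b" "b \<le> T" for a b
        using defect'[OF that] by linarith
      have Cpos: "C * (b - a) powr \<gamma> \<ge> 0" if "0 \<le> a" "a \<le> b" "b \<le> T" for a b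
        using Kpos[OF that] \<open>(2::real) powr (1 - \<gamma>) < 1\<close> by (simp add: C_def)
      have "\<bar>R i a b\<bar> \<le> C * (b - a) powr \<gamma> + e * (b - a)"
        if "0 \<le> a" "a \<le> b" "b \<le> T" "b - a < 2 ^ n * d" for n a b
        using that
      proof (induction n arbitrary: a b)
        case 0
        then have "\<bar>R i a b\<bar> \<le> e * (b - a)" using d(2) by simp
        then show ?case using Cpos[OF 0(1-3)] by linarith
      next
        case (Suc n)
        define u where "u = (a + b) / 2"
        have u: "u - a = (b - a) / 2" "b - u = (b - a) / 2" "a \<le> u" "u \<le> b"
          using Suc.prems by (simp_all add: u_def field_simps)
        have *: "\<bar>R i a u\<bar> \<le> C * (u - a) powr \<gamma> + e * (u - a)"
          "\<bar>R i u b\<bar> \<le> C * (b - u) powr \<gamma> + e * (b - u)"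
          using Suc.prems u by (auto intro!: Suc.IH)
        have "((b - a) / 2) powr \<gamma> * 2 = 2 powr (1 - \<gamma>) * (b - a) powr \<gamma>"
          using Suc.prems by (simp add: powr_divide powr_diff)
        then have "2 * (C * ((b - a) / 2) powr \<gamma>) + K * (b - a) powr \<gamma>
            = (C * 2 powr (1 - \<gamma>) + K) * (b - a) powr \<gamma>"
          by (simp add: algebra_simps)
        also have "\<dots> = C * (b - a) powr \<gamma>" by (simp only: C)
        finally show ?case
          using * defect'[OF Suc.prems(1-3)] unfolding u u_def[symmetric] by (simp add: field_simps)
      qed
      moreover obtain n where "t - s < 2 ^ n * d"
        using real_arch_pow[of 2 "(t - s) / d"] d(1) by (auto simp: field_simps)
      ultimately have "\<bar>R i s t\<bar> \<le> C * (t - s) powr \<gamma> + e * (t - s)" using st by blast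
      moreover have "e * (t - s) \<le> e * (T + 1)" using st e by (intro mult_left_mono) auto
      moreover have "e * (T + 1) = e'" using T by (simp add: e_def)
      ultimately show "\<bar>R i s t\<bar> \<le> C * (t - s) powr \<gamma> + e'" by linarith
    qed
  qed
qed

section \<open>Calculus of controlled paths\<close>

text \<open>A family of real paths \<open>F\<close>, uniformly bounded and controlled by \<open>Y\<close> with uniformly bounded
  Gubinelli derivative \<open>F'\<close>.\<close>

definition controlled_family ::
  "real \<Rightarrow> real \<Rightarrow> (real \<Rightarrow> real ^ 'dy) \<Rightarrow> 'i set \<Rightarrow> ('i \<Rightarrow> real \<Rightarrow> real) \<Rightarrow> ('i \<Rightarrow> real \<Rightarrow> 'dy::finite \<Rightarrow> real)
   \<Rightarrow> bool" where
  "controlled_family T \<alpha> Y S F F' \<longleftrightarrow>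
     bounded_family T S F \<and>
     (\<forall>k. bounded_family T S (\<lambda>i t. F' i t k) \<and>
          order_family T \<alpha> S (\<lambda>i s t. F' i t k - F' i s k)) \<and>
     order_family T (2 * \<alpha>) S (\<lambda>i s t. F i t - F i s - (\<Sum>k\<in>UNIV. F' i s k * incr Y s t $ k))"

context
  fixes T \<alpha> :: real and Y :: "real \<Rightarrow> real ^ 'dy::finite" and S :: "'i set"
  assumes \<alpha>: "0 < \<alpha>"
    and Y: "\<And>k. order_family T \<alpha> S (\<lambda>_ s t. incr Y s t $ k)"
begin

lemma controlled_family_order_increment:
  assumes "controlled_family T \<alpha> Y S F F'"
  shows "order_family T \<alpha> S (\<lambda>i s t. F i t - F i s)"
proof -
  have "order_family T \<alpha> S (\<lambda>i s t. F i t - F i s - (\<Sum>k\<in>UNIV. F' i s k * incr Y s t $ k))"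
    using assms \<alpha> unfolding controlled_family_def by (auto intro: order_family_mono)
  moreover have "order_family T \<alpha> S (\<lambda>i s t. \<Sum>k\<in>UNIV. F' i s k * incr Y s t $ k)"
    using assms Y unfolding controlled_family_def
    by (intro order_family_sum order_family_bounded_mult(1)) auto
  ultimately have "order_family T \<alpha> S (\<lambda>i s t. (F i t - F i s - (\<Sum>k\<in>UNIV. F' i s k * incr Y s t $ k))
      + (\<Sum>k\<in>UNIV. F' i s k * incr Y s t $ k))"
    by (rule order_family_add)
  then show ?thesis by simp
qed

lemma controlled_family_diff:
  assumes "controlled_family T \<alpha> Y S F F'" "controlled_family T \<alpha> Y S G G'"
  shows "controlled_family T \<alpha> Y S (\<lambda>i t. F i t - G i t) (\<lambda>i t k. F' i t k - G' i t k)"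
proof -
  let ?R = "\<lambda>F F' i s t. F i t - F i s - (\<Sum>k\<in>UNIV. F' i s k * incr Y s t $ k)"
  have "order_family T (2 * \<alpha>) S (\<lambda>i s t. ?R F F' i s t - ?R G G' i s t)"
    using assms unfolding controlled_family_def by (auto intro: order_family_diff)
  then have "order_family T (2 * \<alpha>) S (?R (\<lambda>i t. F i t - G i t) (\<lambda>i t k. F' i t k - G' i t k))"
    by (rule order_family_cong) (simp add: sum_subtractf algebra_simps)
  moreover have "order_family T \<alpha> S (\<lambda>i s t. (F' i t k - G' i t k) - (F' i s k - G' i s k))" for k
  proof -
    have "order_family T \<alpha> S (\<lambda>i s t. (F' i t k - F' i s k) - (G' i t k - G' i s k))"
      using assms unfolding controlled_family_def by (auto intro: order_family_diff)
    then show ?thesis by (rule order_family_cong) simp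
  qed
  ultimately show ?thesis
    using assms unfolding controlled_family_def by (auto intro: bounded_family_diff)
qed

text \<open>The Leibniz rule holds because the error it leaves is \<open>\<delta>F \<delta>G\<close>, of order \<open>2 \<alpha>\<close>.\<close>

lemma controlled_family_mult:
  assumes F: "controlled_family T \<alpha> Y S F F'" and G: "controlled_family T \<alpha> Y S G G'"
  shows "controlled_family T \<alpha> Y S (\<lambda>i t. F i t * G i t) (\<lambda>i t k. F' i t k * G i t + F i t * G' i t k)"
proof -
  let ?R = "\<lambda>F F' i s t. F i t - F i s - (\<Sum>k\<in>UNIV. F' i s k * incr Y s t $ k)"
  note dF = controlled_family_order_increment[OF F] and dG = controlled_family_order_increment[OF G]
  have b: "bounded_family T S F" "bounded_family T S G"
    "\<And>k. bounded_family T S (\<lambda>i t. F' i t k)" "\<And>k. bounded_family T S (\<lambda>i t. G' i t k)"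
    and o: "\<And>k. order_family T \<alpha> S (\<lambda>i s t. F' i t k - F' i s k)"
    "\<And>k. order_family T \<alpha> S (\<lambda>i s t. G' i t k - G' i s k)"
    and r: "order_family T (2 * \<alpha>) S (?R F F')" "order_family T (2 * \<alpha>) S (?R G G')"
    using F G unfolding controlled_family_def by auto
  have "order_family T \<alpha> S (\<lambda>i s t. (F' i t k * G i t + F i t * G' i t k)
      - (F' i s k * G i s + F i s * G' i s k))" for k
  proof -
    have "order_family T \<alpha> S (\<lambda>i s t. (F' i t k * G i t - F' i s k * G i s)
        + (F i t * G' i t k - F i s * G' i s k))"
      using b o dF dG by (intro order_family_add order_family_increment_mult) auto
    then show ?thesis by (rule order_family_cong) (simp add: algebra_simps)
  qed
  moreover have "order_family T (2 * \<alpha>) S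
      (?R (\<lambda>i t. F i t * G i t) (\<lambda>i t k. F' i t k * G i t + F i t * G' i t k))"
  proof -
    have dd: "order_family T (2 * \<alpha>) S (\<lambda>i s t. (F i t - F i s) * (G i t - G i s))"
      unfolding mult_2 by (rule order_family_mult[OF dF dG])
    have "order_family T (2 * \<alpha>) S (\<lambda>i s t. (F i s * ?R G G' i s t + G i s * ?R F F' i s t)
        + (F i t - F i s) * (G i t - G i s))"
      by (intro order_family_add order_family_bounded_mult(1) b r dd)
    then show ?thesis
      by (rule order_family_cong)
        (simp add: algebra_simps sum.distrib sum_distrib_left)
  qed
  ultimately show ?thesis
    using b unfolding controlled_family_def
    by (auto intro!: bounded_family_add bounded_family_mult)
qed

text \<open>Exactly, \<open>\<delta>(1/F) = - \<delta>F / F\<^sub>s\<^sup>2 + (\<delta>F)\<^sup>2 / (F\<^sub>s\<^sup>2 F\<^sub>t)\<close>, and the last term is of order \<open>2 \<alpha>\<close>.\<close>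

lemma controlled_family_inverse:
  assumes F: "controlled_family T \<alpha> Y S F F'"
    and c: "c > 0" "\<forall>i\<in>S. \<forall>t\<in>{0..T}. F i t \<ge> c"
  shows "controlled_family T \<alpha> Y S (\<lambda>i t. 1 / F i t) (\<lambda>i t k. - (F' i t k * (1 / F i t * (1 / F i t))))"
proof -
  let ?R = "\<lambda>F F' i s t. F i t - F i s - (\<Sum>k\<in>UNIV. F' i s k * incr Y s t $ k)"
  note dF = controlled_family_order_increment[OF F]
  have nz: "F i t \<noteq> 0" if "i \<in> S" "0 \<le> t" "t \<le> T" for i t using c that by force
  have b: "bounded_family T S F" "\<And>k. bounded_family T S (\<lambda>i t. F' i t k)"
    and o: "\<And>k. order_family T \<alpha> S (\<lambda>i s t. F' i t k - F' i s k)"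
    and r: "order_family T (2 * \<alpha>) S (?R F F')"
    using F unfolding controlled_family_def by auto
  have bi: "bounded_family T S (\<lambda>i t. 1 / F i t)"
  proof (rule bounded_familyI[where K="1 / c"])
    fix i t assume "i \<in> S" "0 \<le> t" "t \<le> T"
    then have "F i t \<ge> c" using c(2) by simp
    then show "\<bar>1 / F i t\<bar> \<le> 1 / c" using c(1) by (simp add: frac_le)
  qed
  have oi: "order_family T \<alpha> S (\<lambda>i s t. 1 / F i t - 1 / F i s)"
  proof -
    have "order_family T \<alpha> S (\<lambda>i s t. - (1 / F i s * (1 / F i t * (F i t - F i s))))"
      by (intro order_family_uminus order_family_bounded_mult(1) order_family_bounded_mult(2) bi dF)
    then show ?thesis
      by (rule order_family_cong) (simp add: nz field_simps)
  qed
  have "order_family T \<alpha> S (\<lambda>i s t. (- (F' i t k * (1 / F i t * (1 / F i t))))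
      - (- (F' i s k * (1 / F i s * (1 / F i s)))))" for k
  proof -
    have "order_family T \<alpha> S (\<lambda>i s t. - (F' i t k * (1 / F i t * (1 / F i t))
        - F' i s k * (1 / F i s * (1 / F i s))))"
      by (intro order_family_uminus order_family_increment_mult bounded_family_mult bi b o oi)
    then show ?thesis by (rule order_family_cong) simp
  qed
  moreover have "order_family T (2 * \<alpha>) S
      (?R (\<lambda>i t. 1 / F i t) (\<lambda>i t k. - (F' i t k * (1 / F i t * (1 / F i t)))))"
  proof -
    have dd: "order_family T (2 * \<alpha>) S (\<lambda>i s t. (F i t - F i s) * (F i t - F i s))"
      unfolding mult_2 by (rule order_family_mult[OF dF dF])
    have "order_family T (2 * \<alpha>) S (\<lambda>i s t.
        1 / F i s * (1 / F i s * (1 / F i t * ((F i t - F i s) * (F i t - F i s))))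
        - 1 / F i s * (1 / F i s * ?R F F' i s t))"
      by (intro order_family_diff order_family_bounded_mult(1) bi r order_family_bounded_mult(2) dd)
    then show ?thesis
    proof (rule order_family_cong)
      fix i s t assume *: "i \<in> S" "0 \<le> s" "s \<le> t" "t \<le> T"
      have n: "F i s \<noteq> 0" "F i t \<noteq> 0" using nz * by auto
      define X where "X = (\<Sum>k\<in>UNIV. F' i s k * incr Y s t $ k)"
      have eq: "(\<Sum>k\<in>UNIV. - (F' i s k * (1 / F i s * (1 / F i s))) * incr Y s t $ k)
          = - (1 / F i s * (1 / F i s) * X)"
        unfolding X_def sum_distrib_left sum_negf[symmetric] by (simp add: mult_ac)
      show "1 / F i s * (1 / F i s * (1 / F i t * ((F i t - F i s) * (F i t - F i s))))
            - 1 / F i s * (1 / F i s * ?R F F' i s t)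
          = ?R (\<lambda>i t. 1 / F i t) (\<lambda>i t k. - (F' i t k * (1 / F i t * (1 / F i t)))) i s t"
        unfolding eq unfolding X_def[symmetric] using n by (simp add: field_simps)
    qed
  qed
  moreover have "bounded_family T S (\<lambda>i t. - (F' i t k * (1 / F i t * (1 / F i t))))" for k
    by (intro bounded_family_uminus bounded_family_mult bi b)
  ultimately show ?thesis
    unfolding controlled_family_def using bi by blast
qed

end

lemma controlled_family_bounded: "controlled_family T \<alpha> Y S F F' \<Longrightarrow> bounded_family T S F"
  and controlled_family_deriv_bounded:
    "controlled_family T \<alpha> Y S F F' \<Longrightarrow> bounded_family T S (\<lambda>i t. F' i t k)"
  and controlled_family_deriv_order:
    "controlled_family T \<alpha> Y S F F' \<Longrightarrow> order_family T \<alpha> S (\<lambda>i s t. F' i t k - F' i s k)"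
  and controlled_family_remainder:
    "controlled_family T \<alpha> Y S F F' \<Longrightarrow>
      order_family T (2 * \<alpha>) S (\<lambda>i s t. F i t - F i s - (\<Sum>k\<in>UNIV. F' i s k * incr Y s t $ k))"
  by (auto simp: controlled_family_def)

section \<open>Integrals over subintervals\<close>

lemma set_integral_Icc_abs_le:
  fixes f :: "real \<Rightarrow> real"
  assumes "s \<le> t" "\<And>r. s \<le> r \<Longrightarrow> r \<le> t \<Longrightarrow> \<bar>f r\<bar> \<le> K"
  shows "\<bar>LINT r:{s..t}|lborel. f r\<bar> \<le> K * (t - s)"
proof (cases "set_integrable lborel {s..t} f")
  case True
  have K: "set_integrable lborel {s..t} (\<lambda>_. K)" by (intro borel_integrable_atLeastAtMost') auto
  have "\<bar>LINT r:{s..t}|lborel. f r\<bar> \<le> (LINT r:{s..t}|lborel. \<bar>f r\<bar>)"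
    using set_integral_norm_bound[OF True] by simp
  also have "\<dots> \<le> (LINT r:{s..t}|lborel. K)"
    using True K assms(2) by (intro set_integral_mono set_integrable_abs) auto
  also have "\<dots> = K * (t - s)" using assms(1) by (simp add: set_integral_const)
  finally show ?thesis .
next
  \<comment> \<open>An integral that does not exist has the default value 0.\<close>
  case False
  moreover have "K \<ge> 0" using assms(2)[of s] assms(1) by simp
  ultimately show ?thesis
    using assms(1) by (simp add: set_integrable_def set_lebesgue_integral_def not_integrable_integral_eq)
qed

lemma set_integral_Icc_combine:
  fixes f :: "real \<Rightarrow> real"
  assumes "set_integrable lborel {s..t} f" "s \<le> u" "u \<le> t"
  shows "(LINT r:{s..t}|lborel. f r) = (LINT r:{s..u}|lborel. f r) + (LINT r:{u..t}|lborel. f r)"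
proof -
  have "set_integrable lborel {s..u} f" "set_integrable lborel {u..t} f"
    using assms by (auto intro: set_integrable_subset)
  then show ?thesis
    using Henstock_Kurzweil_Integration.integral_combine[OF assms(2,3)
        set_borel_integral_eq_integral(1)[OF assms(1)]] assms(1)
    by (simp add: set_borel_integral_eq_integral(2))
qed

lemma set_integrable_sum:
  assumes "finite A" "\<And>k. k \<in> A \<Longrightarrow> set_integrable M B (f k)"
  shows "set_integrable M B (\<lambda>x. \<Sum>k\<in>A. f k x :: real)"
  using assms unfolding set_integrable_def scaleR_sum_right by (intro Bochner_Integration.integrable_sum)

lemma set_integral_sum:
  assumes "finite A" "\<And>k. k \<in> A \<Longrightarrow> set_integrable M B (f k)"
  shows "(LINT x:B|M. (\<Sum>k\<in>A. f k x :: real)) = (\<Sum>k\<in>A. LINT x:B|M. f k x)"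
  using assms unfolding set_integrable_def set_lebesgue_integral_def scaleR_sum_right
  by (intro Bochner_Integration.integral_sum)

lemma set_integrable_mult_continuous:
  fixes f w :: "real \<Rightarrow> real"
  assumes f: "set_integrable lborel {a..b} f" and w: "continuous_on {a..b} w"
  shows "set_integrable lborel {a..b} (\<lambda>t. w t * f t)"
proof -
  have "bounded (w ` {a..b})" using w by (intro compact_imp_bounded compact_continuous_image) auto
  then obtain K where K: "\<forall>t\<in>{a..b}. \<bar>w t\<bar> \<le> K" by (auto simp: bounded_iff)
  have mw: "(\<lambda>t. indicator {a..b} t * w t) \<in> borel_measurable lborel"
    using borel_integrable_atLeastAtMost'[OF w] unfolding set_integrable_def
    by (auto dest: borel_measurable_integrable)
  have mf: "(\<lambda>t. indicator {a..b} t * f t) \<in> borel_measurable lborel"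
    using f unfolding set_integrable_def by (auto dest: borel_measurable_integrable)
  have eq: "(\<lambda>t. (indicator {a..b} t * w t) * (indicator {a..b} t * f t))
      = (\<lambda>t. indicator {a..b} t *\<^sub>R (w t * f t))"
    by (auto simp: indicator_def)
  have "set_borel_measurable lborel {a..b} (\<lambda>t. w t * f t)"
    unfolding set_borel_measurable_def eq[symmetric] by (intro borel_measurable_times mw mf)
  then show ?thesis
  proof (rule set_integrable_bound[where f="\<lambda>t. K * f t", rotated])
    show "set_integrable lborel {a..b} (\<lambda>t. K * f t)" using f by simp
    show "AE t in lborel. t \<in> {a..b} \<longrightarrow> norm (w t * f t) \<le> norm (K * f t)"
    proof (intro AE_I2 impI)
      fix t assume "t \<in> {a..b}"
      then have "\<bar>w t\<bar> \<le> \<bar>K\<bar>" using K by force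
      then show "norm (w t * f t) \<le> norm (K * f t)" by (simp add: abs_mult mult_right_mono)
    qed
  qed
qed

lemma order_family_set_integral:
  assumes "bounded_family T S a"
  shows "order_family T 1 S (\<lambda>i s t. LINT r:{s..t}|lborel. a i r)"
proof -
  obtain K where K: "K > 0" "\<forall>i t. i \<in> S \<longrightarrow> 0 \<le> t \<longrightarrow> t \<le> T \<longrightarrow> \<bar>a i t\<bar> \<le> K"
    using bounded_familyE[OF assms] by blast
  show ?thesis
  proof (rule order_familyI[where K=K])
    fix i s t assume *: "i \<in> S" "0 \<le> s" "s \<le> t" "t \<le> T"
    then show "\<bar>LINT r:{s..t}|lborel. a i r\<bar> \<le> K * (t - s) powr 1"
      using K set_integral_Icc_abs_le[of s t "a i" K] by simp
  qed
qed

text \<open>A Hoelder weight can be frozen at the left endpoint of the interval of integration at the price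
  of an error of order greater than one.\<close>

lemma order_family_set_integral_freeze:
  assumes a: "bounded_family T S a" and int: "\<And>i. i \<in> S \<Longrightarrow> set_integrable lborel {0..T} (a i)"
    and w: "order_family T \<gamma> S (\<lambda>i s t. w i t - w i s)" and \<gamma>: "\<gamma> > 0"
  shows "order_family T (\<gamma> + 1) S (\<lambda>i s t. (LINT r:{s..t}|lborel. w i r * a i r)
           - w i s * (LINT r:{s..t}|lborel. a i r))"
proof -
  obtain K where K: "K > 0" "\<forall>i t. i \<in> S \<longrightarrow> 0 \<le> t \<longrightarrow> t \<le> T \<longrightarrow> \<bar>a i t\<bar> \<le> K"
    using bounded_familyE[OF a] by blast
  obtain L where L: "L > 0"
    "\<forall>i s t. i \<in> S \<longrightarrow> 0 \<le> s \<longrightarrow> s \<le> t \<longrightarrow> t \<le> T \<longrightarrow> \<bar>w i t - w i s\<bar> \<le> L * (t - s) powr \<gamma>"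
    using order_familyE[OF w] by blast
  show ?thesis
  proof (rule order_familyI[where K="L * K"])
    fix i s t assume *: "i \<in> S" "0 \<le> s" "s \<le> t" "t \<le> T"
    have ai: "set_integrable lborel {s..t} (a i)"
      using int[OF *(1)] * by (auto intro: set_integrable_subset)
    have "continuous_on {s..t} (w i)"
      using continuous_on_if_order_family_increment[OF w \<gamma> *(1)] * by (auto intro: continuous_on_subset)
    then have wai: "set_integrable lborel {s..t} (\<lambda>r. w i r * a i r)"
      by (intro set_integrable_mult_continuous ai)
    have "(LINT r:{s..t}|lborel. w i r * a i r) - w i s * (LINT r:{s..t}|lborel. a i r)
        = (LINT r:{s..t}|lborel. (w i r - w i s) * a i r)"
      using ai wai by (simp add: left_diff_distrib)
    moreover have "\<bar>LINT r:{s..t}|lborel. (w i r - w i s) * a i r\<bar> \<le> (L * (t - s) powr \<gamma> * K) * (t - s)"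
    proof (rule set_integral_Icc_abs_le[OF *(3)])
      fix r assume r: "s \<le> r" "r \<le> t"
      have "\<bar>w i r - w i s\<bar> \<le> L * (r - s) powr \<gamma>" using L(2) * r by simp
      also have "\<dots> \<le> L * (t - s) powr \<gamma>"
        using r L(1) \<gamma> by (intro mult_left_mono powr_mono2) auto
      finally show "\<bar>(w i r - w i s) * a i r\<bar> \<le> L * (t - s) powr \<gamma> * K"
        unfolding abs_mult using K * r by (intro mult_mono) auto
    qed
    ultimately show "\<bar>(LINT r:{s..t}|lborel. w i r * a i r) - w i s * (LINT r:{s..t}|lborel. a i r)\<bar>
        \<le> L * K * (t - s) powr (\<gamma> + 1)"
      using * by (simp add: powr_add mult_ac)
  qed
qed

section \<open>Rough paths with differentiable bracket\<close>

lemma hnorm_finite_bound: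
  fixes Z :: "real \<Rightarrow> real \<Rightarrow> 'v::real_normed_vector"
  assumes "hnorm T \<gamma> Z < \<infinity>"
  shows "\<exists>K\<ge>0. \<forall>s t. 0 \<le> s \<and> s < t \<and> t \<le> T \<longrightarrow> norm (Z s t) \<le> K * (t - s) powr \<gamma>"
proof -
  obtain K where K: "hnorm T \<gamma> Z = ennreal K" "K \<ge> 0"
    using assms by (cases "hnorm T \<gamma> Z") auto
  have "norm (Z s t) \<le> K * (t - s) powr \<gamma>" if "0 \<le> s" "s < t" "t \<le> T" for s t
  proof -
    have p: "(t - s) powr \<gamma> > 0" using that by simp
    have "ennreal (norm (Z s t)) / ennreal ((t - s) powr \<gamma>) \<le> hnorm T \<gamma> Z"
      unfolding hnorm_def two_param_sup_def
      using that by (intro SUP_upper2[of s] SUP_upper2[of t]) auto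
    then have "ennreal (norm (Z s t) / (t - s) powr \<gamma>) \<le> ennreal K"
      using p K by (simp add: divide_ennreal)
    then show ?thesis using p K(2) by (simp add: field_simps)
  qed
  then show ?thesis using K(2) by blast
qed

locale rough_path_C1 =
  fixes T \<alpha> :: real and \<Y> :: "('dy::finite) rough"
  assumes T_pos: "T > 0" and \<alpha>: "1 / 3 < \<alpha>" "\<alpha> \<le> 1 / 2" and \<Y>: "\<Y> \<in> rough_paths_C1 T \<alpha>"
begin

abbreviation "dY s t k \<equiv> incr (fst \<Y>) s t $ k"
abbreviation "YY s t k l \<equiv> snd \<Y> s t $ k $ l"
abbreviation "dbr r k l \<equiv> bracket_deriv T \<Y> r $ k $ l"

lemma chen_relation:
  assumes "0 \<le> s" "s \<le> u" "u \<le> t" "t \<le> T"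
  shows "YY s t k l = YY s u k l + YY u t k l + dY s u k * dY u t l"
proof -
  have "chen T \<Y>" using \<Y> by (auto simp: rough_paths_C1_def rough_paths_def)
  then have "snd \<Y> s t = snd \<Y> s u + snd \<Y> u t + tensor (incr (fst \<Y>) s u) (incr (fst \<Y>) u t)"
    using assms unfolding chen_def by blast
  then show ?thesis by (simp add: tensor_def)
qed

lemma YY_refl: "0 \<le> s \<Longrightarrow> s \<le> T \<Longrightarrow> YY s s k l = 0"
  using chen_relation[of s s s] by (simp add: incr_def)

lemma dY_order: "order_family T \<alpha> S (\<lambda>_ s t. dY s t k)"
proof -
  have "hnorm T \<alpha> (incr (fst \<Y>)) < \<infinity>"
    using \<Y> by (auto simp: rough_paths_C1_def rough_paths_def)
  then obtain K where K: "K \<ge> 0"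
    "\<forall>s t. 0 \<le> s \<and> s < t \<and> t \<le> T \<longrightarrow> norm (incr (fst \<Y>) s t) \<le> K * (t - s) powr \<alpha>"
    using hnorm_finite_bound by blast
  have "\<bar>dY s t k\<bar> \<le> K * (t - s) powr \<alpha>" if "0 \<le> s" "s \<le> t" "t \<le> T" for s t
  proof (cases "s = t")
    case False
    then have "norm (incr (fst \<Y>) s t) \<le> K * (t - s) powr \<alpha>" using K(2) that by simp
    then show ?thesis using component_le_norm_cart[of "incr (fst \<Y>) s t" k] by linarith
  qed (simp add: incr_def)
  then show ?thesis by (intro order_familyI[where K=K])
qed

lemma YY_order: "order_family T (2 * \<alpha>) S (\<lambda>_ s t. YY s t k l)"
proof -
  have "hnorm T (2 * \<alpha>) (snd \<Y>) < \<infinity>"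
    using \<Y> by (auto simp: rough_paths_C1_def rough_paths_def)
  then obtain K where K: "K \<ge> 0"
    "\<forall>s t. 0 \<le> s \<and> s < t \<and> t \<le> T \<longrightarrow> norm (snd \<Y> s t) \<le> K * (t - s) powr (2 * \<alpha>)"
    using hnorm_finite_bound by blast
  have "\<bar>YY s t k l\<bar> \<le> K * (t - s) powr (2 * \<alpha>)" if "0 \<le> s" "s \<le> t" "t \<le> T" for s t
  proof (cases "s = t")
    case False
    then have "norm (snd \<Y> s t) \<le> K * (t - s) powr (2 * \<alpha>)" using K(2) that by simp
    moreover have "\<bar>YY s t k l\<bar> \<le> norm (snd \<Y> s t)"
      using component_le_norm_cart[of "snd \<Y> s t $ k" l] Finite_Cartesian_Product.norm_nth_le[of "snd \<Y> s t" k] by linarith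
    ultimately show ?thesis by linarith
  qed (use YY_refl that in simp)
  then show ?thesis by (intro order_familyI[where K=K])
qed

lemma dbr_continuous: "continuous_on {0..T} (\<lambda>r. dbr r k l)"
  using \<Y> by (auto simp: rough_paths_C1_def intro!: continuous_intros)

text \<open>The bracket is defined from the base point 0; Chen's relation moves the identity to an
  arbitrary interval, and the fundamental theorem of calculus writes \<open>\<delta>[Y]\<close> as an integral.\<close>

lemma bracket_increment:
  assumes "0 \<le> s" "s \<le> t" "t \<le> T"
  shows "dY s t k * dY s t l = YY s t k l + YY s t l k + (LINT r:{s..t}|lborel. dbr r k l)"
proof -
  let ?B = "\<lambda>t. bracket \<Y> t $ k $ l"
  have B: "?B r = dY 0 r k * dY 0 r l - YY 0 r k l - YY 0 r l k" for r
    by (simp add: bracket_def tensor_def transpose_def)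
  have "(?B has_vector_derivative dbr r k l) (at r within {s..t})" if "s \<le> r" "r \<le> t" for r
  proof -
    have "bracket \<Y> differentiable (at r within {0..T})"
      using \<Y> that assms by (auto simp: rough_paths_C1_def)
    then have "(bracket \<Y> has_vector_derivative bracket_deriv T \<Y> r) (at r within {0..T})"
      unfolding bracket_deriv_def by (simp add: vector_derivative_works)
    then have "(bracket \<Y> has_vector_derivative bracket_deriv T \<Y> r) (at r within {s..t})"
      using assms by (auto intro: has_vector_derivative_within_subset)
    then show ?thesis
      by (intro bounded_linear.has_vector_derivative[OF bounded_linear_vec_nth])
  qed
  then have "(LINT r:{s..t}|lborel. dbr r k l) = ?B t - ?B s"
    unfolding set_lebesgue_integral_def
    using assms continuous_on_subset[OF dbr_continuous, of "{s..t}"]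
    by (intro integral_FTC_atLeastAtMost) auto
  moreover have "dY 0 t j = dY 0 s j + dY s t j" for j by (simp add: incr_def)
  ultimately show ?thesis
    using chen_relation[OF order_refl assms(1) assms(2) assms(3)] unfolding B
    by (simp add: algebra_simps)
qed

section \<open>Second-order expansions along a rough path\<close>

text \<open>\<open>S\<close> indexes a family of real paths \<open>p\<close> that solve \<open>dp = a dt + G d\<^bold>Y\<close> in the sense of
  an expansion with second-order coefficients \<open>GG\<close>. The index convention of \<open>GG\<close> is the one of the Zakai
  equation: the derivative of \<open>G\<^sub>k\<close> in direction \<open>m\<close> is \<open>GG\<^sub>m\<^sub>k\<close>. All bounds are
  uniform over \<open>S\<close>, except for the rate in the \<open>o(|t - s|)\<close>.\<close>

definition rough_expansion ::
  "'i set \<Rightarrow> ('i \<Rightarrow> real \<Rightarrow> real) \<Rightarrow> ('i \<Rightarrow> real \<Rightarrow> 'dy \<Rightarrow> real) \<Rightarrow> ('i \<Rightarrow> real \<Rightarrow> 'dy \<Rightarrow> 'dy \<Rightarrow> real)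
    \<Rightarrow> ('i \<Rightarrow> real \<Rightarrow> real) \<Rightarrow> bool" where
  "rough_expansion S p G GG a \<longleftrightarrow>
     bounded_family T S p \<and> bounded_family T S a \<and>
     (\<forall>k. controlled_family T \<alpha> (fst \<Y>) S (\<lambda>i t. G i t k) (\<lambda>i t m. GG i t m k)) \<and>
     (\<forall>i\<in>S. set_integrable lborel {0..T} (a i) \<and>
        little_o_increment T (\<lambda>s t. p i t - p i s - (LINT r:{s..t}|lborel. a i r)
          - (\<Sum>k\<in>UNIV. G i s k * dY s t k)
          - (\<Sum>k\<in>UNIV. \<Sum>l\<in>UNIV. GG i s k l * YY s t k l)))"

lemma rough_expansion_const_index:
  assumes "rough_expansion S p G GG a" "j \<in> S"
  shows "rough_expansion S (\<lambda>_. p j) (\<lambda>_. G j) (\<lambda>_. GG j) (\<lambda>_. a j)"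
  using assms
  unfolding rough_expansion_def controlled_family_def bounded_family_def order_family_def
  by (intro conjI ballI allI) (meson|blast)+

text \<open>The germ on the right-hand side of the expansion is almost additive: by Chen's relation its
  defect is the sum of \<open>R\<^sub>s\<^sub>u \<delta>Y\<^sub>u\<^sub>t\<close>, with \<open>R\<close> the remainder of the controlled path \<open>G\<close>, and of
  \<open>\<delta>GG\<^sub>s\<^sub>u YY\<^sub>u\<^sub>t\<close>. Both are uniformly of order \<open>3 \<alpha>\<close>, so sewing upgrades \<open>o(|t - s|)\<close> to a uniform
  bound.\<close>

lemma rough_expansion_remainder:
  assumes "rough_expansion S p G GG a"
  shows "order_family T (3 * \<alpha>) S (\<lambda>i s t. p i t - p i s - (LINT r:{s..t}|lborel. a i r)
          - (\<Sum>k\<in>UNIV. G i s k * dY s t k)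
          - (\<Sum>k\<in>UNIV. \<Sum>l\<in>UNIV. GG i s k l * YY s t k l))" (is "order_family _ _ _ ?R")
proof -
  have ctrl: "\<And>k. controlled_family T \<alpha> (fst \<Y>) S (\<lambda>i t. G i t k) (\<lambda>i t m. GG i t m k)"
    and a: "\<And>i. i \<in> S \<Longrightarrow> set_integrable lborel {0..T} (a i)"
    and small: "\<And>i. i \<in> S \<Longrightarrow> little_o_increment T (?R i)"
    using assms unfolding rough_expansion_def by auto
  let ?E = "\<lambda>l i s u. G i u l - G i s l - (\<Sum>k\<in>UNIV. GG i s k l * dY s u k)"
  have E: "order_family T (2 * \<alpha>) S (?E l)" for l
    using controlled_family_remainder[OF ctrl] .
  have \<delta>: "order_family T \<alpha> S (\<lambda>i s u. GG i u k l - GG i s k l)" for k l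
    using controlled_family_deriv_order[OF ctrl] .
  have chen_defect: "?R i s t - ?R i s u - ?R i u t
      = (\<Sum>l\<in>UNIV. ?E l i s u * dY u t l)
        + (\<Sum>k\<in>UNIV. \<Sum>l\<in>UNIV. (GG i u k l - GG i s k l) * YY u t k l)"
    if i: "i \<in> S" and t: "0 \<le> s" "s \<le> u" "u \<le> t" "t \<le> T" for i s u t
  proof -
    have "set_integrable lborel {s..t} (a i)" using a[OF i] t by (auto intro: set_integrable_subset)
    note I = set_integral_Icc_combine[OF this t(2,3)]
    have 1: "(\<Sum>k\<in>UNIV. G i s k * dY s t k)
        = (\<Sum>k\<in>UNIV. G i s k * dY s u k) + (\<Sum>k\<in>UNIV. G i s k * dY u t k)"
      by (simp add: incr_def algebra_simps flip: sum.distrib)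
    have 2: "(\<Sum>k\<in>UNIV. \<Sum>l\<in>UNIV. GG i s k l * YY s t k l)
        = (\<Sum>k\<in>UNIV. \<Sum>l\<in>UNIV. GG i s k l * YY s u k l)
        + (\<Sum>k\<in>UNIV. \<Sum>l\<in>UNIV. GG i s k l * YY u t k l)
        + (\<Sum>k\<in>UNIV. \<Sum>l\<in>UNIV. GG i s k l * dY s u k * dY u t l)"
      by (simp add: chen_relation[OF t] algebra_simps sum.distrib)
    have 3: "(\<Sum>k\<in>UNIV. \<Sum>l\<in>UNIV. GG i s k l * dY s u k * dY u t l)
        = (\<Sum>l\<in>UNIV. (\<Sum>k\<in>UNIV. GG i s k l * dY s u k) * dY u t l)"
      by (subst sum.swap) (simp add: sum_distrib_right)
    have 4: "(\<Sum>l\<in>UNIV. ?E l i s u * dY u t l) = (\<Sum>l\<in>UNIV. G i u l * dY u t l)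
        - (\<Sum>l\<in>UNIV. G i s l * dY u t l) - (\<Sum>l\<in>UNIV. (\<Sum>k\<in>UNIV. GG i s k l * dY s u k) * dY u t l)"
      by (simp add: left_diff_distrib sum_subtractf)
    have 5: "(\<Sum>k\<in>UNIV. \<Sum>l\<in>UNIV. (GG i u k l - GG i s k l) * YY u t k l)
        = (\<Sum>k\<in>UNIV. \<Sum>l\<in>UNIV. GG i u k l * YY u t k l) - (\<Sum>k\<in>UNIV. \<Sum>l\<in>UNIV. GG i s k l * YY u t k l)"
      by (simp add: left_diff_distrib sum_subtractf)
    show ?thesis unfolding I 1 2 3 4 5 by linarith
  qed
  have "\<exists>K. \<forall>i s u t. i \<in> S \<longrightarrow> 0 \<le> s \<longrightarrow> s \<le> u \<longrightarrow> u \<le> t \<longrightarrow> t \<le> T \<longrightarrow>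
      \<bar>\<Sum>l\<in>UNIV. ?E l i s u * dY u t l\<bar> \<le> K * (t - s) powr (2 * \<alpha> + \<alpha>)"
    by (intro order_family_sum_mult_adjacent E dY_order) (use \<alpha> in auto)
  then obtain K where K: "\<forall>i s u t. i \<in> S \<longrightarrow> 0 \<le> s \<longrightarrow> s \<le> u \<longrightarrow> u \<le> t \<longrightarrow> t \<le> T \<longrightarrow>
      \<bar>\<Sum>l\<in>UNIV. ?E l i s u * dY u t l\<bar> \<le> K * (t - s) powr (2 * \<alpha> + \<alpha>)"
    by blast
  have "\<exists>L. \<forall>i s u t. i \<in> S \<longrightarrow> 0 \<le> s \<longrightarrow> s \<le> u \<longrightarrow> u \<le> t \<longrightarrow> t \<le> T \<longrightarrow>
      \<bar>\<Sum>x\<in>UNIV \<times> UNIV. (GG i u (fst x) (snd x) - GG i s (fst x) (snd x)) * YY u t (fst x) (snd x)\<bar>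
        \<le> L * (t - s) powr (\<alpha> + 2 * \<alpha>)"
    by (intro order_family_sum_mult_adjacent \<delta> YY_order) (use \<alpha> in auto)
  then obtain L where L: "\<forall>i s u t. i \<in> S \<longrightarrow> 0 \<le> s \<longrightarrow> s \<le> u \<longrightarrow> u \<le> t \<longrightarrow> t \<le> T \<longrightarrow>
      \<bar>\<Sum>x\<in>UNIV \<times> UNIV. (GG i u (fst x) (snd x) - GG i s (fst x) (snd x)) * YY u t (fst x) (snd x)\<bar>
        \<le> L * (t - s) powr (\<alpha> + 2 * \<alpha>)"
    by blast
  show ?thesis
  proof (rule sewing_remainder[where K="K + L"])
    show "3 * \<alpha> > 1" using \<alpha> by simp
    show "little_o_increment T (?R i)" if "i \<in> S" for i using small that .
    fix i s u t assume *: "i \<in> S" "0 \<le> s" "s \<le> u" "u \<le> t" "t \<le> T"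
    show "\<bar>?R i s t - ?R i s u - ?R i u t\<bar> \<le> (K + L) * (t - s) powr (3 * \<alpha>)"
      unfolding chen_defect[OF *] distrib_right
      using K[rule_format, OF *] L[rule_format, OF *]
      by (simp add: sum.cartesian_product case_prod_beta)
  qed
qed

end

section \<open>The quotient of two expansions\<close>

definition ratio :: "('i \<Rightarrow> real \<Rightarrow> real) \<Rightarrow> ('i \<Rightarrow> real \<Rightarrow> real) \<Rightarrow> 'i \<Rightarrow> real \<Rightarrow> real" where
  "ratio p m i t = p i t / m i t"

definition ratio_comp :: "('i \<Rightarrow> real \<Rightarrow> 'k \<Rightarrow> real) \<Rightarrow> ('i \<Rightarrow> real \<Rightarrow> real) \<Rightarrow> 'i \<Rightarrow> real \<Rightarrow> 'k \<Rightarrow> real" where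
  "ratio_comp G m i t k = G i t k / m i t"

text \<open>The Gubinelli derivatives of \<open>p / m\<close> and of \<open>ratio_deriv\<close> itself when \<open>p\<close> and \<open>m\<close> have first- and
  second-order coefficients \<open>G, GG\<close> and \<open>H, HH\<close>. For \<open>p = \<mu>(\<phi>)\<close> and \<open>m = \<mu>(1)\<close> these are \<open>\<Phi>\<close> and
  \<open>\<Phi>'\<close>. The indices \<open>k l\<close> stand for the derivative of the component \<open>k\<close> in direction \<open>l\<close>, which
  is why \<open>GG\<close> and \<open>HH\<close> appear with swapped indices.\<close>

definition ratio_deriv where
  "ratio_deriv p m G H i t k = ratio_comp G m i t k - ratio p m i t * ratio_comp H m i t k"

definition ratio_deriv2 where
  "ratio_deriv2 p m G H GG HH i t k l =
     (GG i t l k / m i t - ratio_comp G m i t k * ratio_comp H m i t l)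
     - ratio_deriv p m G H i t l * ratio_comp H m i t k
     - ratio p m i t * (HH i t l k / m i t - ratio_comp H m i t k * ratio_comp H m i t l)"

context rough_path_C1
begin

text \<open>Dropping the drift, the second-order term and the remainder costs order \<open>2 \<alpha>\<close>; for the drift,
  which is of order one, this uses \<open>\<alpha> \<le> 1/2\<close>.\<close>

lemma controlled_family_expansion:
  assumes "rough_expansion S p G GG a"
  shows "controlled_family T \<alpha> (fst \<Y>) S p G"
proof -
  let ?R = "\<lambda>i s t. p i t - p i s - (LINT r:{s..t}|lborel. a i r)
      - (\<Sum>k\<in>UNIV. G i s k * dY s t k) - (\<Sum>k\<in>UNIV. \<Sum>l\<in>UNIV. GG i s k l * YY s t k l)"
  have ctrl: "\<And>k. controlled_family T \<alpha> (fst \<Y>) S (\<lambda>i t. G i t k) (\<lambda>i t m. GG i t m k)"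
    and p: "bounded_family T S p" and a: "bounded_family T S a"
    using assms unfolding rough_expansion_def by auto
  have GG: "bounded_family T S (\<lambda>i t. GG i t k l)" for k l
    using controlled_family_deriv_bounded[OF ctrl] .
  have "order_family T (2 * \<alpha>) S (\<lambda>i s t. ?R i s t + (LINT r:{s..t}|lborel. a i r)
      + (\<Sum>k\<in>UNIV. \<Sum>l\<in>UNIV. GG i s k l * YY s t k l))"
  proof (intro order_family_add order_family_sum order_family_bounded_mult(1) GG YY_order)
    show "order_family T (2 * \<alpha>) S ?R"
      by (rule order_family_mono[OF rough_expansion_remainder[OF assms]]) (use \<alpha> in simp)
    show "order_family T (2 * \<alpha>) S (\<lambda>i s t. LINT r:{s..t}|lborel. a i r)"
      by (rule order_family_mono[OF order_family_set_integral[OF a]]) (use \<alpha> in simp)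
  qed
  then have "order_family T (2 * \<alpha>) S (\<lambda>i s t. p i t - p i s - (\<Sum>k\<in>UNIV. G i s k * dY s t k))"
    by (rule order_family_cong) linarith
  moreover have "order_family T \<alpha> S (\<lambda>i s t. G i t k - G i s k)" for k
    using \<alpha> by (intro controlled_family_order_increment[OF _ dY_order ctrl]) auto
  ultimately show ?thesis
    unfolding controlled_family_def using p controlled_family_bounded[OF ctrl] by blast
qed

lemma controlled_family_quotient:
  assumes F: "controlled_family T \<alpha> (fst \<Y>) S F F'"
    and m: "controlled_family T \<alpha> (fst \<Y>) S m H"
    and c: "c > 0" "\<forall>i\<in>S. \<forall>t\<in>{0..T}. m i t \<ge> c"
  shows "controlled_family T \<alpha> (fst \<Y>) S (\<lambda>i t. F i t / m i t)
           (\<lambda>i t k. F' i t k / m i t - F i t / m i t * (H i t k / m i t))"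
proof -
  have \<alpha>0: "\<alpha> > 0" using \<alpha> by simp
  have "controlled_family T \<alpha> (fst \<Y>) S (\<lambda>i t. F i t * (1 / m i t))
      (\<lambda>i t k. F' i t k * (1 / m i t) + F i t * - (H i t k * (1 / m i t * (1 / m i t))))"
    by (intro controlled_family_mult[OF \<alpha>0 dY_order F]
        controlled_family_inverse[OF \<alpha>0 dY_order m c])
  moreover have "(\<lambda>i t k. F' i t k * (1 / m i t) + F i t * - (H i t k * (1 / m i t * (1 / m i t))))
      = (\<lambda>i t k. F' i t k / m i t - F i t / m i t * (H i t k / m i t))"
    by (intro ext) simp
  ultimately show ?thesis by simp
qed

context
  fixes S :: "'i set" and p m a :: "'i \<Rightarrow> real \<Rightarrow> real" and G H :: "'i \<Rightarrow> real \<Rightarrow> 'dy \<Rightarrow> real"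
    and GG HH :: "'i \<Rightarrow> real \<Rightarrow> 'dy \<Rightarrow> 'dy \<Rightarrow> real" and c :: real
  assumes p: "rough_expansion S p G GG a" and m: "rough_expansion S m H HH (\<lambda>_ _. 0)"
    and c: "c > 0" "\<forall>i\<in>S. \<forall>t\<in>{0..T}. m i t \<ge> c"
begin

abbreviation "quot \<equiv> ratio p m"
abbreviation "quot_G \<equiv> ratio_comp G m"
abbreviation "quot_H \<equiv> ratio_comp H m"
abbreviation "quot_deriv \<equiv> ratio_deriv p m G H"
abbreviation "quot_deriv2 \<equiv> ratio_deriv2 p m G H GG HH"

lemma controlled_quot: "controlled_family T \<alpha> (fst \<Y>) S quot quot_deriv"
  using controlled_family_quotient[OF controlled_family_expansion[OF p] controlled_family_expansion[OF m] c]
  unfolding ratio_def[abs_def] ratio_deriv_def[abs_def] ratio_comp_def .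

lemma controlled_quot_H:
  "controlled_family T \<alpha> (fst \<Y>) S (\<lambda>i t. quot_H i t k)
     (\<lambda>i t l. HH i t l k / m i t - quot_H i t k * quot_H i t l)"
  using controlled_family_quotient[OF _ controlled_family_expansion[OF m] c,
      of "\<lambda>i t. H i t k" "\<lambda>i t l. HH i t l k"] m
  unfolding ratio_comp_def rough_expansion_def by simp

lemma controlled_quot_G:
  "controlled_family T \<alpha> (fst \<Y>) S (\<lambda>i t. quot_G i t k)
     (\<lambda>i t l. GG i t l k / m i t - quot_G i t k * quot_H i t l)"
  using controlled_family_quotient[OF _ controlled_family_expansion[OF m] c,
      of "\<lambda>i t. G i t k" "\<lambda>i t l. GG i t l k"] p
  unfolding ratio_comp_def rough_expansion_def by simp

lemma controlled_quot_deriv: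
  "controlled_family T \<alpha> (fst \<Y>) S (\<lambda>i t. quot_deriv i t k) (\<lambda>i t l. quot_deriv2 i t k l)"
proof -
  have \<alpha>0: "\<alpha> > 0" using \<alpha> by simp
  have 1: "(\<lambda>i t. quot_deriv i t k) = (\<lambda>i t. quot_G i t k - quot i t * quot_H i t k)"
    by (simp add: ratio_deriv_def)
  have 2: "(\<lambda>i t l. quot_deriv2 i t k l) = (\<lambda>i t l. (GG i t l k / m i t - quot_G i t k * quot_H i t l)
        - (quot_deriv i t l * quot_H i t k + quot i t * (HH i t l k / m i t - quot_H i t k * quot_H i t l)))"
    by (intro ext) (simp add: ratio_deriv2_def)
  show ?thesis
    unfolding 1 2
    by (intro controlled_family_diff[OF \<alpha>0 dY_order controlled_quot_G]
        controlled_family_mult[OF \<alpha>0 dY_order controlled_quot controlled_quot_H])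
qed

lemma quot_weight_order:
  "order_family T \<alpha> S (\<lambda>i s t. quot_deriv i t k * quot_H i t l - quot_deriv i s k * quot_H i s l)"
  using \<alpha> by (intro order_family_increment_mult controlled_family_bounded[OF controlled_quot_deriv]
      controlled_family_bounded[OF controlled_quot_H]
      controlled_family_order_increment[OF _ dY_order controlled_quot_deriv]
      controlled_family_order_increment[OF _ dY_order controlled_quot_H]) auto

lemma quot_weight_continuous:
  "i \<in> S \<Longrightarrow> continuous_on {0..T} (\<lambda>t. quot_deriv i t k * quot_H i t l)"
  using continuous_on_if_order_family_increment[OF quot_weight_order] \<alpha> by force

lemma inverse_mass: "bounded_family T S (\<lambda>i t. 1 / m i t)"
  "order_family T \<alpha> S (\<lambda>i s t. 1 / m i t - 1 / m i s)"
proof -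
  have \<alpha>0: "\<alpha> > 0" using \<alpha> by simp
  note inv = controlled_family_inverse[OF \<alpha>0 dY_order controlled_family_expansion[OF m] c]
  show "bounded_family T S (\<lambda>i t. 1 / m i t)" by (rule controlled_family_bounded[OF inv])
  show "order_family T \<alpha> S (\<lambda>i s t. 1 / m i t - 1 / m i s)"
    by (rule controlled_family_order_increment[OF \<alpha>0 dY_order inv])
qed

lemma quot_drift_integrable:
  assumes "i \<in> S"
  shows "set_integrable lborel {0..T} (\<lambda>r. a i r / m i r)"
proof -
  have "continuous_on {0..T} (\<lambda>r. 1 / m i r)"
    using continuous_on_if_order_family_increment[OF inverse_mass(2)] \<alpha> assms by force
  then have "set_integrable lborel {0..T} (\<lambda>r. 1 / m i r * a i r)"
    using p assms unfolding rough_expansion_def by (intro set_integrable_mult_continuous) auto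
  then show ?thesis by simp
qed

lemma quot_correction_integrable:
  assumes "i \<in> S"
  shows "set_integrable lborel {0..T} (\<lambda>r. quot_deriv i r k * dbr r k l * quot_H i r l)"
proof -
  have "set_integrable lborel {0..T} (\<lambda>r. (quot_deriv i r k * quot_H i r l) * dbr r k l)"
    by (intro set_integrable_mult_continuous quot_weight_continuous assms
        borel_integrable_atLeastAtMost' dbr_continuous)
  then show ?thesis by (simp add: mult_ac)
qed

lemma quot_correction_double_integrable:
  assumes "i \<in> S"
  shows "set_integrable lborel {0..T} (\<lambda>r. \<Sum>k\<in>UNIV. \<Sum>l\<in>UNIV. quot_deriv i r k * dbr r k l * quot_H i r l)"
  by (intro set_integrable_sum finite_class.finite_UNIV quot_correction_integrable assms)

text \<open>The exact algebra of the quotient: every term on the right-hand side is small. There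
  \<open>x\<close> and \<open>y\<close> are the first-order parts of \<open>D\<close> and \<open>d\<close>, and \<open>D d\<close> is replaced by \<open>x y\<close>, to which
  the bracket identity applies. The last two summands compare integrals with integrals of frozen
  weights.\<close>

lemma quot_expansion_identity:
  fixes i s t
  assumes i: "i \<in> S" and t: "0 \<le> s" "s \<le> t" "t \<le> T"
  defines "Ep \<equiv> p i t - p i s - (LINT r:{s..t}|lborel. a i r)
      - (\<Sum>k\<in>UNIV. G i s k * dY s t k) - (\<Sum>k\<in>UNIV. \<Sum>l\<in>UNIV. GG i s k l * YY s t k l)"
    and "Em \<equiv> m i t - m i s - (LINT r:{s..t}|lborel. 0)
      - (\<Sum>k\<in>UNIV. H i s k * dY s t k) - (\<Sum>k\<in>UNIV. \<Sum>l\<in>UNIV. HH i s k l * YY s t k l)"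
    and "x \<equiv> \<Sum>k\<in>UNIV. quot_deriv i s k * dY s t k" and "y \<equiv> \<Sum>l\<in>UNIV. quot_H i s l * dY s t l"
    and "D \<equiv> ((p i t - p i s) - quot i s * (m i t - m i s)) / m i s" and "d \<equiv> (m i t - m i s) / m i s"
  shows "quot i t - quot i s
      - (LINT r:{s..t}|lborel. a i r / m i r
          - (\<Sum>k\<in>UNIV. \<Sum>l\<in>UNIV. quot_deriv i r k * dbr r k l * quot_H i r l))
      - (\<Sum>k\<in>UNIV. quot_deriv i s k * dY s t k)
      - (\<Sum>k\<in>UNIV. \<Sum>l\<in>UNIV. quot_deriv2 i s l k * YY s t k l)
    = 1 / m i s * (Ep - quot i s * Em)
      + D * d * ((m i t - m i s) * (1 / m i t)) - (D - x) * d - x * (d - y)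
      - ((LINT r:{s..t}|lborel. 1 / m i r * a i r) - 1 / m i s * (LINT r:{s..t}|lborel. a i r))
      + (\<Sum>k\<in>UNIV. \<Sum>l\<in>UNIV. (LINT r:{s..t}|lborel. (quot_deriv i r k * quot_H i r l) * dbr r k l)
           - quot_deriv i s k * quot_H i s l * (LINT r:{s..t}|lborel. dbr r k l))"
proof -
  have nz: "m i s \<noteq> 0" "m i t \<noteq> 0" using c(2)[rule_format, OF i, of s] c(2)[rule_format, OF i, of t] c(1) t by auto
  let ?I = "LINT r:{s..t}|lborel. a i r"
  let ?J = "LINT r:{s..t}|lborel. 1 / m i r * a i r"
  let ?w = "\<lambda>k l. quot_deriv i s k * quot_H i s l"
  let ?b = "\<lambda>k l. LINT r:{s..t}|lborel. dbr r k l"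
  let ?W = "\<lambda>k l. LINT r:{s..t}|lborel. (quot_deriv i r k * quot_H i r l) * dbr r k l"
  define z where "z = (\<Sum>k\<in>UNIV. \<Sum>l\<in>UNIV. (GG i s k l / m i s - quot i s * (HH i s k l / m i s)) * YY s t k l)"
  have sub: "{s..t} \<subseteq> {0..T}" using t by auto
  \<comment> \<open>Second-order Taylor formula of the quotient with its exact remainder.\<close>
  have taylor: "quot i t - quot i s = D - D * d + D * d * ((m i t - m i s) * (1 / m i t))"
    unfolding D_def d_def ratio_def using nz by (simp add: field_simps power2_eq_square)
  have first: "D = 1 / m i s * ?I + x + z + 1 / m i s * (Ep - quot i s * Em)"
  proof -
    have 1: "x = (\<Sum>k\<in>UNIV. G i s k * dY s t k) / m i s - quot i s * (\<Sum>k\<in>UNIV. H i s k * dY s t k) / m i s"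
      unfolding x_def ratio_deriv_def ratio_comp_def sum_distrib_left sum_divide_distrib
        sum_subtractf[symmetric]
      by (intro sum.cong refl) (simp add: left_diff_distrib)
    have 2: "z = (\<Sum>k\<in>UNIV. \<Sum>l\<in>UNIV. GG i s k l * YY s t k l) / m i s
        - quot i s * (\<Sum>k\<in>UNIV. \<Sum>l\<in>UNIV. HH i s k l * YY s t k l) / m i s"
      unfolding z_def sum_distrib_left sum_divide_distrib sum_subtractf[symmetric]
      by (intro sum.cong refl) (simp add: left_diff_distrib)
    show ?thesis
      unfolding 1 2 D_def Ep_def Em_def using nz(1) by (simp add: field_simps)
  qed
  \<comment> \<open>The bracket identity; renaming the indices moves the transpose of \<open>YY\<close> onto the weights.\<close>
  have square: "x * y = (\<Sum>k\<in>UNIV. \<Sum>l\<in>UNIV. (?w k l + ?w l k) * YY s t k l)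
      + (\<Sum>k\<in>UNIV. \<Sum>l\<in>UNIV. ?w k l * ?b k l)"
  proof -
    have "x * y = (\<Sum>k\<in>UNIV. \<Sum>l\<in>UNIV. ?w k l * (dY s t k * dY s t l))"
      unfolding x_def y_def sum_product by (simp add: mult_ac)
    also have "\<dots> = (\<Sum>k\<in>UNIV. \<Sum>l\<in>UNIV. ?w k l * YY s t k l)
        + (\<Sum>k\<in>UNIV. \<Sum>l\<in>UNIV. ?w k l * YY s t l k) + (\<Sum>k\<in>UNIV. \<Sum>l\<in>UNIV. ?w k l * ?b k l)"
      unfolding bracket_increment[OF t] distrib_left sum.distrib ..
    also have "(\<Sum>k\<in>UNIV. \<Sum>l\<in>UNIV. ?w k l * YY s t l k) = (\<Sum>k\<in>UNIV. \<Sum>l\<in>UNIV. ?w l k * YY s t k l)"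
      by (rule sum.swap)
    finally show ?thesis by (simp only: distrib_right sum.distrib)
  qed
  \<comment> \<open>The second-order coefficient of the quotient is what \<open>D\<close> contributes minus the correction found in \<open>square\<close>.\<close>
  have second: "(\<Sum>k\<in>UNIV. \<Sum>l\<in>UNIV. quot_deriv2 i s l k * YY s t k l)
      = z - (\<Sum>k\<in>UNIV. \<Sum>l\<in>UNIV. (?w k l + ?w l k) * YY s t k l)"
    unfolding z_def sum_subtractf[symmetric]
    by (intro sum.cong refl) (simp add: ratio_deriv2_def ratio_deriv_def algebra_simps)
  have drift: "(LINT r:{s..t}|lborel. a i r / m i r
          - (\<Sum>k\<in>UNIV. \<Sum>l\<in>UNIV. quot_deriv i r k * dbr r k l * quot_H i r l))
      = ?J - (\<Sum>k\<in>UNIV. \<Sum>l\<in>UNIV. ?W k l)"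
  proof -
    have 1: "set_integrable lborel {s..t} (\<lambda>r. a i r / m i r)"
      by (rule set_integrable_subset[OF quot_drift_integrable[OF i] _ sub]) simp
    have 2: "set_integrable lborel {s..t} (\<lambda>r. quot_deriv i r k * dbr r k l * quot_H i r l)" for k l
      by (rule set_integrable_subset[OF quot_correction_integrable[OF i] _ sub]) simp
    have 3: "(LINT r:{s..t}|lborel. (\<Sum>k\<in>UNIV. \<Sum>l\<in>UNIV. quot_deriv i r k * dbr r k l * quot_H i r l))
        = (\<Sum>k\<in>UNIV. \<Sum>l\<in>UNIV. LINT r:{s..t}|lborel. quot_deriv i r k * dbr r k l * quot_H i r l)"
      by (simp add: set_integral_sum set_integrable_sum 2)
    have "set_integrable lborel {s..t} (\<lambda>r. \<Sum>k\<in>UNIV. \<Sum>l\<in>UNIV. quot_deriv i r k * dbr r k l * quot_H i r l)"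
      by (intro set_integrable_sum finite_class.finite_UNIV 2)
    then show ?thesis using 1 3 by (simp add: mult_ac)
  qed
  have last: "(\<Sum>k\<in>UNIV. \<Sum>l\<in>UNIV. ?W k l - ?w k l * ?b k l)
      = (\<Sum>k\<in>UNIV. \<Sum>l\<in>UNIV. ?W k l) - (\<Sum>k\<in>UNIV. \<Sum>l\<in>UNIV. ?w k l * ?b k l)"
    by (simp only: sum_subtractf)
  have "D * d = (D - x) * d + x * (d - y) + x * y" by (simp add: algebra_simps)
  then show ?thesis
    unfolding taylor drift second last x_def[symmetric] using first square by linarith
qed

text \<open>By \<open>quot_expansion_identity\<close> it remains to count orders. The terms involving \<open>D\<close> and \<open>d\<close> have order
  \<open>3 \<alpha>\<close> and the frozen integrals \<open>1 + \<alpha>\<close>.\<close>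

lemma quot_rough_expansion:
  assumes i: "i \<in> S"
  shows "little_o_increment T (\<lambda>s t. quot i t - quot i s
      - (LINT r:{s..t}|lborel. a i r / m i r
          - (\<Sum>k\<in>UNIV. \<Sum>l\<in>UNIV. quot_deriv i r k * dbr r k l * quot_H i r l))
      - (\<Sum>k\<in>UNIV. quot_deriv i s k * dY s t k)
      - (\<Sum>k\<in>UNIV. \<Sum>l\<in>UNIV. quot_deriv2 i s l k * YY s t k l))"
proof -
  have \<alpha>0: "\<alpha> > 0" using \<alpha> by simp
  let ?dp = "\<lambda>i s t. p i t - p i s" and ?dm = "\<lambda>i s t. m i t - m i s"
  let ?x = "\<lambda>i s t. \<Sum>k\<in>UNIV. quot_deriv i s k * dY s t k" and ?y = "\<lambda>i s t. \<Sum>l\<in>UNIV. quot_H i s l * dY s t l"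
  let ?D = "\<lambda>i s t. (?dp i s t - quot i s * ?dm i s t) / m i s" and ?d = "\<lambda>i s t. ?dm i s t / m i s"
  let ?Ep = "\<lambda>i s t. ?dp i s t - (LINT r:{s..t}|lborel. a i r)
      - (\<Sum>k\<in>UNIV. G i s k * dY s t k) - (\<Sum>k\<in>UNIV. \<Sum>l\<in>UNIV. GG i s k l * YY s t k l)"
  let ?Em = "\<lambda>i s t. ?dm i s t - (LINT r:{s..t}|lborel. 0)
      - (\<Sum>k\<in>UNIV. H i s k * dY s t k) - (\<Sum>k\<in>UNIV. \<Sum>l\<in>UNIV. HH i s k l * YY s t k l)"
  note cp = controlled_family_expansion[OF p] and cm = controlled_family_expansion[OF m]
  note inv = inverse_mass and q = controlled_family_bounded[OF controlled_quot]
  have dm: "order_family T \<alpha> S ?dm" by (rule controlled_family_order_increment[OF \<alpha>0 dY_order cm])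
  have dp: "order_family T \<alpha> S ?dp" by (rule controlled_family_order_increment[OF \<alpha>0 dY_order cp])
  have d: "order_family T \<alpha> S ?d"
    using order_family_bounded_mult(1)[OF inv(1) dm] by simp
  have D: "order_family T \<alpha> S ?D"
    using order_family_bounded_mult(1)[OF inv(1) order_family_diff[OF dp order_family_bounded_mult(1)[OF q dm]]]
    by simp
  have x: "order_family T \<alpha> S ?x"
    by (intro order_family_sum order_family_bounded_mult(1) dY_order
        controlled_family_bounded[OF controlled_quot_deriv])
  have dy: "order_family T (2 * \<alpha>) S (\<lambda>i s t. ?d i s t - ?y i s t)"
  proof -
    have "order_family T (2 * \<alpha>) S (\<lambda>i s t. 1 / m i s * (?dm i s t - (\<Sum>k\<in>UNIV. H i s k * dY s t k)))"
      by (rule order_family_bounded_mult(1)[OF inv(1) controlled_family_remainder[OF cm]])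
    then show ?thesis
      by (rule order_family_cong) (simp add: ratio_comp_def right_diff_distrib diff_divide_distrib sum_divide_distrib)
  qed
  have Dx: "order_family T (2 * \<alpha>) S (\<lambda>i s t. ?D i s t - ?x i s t)"
  proof -
    have "order_family T (2 * \<alpha>) S (\<lambda>i s t. 1 / m i s * ((?dp i s t - (\<Sum>k\<in>UNIV. G i s k * dY s t k))
        - quot i s * (?dm i s t - (\<Sum>k\<in>UNIV. H i s k * dY s t k))))"
      by (intro order_family_bounded_mult(1)[OF inv(1)] order_family_diff
          order_family_bounded_mult(1)[OF q] controlled_family_remainder[OF cm] controlled_family_remainder[OF cp])
    then show ?thesis
    proof (rule order_family_cong)
      fix i s t
      have eq: "?x i s t = 1 / m i s * ((\<Sum>k\<in>UNIV. G i s k * dY s t k) - quot i s * (\<Sum>k\<in>UNIV. H i s k * dY s t k))"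
        unfolding sum_distrib_left sum_subtractf[symmetric]
        by (intro sum.cong refl) (simp add: ratio_deriv_def ratio_comp_def left_diff_distrib diff_divide_distrib)
      show "1 / m i s * ((?dp i s t - (\<Sum>k\<in>UNIV. G i s k * dY s t k))
        - quot i s * (?dm i s t - (\<Sum>k\<in>UNIV. H i s k * dY s t k))) = ?D i s t - ?x i s t"
        unfolding eq by (simp add: algebra_simps diff_divide_distrib add_divide_distrib)
    qed
  qed
  have three: "2 * \<alpha> + \<alpha> = 3 * \<alpha>" "\<alpha> + 2 * \<alpha> = 3 * \<alpha>" "\<alpha> + \<alpha> + \<alpha> = 3 * \<alpha>" by auto
  have dm': "order_family T \<alpha> S (\<lambda>i s t. ?dm i s t * (1 / m i t))"
    using order_family_bounded_mult(2)[OF inv(1) dm] by simp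
  have cubic: "order_family T (3 * \<alpha>) S (\<lambda>i s t. ?D i s t * ?d i s t * (?dm i s t * (1 / m i t))
      - (?D i s t - ?x i s t) * ?d i s t - ?x i s t * (?d i s t - ?y i s t))"
    using order_family_diff[OF order_family_diff[OF
        order_family_mult[OF order_family_mult[OF D d] dm', unfolded three]
        order_family_mult[OF Dx d, unfolded three]]
        order_family_mult[OF x dy, unfolded three]] .
  have a: "bounded_family T S a" "\<And>i. i \<in> S \<Longrightarrow> set_integrable lborel {0..T} (a i)"
    using p unfolding rough_expansion_def by auto
  note drift_a = order_family_set_integral_freeze[OF a inv(2) \<alpha>0]
  note drift_br = order_family_set_integral_freeze[OF bounded_family_if_continuous_on[OF dbr_continuous]
          borel_integrable_atLeastAtMost'[OF dbr_continuous] quot_weight_order \<alpha>0]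
  have drift: "order_family T (\<alpha> + 1) S (\<lambda>i s t. (\<Sum>k\<in>UNIV. \<Sum>l\<in>UNIV.
          (LINT r:{s..t}|lborel. (quot_deriv i r k * quot_H i r l) * dbr r k l)
           - quot_deriv i s k * quot_H i s l * (LINT r:{s..t}|lborel. dbr r k l))
      - ((LINT r:{s..t}|lborel. 1 / m i r * a i r) - 1 / m i s * (LINT r:{s..t}|lborel. a i r)))"
    by (rule order_family_diff[OF order_family_sum[OF order_family_sum[OF drift_br]] drift_a])
  obtain L where L: "L > 0" "\<forall>i t. i \<in> S \<longrightarrow> 0 \<le> t \<longrightarrow> t \<le> T \<longrightarrow> \<bar>1 / m i t\<bar> \<le> L"
    by (rule bounded_familyE[OF inv(1)])
  obtain L' where L': "L' > 0" "\<forall>i t. i \<in> S \<longrightarrow> 0 \<le> t \<longrightarrow> t \<le> T \<longrightarrow> \<bar>1 / m i t * - quot i t\<bar> \<le> L'"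
    by (rule bounded_familyE[OF bounded_family_mult[OF inv(1) bounded_family_uminus[OF q]]])
  have Ep: "little_o_increment T (?Ep i)" and Em: "little_o_increment T (?Em i)"
    using p m i unfolding rough_expansion_def by auto
  have "little_o_increment T (\<lambda>s t. ((1 / m i s * ?Ep i s t + 1 / m i s * - quot i s * ?Em i s t)
      + (?D i s t * ?d i s t * (?dm i s t * (1 / m i t))
          - (?D i s t - ?x i s t) * ?d i s t - ?x i s t * (?d i s t - ?y i s t)))
      + ((\<Sum>k\<in>UNIV. \<Sum>l\<in>UNIV. (LINT r:{s..t}|lborel. (quot_deriv i r k * quot_H i r l) * dbr r k l)
           - quot_deriv i s k * quot_H i s l * (LINT r:{s..t}|lborel. dbr r k l))
        - ((LINT r:{s..t}|lborel. 1 / m i r * a i r) - 1 / m i s * (LINT r:{s..t}|lborel. a i r))))"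
  proof (intro little_o_increment_add)
    show "little_o_increment T (\<lambda>s t. 1 / m i s * ?Ep i s t)"
      using L i by (intro little_o_increment_bounded_mult[OF Ep, where K=L]) auto
    show "little_o_increment T (\<lambda>s t. 1 / m i s * - quot i s * ?Em i s t)"
      using L' i by (intro little_o_increment_bounded_mult[OF Em, where K=L']) auto
  qed (use little_o_increment_if_order_family[OF cubic _ i] little_o_increment_if_order_family[OF drift _ i]
        \<alpha> in auto)
  then show ?thesis
  proof (rule little_o_increment_cong)
    fix s t assume t: "0 \<le> s" "s \<le> t" "t \<le> T"
    have *: "1 / m i s * (e - quot i s * e') = 1 / m i s * e + 1 / m i s * - quot i s * e'" for e e'
      by (simp add: algebra_simps)
    show "((1 / m i s * ?Ep i s t + 1 / m i s * - quot i s * ?Em i s t)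
      + (?D i s t * ?d i s t * (?dm i s t * (1 / m i t))
          - (?D i s t - ?x i s t) * ?d i s t - ?x i s t * (?d i s t - ?y i s t)))
      + ((\<Sum>k\<in>UNIV. \<Sum>l\<in>UNIV. (LINT r:{s..t}|lborel. (quot_deriv i r k * quot_H i r l) * dbr r k l)
           - quot_deriv i s k * quot_H i s l * (LINT r:{s..t}|lborel. dbr r k l))
        - ((LINT r:{s..t}|lborel. 1 / m i r * a i r) - 1 / m i s * (LINT r:{s..t}|lborel. a i r)))
      = quot i t - quot i s
      - (LINT r:{s..t}|lborel. a i r / m i r
          - (\<Sum>k\<in>UNIV. \<Sum>l\<in>UNIV. quot_deriv i r k * dbr r k l * quot_H i r l))
      - (\<Sum>k\<in>UNIV. quot_deriv i s k * dY s t k)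
      - (\<Sum>k\<in>UNIV. \<Sum>l\<in>UNIV. quot_deriv2 i s l k * YY s t k l)"
      unfolding quot_expansion_identity[OF i t] * by linarith
  qed
qed

end

end

section \<open>Bounds on test functions and operators\<close>

lemma dirderivs_Nil: "dirderivs [] f = f"
  by (rule ext) simp

lemma dirderivs_singleton: "dirderivs [v] f = (\<lambda>x. frechet_derivative f (at x) v)"
  by (rule ext) (simp add: dirderivs_Nil)

lemma dirderivs_const: "vs \<noteq> [] \<Longrightarrow> dirderivs vs (\<lambda>_. c) = (\<lambda>_. 0)"
proof (induction vs)
  case (Cons v vs)
  have "dirderivs vs (\<lambda>_. c) = (\<lambda>_. if vs = [] then c else 0)"
    using Cons.IH by (cases "vs = []") (auto simp: dirderivs_Nil)
  then show ?case by (intro ext) simp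
qed simp

lemma norm_dirderivs_le:
  assumes "Cb_norm \<beta> f \<le> ennreal K" "K \<ge> 0" "length vs \<le> hoelder_order \<beta>" "\<And>v. v \<in> set vs \<Longrightarrow> norm v \<le> 1"
  shows "norm (dirderivs vs f x) \<le> K"
proof -
  let ?j = "length vs"
  have "ennreal (norm (dirderivs vs f x)) \<le> multi_norm ?j (\<lambda>vs. dirderivs vs f x)"
    unfolding multi_norm_def using assms(4) by (intro SUP_upper) auto
  also have "\<dots> \<le> (SUP x. multi_norm ?j (\<lambda>vs. dirderivs vs f x))" by (intro SUP_upper) auto
  also have "\<dots> \<le> (\<Sum>j\<le>hoelder_order \<beta>. SUP x. multi_norm j (\<lambda>vs. dirderivs vs f x))"
    using assms(3) by (intro member_le_sum) auto
  also have "\<dots> \<le> Cb_norm \<beta> f" unfolding Cb_norm_def by simp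
  also note assms(1)
  finally show ?thesis using assms(2) by simp
qed

lemma hoelder_order_3: "hoelder_order 3 = 2"
  by (simp add: hoelder_order_def)

lemma hoelder_order_pos: "\<beta> > 1 \<Longrightarrow> hoelder_order \<beta> \<ge> 1"
  unfolding hoelder_order_def by linarith

lemma times_cont_diff_const: "times_cont_diff n (\<lambda>_. c)"
  by (induction n arbitrary: c) simp_all

lemma const_in_Cb: "(\<lambda>_. c) \<in> Cb \<beta>"
proof -
  \<comment> \<open>For \<open>j = 0\<close> the two values agree, and derivatives of positive order vanish.\<close>
  have 0: "multi_norm j (\<lambda>vs. dirderivs vs (\<lambda>_. c) x - dirderivs vs (\<lambda>_. c) y) = 0" for j and x y :: 'a
  proof -
    have "dirderivs vs (\<lambda>_. c) x = dirderivs vs (\<lambda>_. c) y" for vs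
      by (cases "vs = []") (auto simp: dirderivs_const dirderivs_Nil)
    then have "multi_norm j (\<lambda>vs. dirderivs vs (\<lambda>_. c) x - dirderivs vs (\<lambda>_. c) y) \<le> 0"
      unfolding multi_norm_def by (intro SUP_least) simp
    then show ?thesis by simp
  qed
  have 1: "(SUP x::'a. multi_norm j (\<lambda>vs. dirderivs vs (\<lambda>_. c) x)) \<le> ennreal (norm c)" for j
    unfolding multi_norm_def
  proof (intro SUP_least)
    fix x :: 'a and vs :: "'a list"
    show "ennreal (norm (dirderivs vs (\<lambda>_. c) x)) \<le> ennreal (norm c)"
      by (cases "vs = []") (simp_all add: dirderivs_const dirderivs_Nil)
  qed
  have "Cb_norm \<beta> (\<lambda>_::'a. c) = (\<Sum>j\<le>hoelder_order \<beta>. SUP x::'a. multi_norm j (\<lambda>vs. dirderivs vs (\<lambda>_. c) x))"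
  proof -
    have "(SUP x. SUP y\<in>- {x::'a}. multi_norm (hoelder_order \<beta>)
        (\<lambda>vs. dirderivs vs (\<lambda>_. c) x - dirderivs vs (\<lambda>_. c) y) / ennreal (dist x y powr hoelder_exponent \<beta>)) \<le> 0"
      by (intro SUP_least) (simp add: 0)
    then show ?thesis unfolding Cb_norm_def by simp
  qed
  also have "\<dots> \<le> (\<Sum>j\<le>hoelder_order \<beta>. ennreal (norm c))" by (intro sum_mono 1)
  also have "\<dots> < \<infinity>" by (simp add: ennreal_mult_less_top of_nat_less_top)
  finally show ?thesis by (simp add: Cb_def times_cont_diff_const)
qed

definition Cb_ball :: "real \<Rightarrow> real \<Rightarrow> ('a::euclidean_space \<Rightarrow> real) set" where
  "Cb_ball \<beta> B = {\<phi> \<in> Cb \<beta>. Cb_norm \<beta> \<phi> \<le> ennreal B}"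

lemma
  fixes \<phi> :: "real ^ 'dx::finite \<Rightarrow> real"
  assumes "\<phi> \<in> Cb_ball 3 B" "B \<ge> 0"
  shows Cb_ball_bound: "\<bar>\<phi> x\<bar> \<le> B"
    and Cb_ball_deriv_bound: "\<bar>dirderivs [axis i 1] \<phi> x\<bar> \<le> B"
    and Cb_ball_deriv2_bound: "\<bar>dirderivs [axis i 1, axis j 1] \<phi> x\<bar> \<le> B"
    and Cb_ball_differentiable: "\<phi> differentiable (at x)"
    and Cb_ball_deriv_differentiable: "dirderivs [v] \<phi> differentiable (at x)"
proof -
  have n: "Cb_norm 3 \<phi> \<le> ennreal B" and d: "times_cont_diff (Suc (Suc 0)) \<phi>"
    using assms(1) by (auto simp: Cb_ball_def Cb_def hoelder_order_3 numeral_2_eq_2)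
  note le = norm_dirderivs_le[OF n assms(2), unfolded hoelder_order_3 real_norm_def]
  show "\<bar>\<phi> x\<bar> \<le> B" using le[of "[]" x] by simp
  show "\<bar>dirderivs [axis i 1] \<phi> x\<bar> \<le> B" by (rule le) auto
  show "\<bar>dirderivs [axis i 1, axis j 1] \<phi> x\<bar> \<le> B" by (rule le) auto
  show "\<phi> differentiable (at x)" using d by simp
  show "dirderivs [v] \<phi> differentiable (at x)" using d by (simp add: dirderivs_singleton)
qed

lemma Cb_ball_mono: "B \<le> B' \<Longrightarrow> Cb_ball \<beta> B \<subseteq> Cb_ball \<beta> B'"
  unfolding Cb_ball_def by (auto intro: order_trans ennreal_leI)

text \<open>Regularity of order greater than one makes the vector field differentiable. Membership in the
  Hoelder space at every time comes from measurability as a map into that space.\<close>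

lemma controlled_vf_bounds:
  assumes "controlled_vf T \<alpha> \<beta> Y g g'"
  obtains K where "K \<ge> 0"
    "\<forall>t\<in>{0..T}. \<forall>x. norm (g t x) \<le> K \<and> norm (g' t x) \<le> K \<and> g t differentiable (at x)
        \<and> (\<forall>v. norm v \<le> 1 \<longrightarrow> norm (frechet_derivative (g t) (at x) v) \<le> K)"
proof -
  have \<beta>: "1 < \<beta>" and g: "g \<in> restrict_space borel {0..T} \<rightarrow>\<^sub>M Cb_borel \<beta>"
    and fin: "(SUP t\<in>{0..T}. Cb_norm \<beta> (g t)) + (SUP t\<in>{0..T}. Cb_norm (\<beta> - 1) (g' t)) < \<infinity>"
    using assms unfolding controlled_vf_def by auto
  obtain K where K: "K \<ge> 0"
    "(SUP t\<in>{0..T}. Cb_norm \<beta> (g t)) + (SUP t\<in>{0..T}. Cb_norm (\<beta> - 1) (g' t)) = ennreal K"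
    using fin by (metis ennreal_cases infinity_ennreal_def less_irrefl)
  have "norm (g t x) \<le> K \<and> norm (g' t x) \<le> K \<and> g t differentiable (at x)
        \<and> (\<forall>v. norm v \<le> 1 \<longrightarrow> norm (frechet_derivative (g t) (at x) v) \<le> K)"
    if t: "t \<in> {0..T}" for t x
  proof -
    have gK: "Cb_norm \<beta> (g t) \<le> ennreal K"
      unfolding K(2)[symmetric] using t by (intro add_increasing2 SUP_upper) auto
    have g'K: "Cb_norm (\<beta> - 1) (g' t) \<le> ennreal K"
      unfolding K(2)[symmetric] using t by (intro add_increasing SUP_upper) auto
    have "g t \<in> space (Cb_borel \<beta>)"
      using g t by (intro measurable_space[OF g]) (simp add: space_restrict_space)
    moreover have "space (Cb_borel \<beta>) = (Cb \<beta> :: ('b \<Rightarrow> (real, 'a) vec \<Rightarrow>\<^sub>L 'c) set)"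
      unfolding Cb_borel_def by (rule space_measure_of) auto
    ultimately have "times_cont_diff (hoelder_order \<beta>) (g t)" by (simp add: Cb_def)
    then have "g t differentiable (at x)"
      using hoelder_order_pos[OF \<beta>] by (cases "hoelder_order \<beta>") auto
    moreover have "norm (g t x) \<le> K" using norm_dirderivs_le[OF gK K(1), of "[]" x] by simp
    moreover have "norm (g' t x) \<le> K" using norm_dirderivs_le[OF g'K K(1), of "[]" x] by simp
    moreover have "norm (frechet_derivative (g t) (at x) v) \<le> K" if "norm v \<le> 1" for v
      using norm_dirderivs_le[OF gK K(1), of "[v]" x] hoelder_order_pos[OF \<beta>] that
      by (simp add: dirderivs_singleton del: dirderivs.simps)
    ultimately show ?thesis by blast
  qed
  then show thesis using that K(1) by blast
qed

lemma norm_cmp_le: "norm (cmp L k) \<le> norm L"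
  using norm_blinfun[of L "axis k 1"] by (simp add: cmp_def)

lemma norm_cmp2_le: "norm (cmp2 M k l) \<le> norm M"
proof -
  have "norm (cmp2 M k l) \<le> norm (blinfun_apply M (axis l 1))"
    using norm_blinfun[of "blinfun_apply M (axis l 1)" "axis k 1"] by (simp add: cmp2_def)
  also have "\<dots> \<le> norm M" using norm_blinfun[of M "axis l 1"] by simp
  finally show ?thesis .
qed

lemma abs_cmp_nth_le: "\<bar>cmp L k $ i\<bar> \<le> norm L"
  using norm_cmp_le[of L k] component_le_norm_cart[of "cmp L k" i] by linarith

lemma abs_cmp2_nth_le: "\<bar>cmp2 M k l $ i\<bar> \<le> norm M"
  using norm_cmp2_le[of M k l] component_le_norm_cart[of "cmp2 M k l" i] by linarith

lemma abs_cmp_le: "\<bar>cmp L k\<bar> \<le> norm L"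
  using norm_cmp_le[of L k] by simp

lemma abs_cmp2_le: "\<bar>cmp2 M k l\<bar> \<le> norm M"
  using norm_cmp2_le[of M k l] by simp

lemma bounded_linear_cmp: "bounded_linear (\<lambda>L. cmp L k)"
  unfolding cmp_def by (rule blinfun.bounded_linear_left)

lemma opG_one: "opG c t k (\<lambda>_. 1) = (\<lambda>x. cmp (coef_h c t x) k)"
  by (intro ext) (simp add: opG_def dirderivs_const del: dirderivs.simps)

lemma opA_one: "opA T c \<Y> t (\<lambda>_. 1) = (\<lambda>_. 0)"
  by (intro ext) (simp add: opA_def dirderivs_const del: dirderivs.simps)

text \<open>The operator \<open>\<Gamma>\<^sub>k \<Gamma>\<^sub>l\<close> differentiates the coefficients inside \<open>\<Gamma>\<^sub>l \<phi>\<close>, so its bound needs this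
  explicit form of the derivative.\<close>

lemma dirderivs_opG:
  fixes c :: "('dx::finite, 'dy::finite, 'db::finite) coeffs"
  assumes f: "coef_f c t differentiable (at x)" and h: "coef_h c t differentiable (at x)"
    and \<phi>: "\<phi> differentiable (at x)" and \<phi>': "\<And>i. dirderivs [axis i 1] \<phi> differentiable (at x)"
  shows "dirderivs [v] (opG c t k \<phi>) x =
    (\<Sum>i\<in>UNIV. cmp (coef_f c t x) k $ i * dirderivs [v, axis i 1] \<phi> x
        + cmp (frechet_derivative (coef_f c t) (at x) v) k $ i * dirderivs [axis i 1] \<phi> x)
    + (cmp (coef_h c t x) k * dirderivs [v] \<phi> x + cmp (frechet_derivative (coef_h c t) (at x) v) k * \<phi> x)"
proof -
  have df: "((\<lambda>x. cmp (coef_f c t x) k $ i) has_derivative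
      (\<lambda>v. cmp (frechet_derivative (coef_f c t) (at x) v) k $ i)) (at x)" for i
    by (intro bounded_linear.has_derivative[OF bounded_linear_vec_nth]
        bounded_linear.has_derivative[OF bounded_linear_cmp] frechet_derivative_works[THEN iffD1, OF f])
  have dh: "((\<lambda>x. cmp (coef_h c t x) k) has_derivative
      (\<lambda>v. cmp (frechet_derivative (coef_h c t) (at x) v) k)) (at x)"
    by (intro bounded_linear.has_derivative[OF bounded_linear_cmp] frechet_derivative_works[THEN iffD1, OF h])
  have "(opG c t k \<phi> has_derivative (\<lambda>v. (\<Sum>i\<in>UNIV. cmp (coef_f c t x) k $ i * frechet_derivative (dirderivs [axis i 1] \<phi>) (at x) v
        + cmp (frechet_derivative (coef_f c t) (at x) v) k $ i * dirderivs [axis i 1] \<phi> x)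
    + (cmp (coef_h c t x) k * frechet_derivative \<phi> (at x) v + cmp (frechet_derivative (coef_h c t) (at x) v) k * \<phi> x))) (at x)"
    unfolding opG_def[abs_def]
    by (intro has_derivative_add has_derivative_sum has_derivative_mult df dh frechet_derivative_works[THEN iffD1, OF \<phi>] frechet_derivative_works[THEN iffD1, OF \<phi>'])
  from frechet_derivative_at[OF this] show ?thesis
    by (simp add: dirderivs_Nil fun_eq_iff del: dirderivs.simps(1))
qed

text \<open>The part of the standing assumption on the coefficients, at a fixed rough path, from which the
  operator bounds follow.\<close>

locale zakai_coefficients = rough_path_C1 T \<alpha> \<Y>
  for T \<alpha> :: real and \<Y> :: "('dy::finite) rough" +
  fixes c :: "('dx::finite, 'dy, 'db::finite) coeffs"
  assumes b_bound: "\<exists>K. \<forall>t\<in>{0..T}. \<forall>x. norm (coef_b c t x) \<le> K"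
    and \<sigma>_bound: "\<exists>K. \<forall>t\<in>{0..T}. \<forall>x. norm (coef_\<sigma> c t x) \<le> K"
    and f_controlled: "\<exists>\<beta>. controlled_vf T \<alpha> \<beta> (fst \<Y>) (coef_f c) (coef_f' c)"
    and h_controlled: "\<exists>\<beta>. controlled_vf T \<alpha> \<beta> (fst \<Y>) (coef_h c) (coef_h' c)"
begin

abbreviation test_dom :: "real \<Rightarrow> ((real ^ 'dx \<Rightarrow> real) \<times> (real ^ 'dx)) set" where
  "test_dom B \<equiv> Cb_ball 3 B \<times> UNIV"

text \<open>Boundedness of the operators uniformly in the test function and in the point \<open>x\<close> is boundedness
  of a family indexed by pairs \<open>(\<phi>, x)\<close>. The closure of bounded families under sums and
  products then does the estimates.\<close>

lemma bounded_coef: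
  fixes L :: "real \<Rightarrow> real ^ 'dx \<Rightarrow> real"
  assumes "\<exists>K. \<forall>t\<in>{0..T}. \<forall>x. norm (g t x) \<le> K" "\<And>t x. \<bar>L t x\<bar> \<le> norm (g t x)"
  shows "bounded_family T (test_dom B) (\<lambda>i t. L t (snd i))"
proof -
  obtain K where "\<forall>t\<in>{0..T}. \<forall>x. norm (g t x) \<le> K" using assms(1) by blast
  then show ?thesis
    using order_trans[OF assms(2)] by (intro bounded_familyI[where K=K]) auto
qed

lemma coef_f_facts:
  "\<exists>K. \<forall>t\<in>{0..T}. \<forall>x. norm (coef_f c t x) \<le> K"
  "\<exists>K. \<forall>t\<in>{0..T}. \<forall>x. norm (coef_f' c t x) \<le> K"
  "\<exists>K. \<forall>t\<in>{0..T}. \<forall>x. norm (frechet_derivative (coef_f c t) (at x) (axis i 1)) \<le> K"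
  "t \<in> {0..T} \<Longrightarrow> coef_f c t differentiable (at x)"
proof -
  obtain \<beta> where "controlled_vf T \<alpha> \<beta> (fst \<Y>) (coef_f c) (coef_f' c)" using f_controlled by blast
  then obtain K where K: "K \<ge> 0"
    "\<forall>t\<in>{0..T}. \<forall>x. norm (coef_f c t x) \<le> K \<and> norm (coef_f' c t x) \<le> K \<and> coef_f c t differentiable (at x)
        \<and> (\<forall>v. norm v \<le> 1 \<longrightarrow> norm (frechet_derivative (coef_f c t) (at x) v) \<le> K)"
    by (rule controlled_vf_bounds)
  then show "\<exists>K. \<forall>t\<in>{0..T}. \<forall>x. norm (coef_f c t x) \<le> K"
    "\<exists>K. \<forall>t\<in>{0..T}. \<forall>x. norm (coef_f' c t x) \<le> K"
    "t \<in> {0..T} \<Longrightarrow> coef_f c t differentiable (at x)" by blast+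
  show "\<exists>K. \<forall>t\<in>{0..T}. \<forall>x. norm (frechet_derivative (coef_f c t) (at x) (axis i 1)) \<le> K"
    using K(2) by (intro exI[of _ K]) simp
qed

lemma coef_h_facts:
  "\<exists>K. \<forall>t\<in>{0..T}. \<forall>x. norm (coef_h c t x) \<le> K"
  "\<exists>K. \<forall>t\<in>{0..T}. \<forall>x. norm (coef_h' c t x) \<le> K"
  "\<exists>K. \<forall>t\<in>{0..T}. \<forall>x. norm (frechet_derivative (coef_h c t) (at x) (axis i 1)) \<le> K"
  "t \<in> {0..T} \<Longrightarrow> coef_h c t differentiable (at x)"
proof -
  obtain \<beta> where "controlled_vf T \<alpha> \<beta> (fst \<Y>) (coef_h c) (coef_h' c)" using h_controlled by blast
  then obtain K where K: "K \<ge> 0"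
    "\<forall>t\<in>{0..T}. \<forall>x. norm (coef_h c t x) \<le> K \<and> norm (coef_h' c t x) \<le> K \<and> coef_h c t differentiable (at x)
        \<and> (\<forall>v. norm v \<le> 1 \<longrightarrow> norm (frechet_derivative (coef_h c t) (at x) v) \<le> K)"
    by (rule controlled_vf_bounds)
  then show "\<exists>K. \<forall>t\<in>{0..T}. \<forall>x. norm (coef_h c t x) \<le> K"
    "\<exists>K. \<forall>t\<in>{0..T}. \<forall>x. norm (coef_h' c t x) \<le> K"
    "t \<in> {0..T} \<Longrightarrow> coef_h c t differentiable (at x)" by blast+
  show "\<exists>K. \<forall>t\<in>{0..T}. \<forall>x. norm (frechet_derivative (coef_h c t) (at x) (axis i 1)) \<le> K"
    using K(2) by (intro exI[of _ K]) simp
qed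

lemmas bounded_coefs =
  bounded_coef[OF coef_f_facts(1), OF abs_cmp_nth_le]
  bounded_coef[OF coef_f_facts(2), OF abs_cmp2_nth_le]
  bounded_coef[OF coef_f_facts(3), OF abs_cmp_nth_le]
  bounded_coef[OF coef_h_facts(1), OF abs_cmp_le]
  bounded_coef[OF coef_h_facts(2), OF abs_cmp2_le]
  bounded_coef[OF coef_h_facts(3), OF abs_cmp_le]
  bounded_coef[OF \<sigma>_bound, OF abs_cmp_nth_le]
  bounded_coef[OF b_bound, OF component_le_norm_cart]

lemma bounded_test:
  assumes "B \<ge> 0"
  shows "bounded_family T (test_dom B) (\<lambda>i t. fst i (snd i))"
    and "bounded_family T (test_dom B) (\<lambda>i t. dirderivs [axis j 1] (fst i) (snd i))"
    and "bounded_family T (test_dom B) (\<lambda>i t. dirderivs [axis j 1, axis k 1] (fst i) (snd i))"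
proof -
  show "bounded_family T (test_dom B) (\<lambda>i t. fst i (snd i))"
    using Cb_ball_bound assms by (intro bounded_familyI[where K=B]) auto
  show "bounded_family T (test_dom B) (\<lambda>i t. dirderivs [axis j 1] (fst i) (snd i))"
    using Cb_ball_deriv_bound[OF _ assms]
    by (intro bounded_familyI[where K=B]) (auto simp del: dirderivs.simps)
  show "bounded_family T (test_dom B) (\<lambda>i t. dirderivs [axis j 1, axis k 1] (fst i) (snd i))"
    using Cb_ball_deriv2_bound[OF _ assms]
    by (intro bounded_familyI[where K=B]) (auto simp del: dirderivs.simps)
qed

lemma bounded_bracket: "bounded_family T (test_dom B) (\<lambda>i t. bracket_deriv T \<Y> t $ k $ l)"
  by (rule bounded_family_if_continuous_on[OF dbr_continuous])

lemma bounded_opG: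
  assumes "B \<ge> 0"
  shows "bounded_family T (test_dom B) (\<lambda>i t. opG c t k (fst i) (snd i))"
  unfolding opG_def
  by (intro bounded_family_add bounded_family_sum bounded_family_mult bounded_coefs bounded_test assms)

lemma bounded_opG':
  assumes "B \<ge> 0"
  shows "bounded_family T (test_dom B) (\<lambda>i t. opG' c t k l (fst i) (snd i))"
  unfolding opG'_def
  by (intro bounded_family_add bounded_family_sum bounded_family_mult bounded_coefs bounded_test assms)

lemma bounded_opA:
  assumes "B \<ge> 0"
  shows "bounded_family T (test_dom B) (\<lambda>i t. opA T c \<Y> t (fst i) (snd i))"
  unfolding opA_def
  by (intro bounded_family_add bounded_family_sum bounded_family_mult bounded_coefs bounded_test
      bounded_bracket bounded_family_const assms)

lemma bounded_opGG:
  assumes B: "B \<ge> 0"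
  shows "bounded_family T (test_dom B) (\<lambda>i t. opGG c t k l (fst i) (snd i))"
proof -
  let ?D = "\<lambda>j i t. (\<Sum>n\<in>UNIV. cmp (coef_f c t (snd i)) l $ n * dirderivs [axis j 1, axis n 1] (fst i) (snd i)
        + cmp (frechet_derivative (coef_f c t) (at (snd i)) (axis j 1)) l $ n * dirderivs [axis n 1] (fst i) (snd i))
    + (cmp (coef_h c t (snd i)) l * dirderivs [axis j 1] (fst i) (snd i)
        + cmp (frechet_derivative (coef_h c t) (at (snd i)) (axis j 1)) l * fst i (snd i))"
  have bD: "bounded_family T (test_dom B) (?D j)" for j
    by (intro bounded_family_add bounded_family_sum bounded_family_mult bounded_coefs bounded_test B)
  have D: "dirderivs [axis j 1] (opG c t l (fst i)) (snd i) = ?D j i t" if "i \<in> test_dom B" "0 \<le> t" "t \<le> T" for i j t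
    using that coef_f_facts(4) coef_h_facts(4) Cb_ball_differentiable[OF _ B] Cb_ball_deriv_differentiable[OF _ B]
    by (intro dirderivs_opG) auto
  have "bounded_family T (test_dom B) (\<lambda>i t. (\<Sum>j\<in>UNIV. cmp (coef_f c t (snd i)) k $ j * ?D j i t)
      + cmp (coef_h c t (snd i)) k * opG c t l (fst i) (snd i) + opG' c t l k (fst i) (snd i))"
    by (intro bounded_family_add bounded_family_sum bounded_family_mult bounded_coefs bD bounded_opG bounded_opG' B)
  then obtain K where K: "K > 0" "\<forall>i t. i \<in> test_dom B \<longrightarrow> 0 \<le> t \<longrightarrow> t \<le> T \<longrightarrow>
      \<bar>(\<Sum>j\<in>UNIV. cmp (coef_f c t (snd i)) k $ j * ?D j i t)
      + cmp (coef_h c t (snd i)) k * opG c t l (fst i) (snd i) + opG' c t l k (fst i) (snd i)\<bar> \<le> K"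
    by (rule bounded_familyE)
  show ?thesis
  proof (rule bounded_familyI[where K=K])
    fix i t assume *: "i \<in> test_dom B" "0 \<le> t" "t \<le> T"
    show "\<bar>opGG c t k l (fst i) (snd i)\<bar> \<le> K"
      using K(2)[rule_format, OF *] unfolding opGG_def opG_def[of c t k "opG c t l (fst i)"] D[OF *] .
  qed
qed

end

section \<open>Normalised measures\<close>

lemma bounded_family_integral:
  fixes \<mu> :: "real \<Rightarrow> 'a measure"
  assumes g: "bounded_family T (S \<times> UNIV) (\<lambda>i t. g (fst i) t (snd i))"
    and fin: "\<And>t. 0 \<le> t \<Longrightarrow> t \<le> T \<Longrightarrow> finite_measure (\<mu> t)"
    and M: "\<And>t. 0 \<le> t \<Longrightarrow> t \<le> T \<Longrightarrow> (\<integral>x. 1 \<partial>\<mu> t) \<le> (M :: real)"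
  shows "bounded_family T S (\<lambda>i t. \<integral>x. g i t x \<partial>\<mu> t)"
proof -
  obtain K where K: "K > 0" "\<forall>i t. i \<in> S \<times> UNIV \<longrightarrow> 0 \<le> t \<longrightarrow> t \<le> T \<longrightarrow> \<bar>g (fst i) t (snd i)\<bar> \<le> K"
    by (rule bounded_familyE[OF g])
  show ?thesis
  proof (rule bounded_familyI[where K="K * M"])
    fix i t assume *: "i \<in> S" "0 \<le> t" "t \<le> T"
    interpret finite_measure "\<mu> t" using fin * by blast
    have b: "\<bar>g i t x\<bar> \<le> K" for x using K(2) * by force
    have "\<bar>\<integral>x. g i t x \<partial>\<mu> t\<bar> \<le> (\<integral>x. K \<partial>\<mu> t)"
    \<comment> \<open>The integral is 0 by convention if \<open>g\<close> is not integrable.\<close>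
    proof (cases "integrable (\<mu> t) (g i t)")
      case True
      then have "(\<integral>x. \<bar>g i t x\<bar> \<partial>\<mu> t) \<le> (\<integral>x. K \<partial>\<mu> t)"
        using b by (intro Bochner_Integration.integral_mono) auto
      then show ?thesis using integral_abs_bound[of "\<mu> t" "g i t"] by linarith
    qed (use K in \<open>simp add: not_integrable_integral_eq\<close>)
    also have "\<dots> = K * (\<integral>x. 1 \<partial>\<mu> t)" by simp
    also have "\<dots> \<le> K * M" using K(1) M[OF *(2,3)] by (intro mult_left_mono) auto
    finally show "\<bar>\<integral>x. g i t x \<partial>\<mu> t\<bar> \<le> K * M" .
  qed
qed

lemma normalized_eq:
  assumes "finite_measure M"  "(\<integral>x. 1 \<partial>M) > (0::real)"
  shows "normalized M = scale_measure (ennreal (1 / (\<integral>x. 1 \<partial>M))) M"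
proof -
  interpret finite_measure M by fact
  have "1 / emeasure M (space M) = ennreal (1 / (\<integral>x. 1 \<partial>M))"
    using assms(2) by (simp add: emeasure_eq_measure divide_ennreal flip: ennreal_1)
  then show ?thesis unfolding normalized_def by simp
qed

text \<open>Scaling a measure is the same as giving it a constant density. For a function that is not
  measurable both sides are zero, by the convention for integrals of such functions.\<close>

lemma integral_scale_measure:
  fixes f :: "'a \<Rightarrow> real"
  assumes "r > 0"
  shows "(\<integral>x. f x \<partial>scale_measure (ennreal r) M) = r * (\<integral>x. f x \<partial>M)"
proof -
  have eq: "scale_measure (ennreal r) M = density M (\<lambda>_. ennreal r)"
    by (rule measure_eqI) (auto simp: emeasure_density nn_integral_cmult_indicator)
  show ?thesis
  proof (cases "f \<in> borel_measurable M")
    case True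
    then show ?thesis using assms by (simp add: eq integral_density)
  next
    case False
    then have "\<not> integrable M f" "\<not> integrable (density M (\<lambda>_. ennreal r)) f"
      using borel_measurable_integrable by fastforce+
    then show ?thesis by (simp add: eq not_integrable_integral_eq)
  qed
qed

lemma integral_normalized:
  fixes f :: "'a \<Rightarrow> real"
  assumes "finite_measure M"  "(\<integral>x. 1 \<partial>M) > (0::real)"
  shows "(\<integral>x. f x \<partial>normalized M) = (\<integral>x. f x \<partial>M) / (\<integral>x. 1 \<partial>M)"
  unfolding normalized_eq[OF assms] using assms(2) by (subst integral_scale_measure) simp_all

lemma finite_borel_normalized:
  assumes "finite_borel M" "(\<integral>x. 1 \<partial>M) > (0::real)"
  shows "finite_borel (normalized M)"
proof -
  have fin: "finite_measure M" using assms(1) by (simp add: finite_borel_def)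
  interpret finite_measure M by fact
  have "finite_measure (normalized M)"
    unfolding normalized_eq[OF fin assms(2)]
    by (intro finite_measureI) (simp add: space_scale_measure ennreal_mult_eq_top_iff)
  then show ?thesis using assms(1) by (simp add: finite_borel_def normalized_def)
qed

section \<open>From the Zakai to the Kushner--Stratonovich equation\<close>

locale zakai_setting = zakai_coefficients T \<alpha> \<Y> c
  for T \<alpha> :: real and \<Y> :: "('dy::finite) rough" and c :: "('dx::finite, 'dy, 'db::finite) coeffs" +
  fixes \<mu> :: "real \<Rightarrow> (real ^ 'dx) measure"
  assumes zakai: "zakai_solution T \<alpha> c \<Y> \<mu>"
    and mass_pos: "\<And>t. t \<in> {0..T} \<Longrightarrow> (\<integral>x. 1 \<partial>\<mu> t) > (0::real)"
begin

definition mean where "mean \<phi> t = (\<integral>x. \<phi> x \<partial>\<mu> t)" for \<phi> :: "real ^ 'dx \<Rightarrow> real"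
definition mean_opG where "mean_opG \<phi> t k = (\<integral>x. opG c t k \<phi> x \<partial>\<mu> t)"
definition mean_opGG where "mean_opGG \<phi> t k l = (\<integral>x. opGG c t k l \<phi> x \<partial>\<mu> t)"
definition mean_opA where "mean_opA \<phi> t = (\<integral>x. opA T c \<Y> t \<phi> x \<partial>\<mu> t)"

abbreviation one :: "real ^ 'dx \<Rightarrow> real" where "one \<equiv> \<lambda>_. 1"

lemma finite_\<mu>: "0 \<le> t \<Longrightarrow> t \<le> T \<Longrightarrow> finite_measure (\<mu> t)"
  and finite_borel_\<mu>: "0 \<le> t \<Longrightarrow> t \<le> T \<Longrightarrow> finite_borel (\<mu> t)"
  and mean_continuous: "continuous_on UNIV \<phi> \<Longrightarrow> bounded (range \<phi>) \<Longrightarrow> continuous_on {0..T} (mean \<phi>)"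
  using zakai unfolding zakai_solution_def weakly_continuous_curve_def finite_borel_def mean_def[abs_def]
  by auto

lemma mass_continuous: "continuous_on {0..T} (mean one)"
  by (intro mean_continuous continuous_intros) (auto intro: boundedI)

lemma mass_bounds:
  obtains l M where "l > 0" "\<forall>t\<in>{0..T}. l \<le> mean one t \<and> mean one t \<le> M"
proof -
  have ne: "{0..T} \<noteq> {}" using T_pos by simp
  obtain s where s: "s \<in> {0..T}" "\<forall>t\<in>{0..T}. mean one s \<le> mean one t"
    using continuous_attains_inf[OF compact_Icc ne mass_continuous] by blast
  obtain u where u: "u \<in> {0..T}" "\<forall>t\<in>{0..T}. mean one t \<le> mean one u"
    using continuous_attains_sup[OF compact_Icc ne mass_continuous] by blast
  show thesis
    using that[of "mean one s" "mean one u"] mass_pos[OF s(1)] s u by (simp add: mean_def)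
qed

lemma rough_expansion_mean:
  assumes B: "B \<ge> 0"
  shows "rough_expansion (Cb_ball 3 B) mean mean_opG mean_opGG mean_opA"
proof -
  let ?S = "Cb_ball 3 B :: (real ^ 'dx \<Rightarrow> real) set"
  obtain l M where lM: "l > 0" "\<forall>t\<in>{0..T}. l \<le> mean one t \<and> mean one t \<le> M"
    by (rule mass_bounds)
  have M: "(\<integral>x. 1 \<partial>\<mu> t) \<le> (M::real)" if "0 \<le> t" "t \<le> T" for t
    using lM(2) that by (simp add: mean_def)
  note bnd = bounded_family_integral[OF _ finite_\<mu> M]
  have "bounded_family T ?S mean"
    unfolding mean_def[abs_def] by (intro bnd bounded_test B) auto
  moreover have "bounded_family T ?S mean_opA"
    unfolding mean_opA_def[abs_def] by (intro bnd bounded_opA B) auto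
  moreover have bG: "bounded_family T ?S (\<lambda>\<phi> t. mean_opG \<phi> t k)" for k
    unfolding mean_opG_def by (intro bnd bounded_opG B) auto
  moreover have bGG: "bounded_family T ?S (\<lambda>\<phi> t. mean_opGG \<phi> t k l)" for k l
    unfolding mean_opGG_def by (intro bnd bounded_opGG B) auto
  obtain K where K: "\<forall>\<phi>\<in>Cb 3. Cb_norm 3 \<phi> \<le> ennreal B \<longrightarrow>
        (\<forall>s t. 0 \<le> s \<and> s \<le> t \<and> t \<le> T \<longrightarrow>
           (\<forall>k l. \<bar>mean_opGG \<phi> t k l - mean_opGG \<phi> s k l\<bar> \<le> K * (t - s) powr \<alpha>) \<and>
           (\<forall>k. \<bar>mean_opG \<phi> t k - mean_opG \<phi> s k - (\<Sum>m\<in>UNIV. mean_opGG \<phi> s m k * dY s t m)\<bar>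
                    \<le> K * (t - s) powr (2 * \<alpha>)))"
    using zakai unfolding zakai_solution_def mean_opG_def mean_opGG_def by meson
  have "controlled_family T \<alpha> (fst \<Y>) ?S (\<lambda>\<phi> t. mean_opG \<phi> t k) (\<lambda>\<phi> t m. mean_opGG \<phi> t m k)" for k
    unfolding controlled_family_def
    by (intro conjI allI bG bGG; rule order_familyI[where K=K]) (use K in \<open>auto simp: Cb_ball_def\<close>)
  moreover have "set_integrable lborel {0..T} (mean_opA \<phi>) \<and>
        little_o_increment T (\<lambda>s t. mean \<phi> t - mean \<phi> s - (LINT r:{s..t}|lborel. mean_opA \<phi> r)
          - (\<Sum>k\<in>UNIV. mean_opG \<phi> s k * dY s t k)
          - (\<Sum>k\<in>UNIV. \<Sum>l\<in>UNIV. mean_opGG \<phi> s k l * YY s t k l))" if "\<phi> \<in> ?S" for \<phi>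
    using zakai that
    unfolding zakai_solution_def mean_opG_def mean_opGG_def mean_def mean_opA_def[abs_def] Cb_ball_def
    by blast
  ultimately show ?thesis unfolding rough_expansion_def by blast
qed

lemma one_in_ball: obtains B where "B > 0" "one \<in> Cb_ball 3 B"
proof -
  have 1: "one \<in> Cb 3" by (rule const_in_Cb)
  then have "Cb_norm 3 one < \<infinity>" by (simp add: Cb_def)
  then obtain K where "Cb_norm 3 one = ennreal K" "K \<ge> 0" by (cases "Cb_norm 3 one") auto
  then have "Cb_norm 3 one \<le> ennreal (K + 1)" by (simp add: ennreal_leI)
  then show thesis using that[of "K + 1"] 1 \<open>K \<ge> 0\<close> by (simp add: Cb_ball_def)
qed

text \<open>The mass is the mean of the test function 1, viewed as a family that does not depend on its
  index. Its drift vanishes.\<close>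

lemma rough_expansion_mass:
  assumes "one \<in> Cb_ball 3 B" "B \<ge> 0"
  shows "rough_expansion (Cb_ball 3 B :: (real ^ 'dx \<Rightarrow> real) set)
    (\<lambda>_. mean one) (\<lambda>_. mean_opG one) (\<lambda>_. mean_opGG one) (\<lambda>_ _. 0)"
  using rough_expansion_const_index[OF rough_expansion_mean assms(1)] assms(2)
  by (simp add: mean_opA_def[abs_def] opA_one)

abbreviation \<zeta> where "\<zeta> t \<equiv> normalized (\<mu> t)"
text \<open>The means under \<open>\<zeta>\<close>, their first- and second-order coefficients, and the mean of \<open>h\<close>.\<close>

abbreviation "Q \<equiv> ratio mean (\<lambda>_. mean one)"
abbreviation "Q1 \<equiv> ratio_deriv mean (\<lambda>_. mean one) mean_opG (\<lambda>_. mean_opG one)"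
abbreviation "Q2 \<equiv> ratio_deriv2 mean (\<lambda>_. mean one) mean_opG (\<lambda>_. mean_opG one) mean_opGG (\<lambda>_. mean_opGG one)"
abbreviation "QH \<equiv> ratio_comp (\<lambda>_. mean_opG one) (\<lambda>_. mean one)"

lemma integral_\<zeta>:
  fixes f :: "real ^ 'dx \<Rightarrow> real"
  shows "0 \<le> t \<Longrightarrow> t \<le> T \<Longrightarrow> (\<integral>x. f x \<partial>\<zeta> t) = (\<integral>x. f x \<partial>\<mu> t) / mean one t"
  unfolding mean_def by (intro integral_normalized finite_\<mu> mass_pos) auto

text \<open>The coefficients in the Kushner--Stratonovich equation are those of the quotient of the means
  by the mass.\<close>

lemma \<zeta>_simps:
  assumes "0 \<le> t" "t \<le> T"
  shows "(\<integral>x. \<phi> x \<partial>\<zeta> t) = Q \<phi> t" "(\<integral>x. opA T c \<Y> t \<phi> x \<partial>\<zeta> t) = mean_opA \<phi> t / mean one t"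
    and "mean_h c \<zeta> t k = QH \<phi> t k" and "Phi c \<zeta> \<phi> t k = Q1 \<phi> t k" and "Phi' c \<zeta> \<phi> t k l = Q2 \<phi> t k l"
  using assms
  by (simp_all add: integral_\<zeta> Phi'_def Phi_def mean_deriv_def mean_G_deriv_def mean_h_def ratio_def ratio_deriv_def
      ratio_deriv2_def ratio_comp_def mean_def mean_opA_def mean_opG_def mean_opGG_def opG_one)

lemma kushner_stratonovich: "kushner_stratonovich_solution T \<alpha> c \<Y> \<zeta>"
proof -
  obtain B1 where B1: "B1 > 0" "one \<in> Cb_ball 3 B1" by (rule one_in_ball)
  obtain l M where lM: "l > 0" "\<forall>t\<in>{0..T}. l \<le> mean one t \<and> mean one t \<le> M"
    by (rule mass_bounds)
  then have m0: "l > 0" "\<forall>\<phi>\<in>S. \<forall>t\<in>{0..T}. l \<le> mean one t" for S :: "(real ^ 'dx \<Rightarrow> real) set"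
    by auto
  \<comment> \<open>The radius is enlarged so that the ball contains the function 1, whose mean is the mass.\<close>
  have ball: "rough_expansion (Cb_ball 3 (max B B1)) mean mean_opG mean_opGG mean_opA"
    "rough_expansion (Cb_ball 3 (max B B1) :: (real ^ 'dx \<Rightarrow> real) set)
      (\<lambda>_. mean one) (\<lambda>_. mean_opG one) (\<lambda>_. mean_opGG one) (\<lambda>_ _. 0)" for B
    using rough_expansion_mean[of "max B B1"] rough_expansion_mass[of "max B B1"] B1
      Cb_ball_mono[of B1 "max B B1" 3] by auto
  have in_ball: "\<exists>B. \<phi> \<in> Cb_ball 3 (max B B1)" if "\<phi> \<in> Cb 3" for \<phi> :: "real ^ 'dx \<Rightarrow> real"
  proof -
    have "Cb_norm 3 \<phi> < \<infinity>" using that by (simp add: Cb_def)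
    then obtain K where "Cb_norm 3 \<phi> = ennreal K" by (cases "Cb_norm 3 \<phi>") auto
    then show ?thesis using that by (intro exI[of _ K]) (simp add: Cb_ball_def ennreal_leI)
  qed
  have weak: "weakly_continuous_curve T \<zeta>"
    unfolding weakly_continuous_curve_def
  proof (intro conjI ballI allI impI)
    fix t assume "t \<in> {0..T}"
    then show "finite_borel (\<zeta> t)" by (intro finite_borel_normalized finite_borel_\<mu> mass_pos) auto
  next
    fix \<phi> :: "real ^ 'dx \<Rightarrow> real" assume "continuous_on UNIV \<phi> \<and> bounded (range \<phi>)"
    then have "continuous_on {0..T} (\<lambda>t. mean \<phi> t / mean one t)"
      using mean_continuous mass_continuous lM by (intro continuous_on_divide) fastforce+
    then show "continuous_on {0..T} (\<lambda>t. \<integral>x. \<phi> x \<partial>\<zeta> t)"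
      by (rule continuous_on_eq) (simp add: integral_\<zeta> mean_def)
  qed
  have int: "set_integrable lborel {0..T} (\<lambda>t. \<integral>x. opA T c \<Y> t \<phi> x \<partial>\<zeta> t) \<and>
      set_integrable lborel {0..T} (\<lambda>t. \<Sum>k\<in>UNIV. \<Sum>l\<in>UNIV.
          Phi c \<zeta> \<phi> t k * bracket_deriv T \<Y> t $ k $ l * mean_h c \<zeta> t l)" if \<phi>: "\<phi> \<in> Cb 3" for \<phi>
  proof -
    obtain B where B: "\<phi> \<in> Cb_ball 3 (max B B1)" using in_ball[OF \<phi>] by blast
    have "set_integrable lborel {0..T} (\<lambda>t. \<integral>x. opA T c \<Y> t \<phi> x \<partial>\<zeta> t)
        \<longleftrightarrow> set_integrable lborel {0..T} (\<lambda>t. mean_opA \<phi> t / mean one t)"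
      by (intro set_integrable_cong refl) (simp add: \<zeta>_simps(2))
    moreover have "set_integrable lborel {0..T} (\<lambda>t. \<Sum>k\<in>UNIV. \<Sum>l\<in>UNIV.
          Phi c \<zeta> \<phi> t k * dbr t k l * mean_h c \<zeta> t l)
        \<longleftrightarrow> set_integrable lborel {0..T} (\<lambda>t. \<Sum>k\<in>UNIV. \<Sum>l\<in>UNIV. Q1 \<phi> t k * dbr t k l * QH \<phi> t l)"
      by (intro set_integrable_cong refl) (simp add: \<zeta>_simps(3)[of _ _ \<phi>] \<zeta>_simps(4))
    ultimately show ?thesis
      using quot_drift_integrable[OF ball[of B] m0 B] quot_correction_double_integrable[OF ball[of B] m0 B]
      by blast
  qed
  have reg: "\<exists>K>0. \<forall>\<phi>\<in>Cb 3. Cb_norm 3 \<phi> \<le> ennreal B \<longrightarrow>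
        (\<forall>s t. 0 \<le> s \<and> s \<le> t \<and> t \<le> T \<longrightarrow>
           (\<forall>k l. \<bar>Phi' c \<zeta> \<phi> t k l - Phi' c \<zeta> \<phi> s k l\<bar> \<le> K * (t - s) powr \<alpha>) \<and>
           (\<forall>k. \<bar>Phi c \<zeta> \<phi> t k - Phi c \<zeta> \<phi> s k
                    - (\<Sum>m\<in>UNIV. Phi' c \<zeta> \<phi> s k m * incr (fst \<Y>) s t $ m)\<bar>
                    \<le> K * (t - s) powr (2 * \<alpha>)))" for B
  proof -
    let ?S = "Cb_ball 3 (max B B1) :: (real ^ 'dx \<Rightarrow> real) set"
    note ctrl = controlled_quot_deriv[OF ball[of B] m0]
    have "order_family T \<alpha> (UNIV \<times> ?S)
        (\<lambda>x s t. Q2 (snd x) t (fst (fst x)) (snd (fst x)) - Q2 (snd x) s (fst (fst x)) (snd (fst x)))"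
      by (intro order_family_finite_index controlled_family_deriv_order[OF ctrl])
    then obtain K where K: "K > 0" "\<forall>x s t. x \<in> UNIV \<times> ?S \<longrightarrow> 0 \<le> s \<longrightarrow> s \<le> t \<longrightarrow> t \<le> T \<longrightarrow>
        \<bar>Q2 (snd x) t (fst (fst x)) (snd (fst x)) - Q2 (snd x) s (fst (fst x)) (snd (fst x))\<bar>
          \<le> K * (t - s) powr \<alpha>"
      by (rule order_familyE)
    have "order_family T (2 * \<alpha>) (UNIV \<times> ?S) (\<lambda>x s t. Q1 (snd x) t (fst x) - Q1 (snd x) s (fst x)
        - (\<Sum>m\<in>UNIV. Q2 (snd x) s (fst x) m * dY s t m))"
      by (intro order_family_finite_index controlled_family_remainder[OF ctrl])
    then obtain L where L: "L > 0" "\<forall>x s t. x \<in> UNIV \<times> ?S \<longrightarrow> 0 \<le> s \<longrightarrow> s \<le> t \<longrightarrow> t \<le> T \<longrightarrow>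
        \<bar>Q1 (snd x) t (fst x) - Q1 (snd x) s (fst x) - (\<Sum>m\<in>UNIV. Q2 (snd x) s (fst x) m * dY s t m)\<bar>
          \<le> L * (t - s) powr (2 * \<alpha>)"
      by (rule order_familyE)
    show ?thesis
    proof (intro exI[of _ "K + L"] conjI ballI allI impI)
      show "K + L > 0" using K(1) L(1) by simp
      fix \<phi> :: "real ^ 'dx \<Rightarrow> real" and s t
      assume \<phi>: "\<phi> \<in> Cb 3" "Cb_norm 3 \<phi> \<le> ennreal B" and st: "0 \<le> s \<and> s \<le> t \<and> t \<le> T"
      have S: "\<phi> \<in> ?S" using \<phi> Cb_ball_mono[of B "max B B1" 3] by (auto simp: Cb_ball_def)
      have s: "0 \<le> s" "s \<le> T" and t: "0 \<le> t" "t \<le> T" using st by auto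
      note conv = \<zeta>_simps(4,5)[OF s] \<zeta>_simps(4,5)[OF t]
      have le: "K * r \<le> (K + L) * r" "L * r \<le> (K + L) * r" if "r \<ge> 0" for r
        using K(1) L(1) that by (simp_all add: mult_right_mono)
      show "\<bar>Phi' c \<zeta> \<phi> t k l - Phi' c \<zeta> \<phi> s k l\<bar> \<le> (K + L) * (t - s) powr \<alpha>" for k l
      proof -
        have "\<bar>Q2 \<phi> t k l - Q2 \<phi> s k l\<bar> \<le> K * (t - s) powr \<alpha>"
          using K(2)[rule_format, of "((k, l), \<phi>)" s t] S st by simp
        also have "\<dots> \<le> (K + L) * (t - s) powr \<alpha>" by (rule le) simp
        finally show ?thesis unfolding conv .
      qed
      show "\<bar>Phi c \<zeta> \<phi> t k - Phi c \<zeta> \<phi> s k - (\<Sum>m\<in>UNIV. Phi' c \<zeta> \<phi> s k m * dY s t m)\<bar>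
          \<le> (K + L) * (t - s) powr (2 * \<alpha>)" for k
      proof -
        have "\<bar>Q1 \<phi> t k - Q1 \<phi> s k - (\<Sum>m\<in>UNIV. Q2 \<phi> s k m * dY s t m)\<bar> \<le> L * (t - s) powr (2 * \<alpha>)"
          using L(2)[rule_format, of "(k, \<phi>)" s t] S st by simp
        also have "\<dots> \<le> (K + L) * (t - s) powr (2 * \<alpha>)" by (rule le) simp
        finally show ?thesis unfolding conv .
      qed
    qed
  qed
  have expansion: "little_o_increment T (\<lambda>s t.
        (\<integral>x. \<phi> x \<partial>\<zeta> t) - (\<integral>x. \<phi> x \<partial>\<zeta> s)
        - (LINT r:{s..t}|lborel. (\<integral>x. opA T c \<Y> r \<phi> x \<partial>\<zeta> r)
             - (\<Sum>k\<in>UNIV. \<Sum>l\<in>UNIV.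
                  Phi c \<zeta> \<phi> r k * bracket_deriv T \<Y> r $ k $ l * mean_h c \<zeta> r l))
        - (\<Sum>k\<in>UNIV. Phi c \<zeta> \<phi> s k * incr (fst \<Y>) s t $ k)
        - (\<Sum>k\<in>UNIV. \<Sum>l\<in>UNIV. Phi' c \<zeta> \<phi> s l k * snd \<Y> s t $ k $ l))" if \<phi>: "\<phi> \<in> Cb 3" for \<phi>
  proof -
    obtain B where B: "\<phi> \<in> Cb_ball 3 (max B B1)" using in_ball[OF \<phi>] by blast
    show ?thesis
    proof (rule little_o_increment_cong[OF quot_rough_expansion[OF ball[of B] m0 B]])
      fix s t assume st: "0 \<le> s" "s \<le> t" "t \<le> T"
      have "(LINT r:{s..t}|lborel. mean_opA \<phi> r / mean one r
              - (\<Sum>k\<in>UNIV. \<Sum>l\<in>UNIV. Q1 \<phi> r k * dbr r k l * QH \<phi> r l))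
          = (LINT r:{s..t}|lborel. (\<integral>x. opA T c \<Y> r \<phi> x \<partial>\<zeta> r)
             - (\<Sum>k\<in>UNIV. \<Sum>l\<in>UNIV. Phi c \<zeta> \<phi> r k * dbr r k l * mean_h c \<zeta> r l))"
        using st by (intro set_lebesgue_integral_cong) (auto simp: \<zeta>_simps(2) \<zeta>_simps(3)[of _ _ \<phi>] \<zeta>_simps(4))
      then show "Q \<phi> t - Q \<phi> s - (LINT r:{s..t}|lborel. mean_opA \<phi> r / mean one r
              - (\<Sum>k\<in>UNIV. \<Sum>l\<in>UNIV. Q1 \<phi> r k * dbr r k l * QH \<phi> r l))
          - (\<Sum>k\<in>UNIV. Q1 \<phi> s k * dY s t k) - (\<Sum>k\<in>UNIV. \<Sum>l\<in>UNIV. Q2 \<phi> s l k * YY s t k l)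
        = (\<integral>x. \<phi> x \<partial>\<zeta> t) - (\<integral>x. \<phi> x \<partial>\<zeta> s)
          - (LINT r:{s..t}|lborel. (\<integral>x. opA T c \<Y> r \<phi> x \<partial>\<zeta> r)
             - (\<Sum>k\<in>UNIV. \<Sum>l\<in>UNIV. Phi c \<zeta> \<phi> r k * dbr r k l * mean_h c \<zeta> r l))
          - (\<Sum>k\<in>UNIV. Phi c \<zeta> \<phi> s k * dY s t k)
          - (\<Sum>k\<in>UNIV. \<Sum>l\<in>UNIV. Phi' c \<zeta> \<phi> s l k * YY s t k l)"
        using st by (simp add: \<zeta>_simps(1,4,5))
    qed
  qed
  show ?thesis
    unfolding kushner_stratonovich_solution_def using weak int reg expansion by blast
qed

end

theorem theorem3p15:
  fixes T \<alpha> :: real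
    and C :: "('dy::finite) rough \<Rightarrow> ('dx::finite, 'dy, 'db::finite) coeffs"
    and \<Y> :: "'dy rough"
    and \<mu> :: "real \<Rightarrow> (real ^ 'dx) measure"
  assumes "T > 0" and "1 / 3 < \<alpha>" and "\<alpha> \<le> 1 / 2"
    and "assumption_E T \<alpha> C"
    and "\<Y> \<in> rough_paths_C1 T \<alpha>"
    and "zakai_solution T \<alpha> (C \<Y>) \<Y> \<mu>"
    and "\<forall>t\<in>{0..T}. (\<integral>x. 1 \<partial>\<mu> t) > (0::real)"
  shows "(\<forall>t\<in>{0..T}. \<forall>\<phi> :: real ^ 'dx \<Rightarrow> real. \<phi> \<in> borel_measurable borel \<and> bounded (range \<phi>) \<longrightarrow>
            (\<integral>x. \<phi> x \<partial>normalized (\<mu> t)) = (\<integral>x. \<phi> x \<partial>\<mu> t) / (\<integral>x. 1 \<partial>\<mu> t)) \<and>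
         kushner_stratonovich_solution T \<alpha> (C \<Y>) \<Y> (\<lambda>t. normalized (\<mu> t))"
proof -
  interpret zakai_setting T \<alpha> \<Y> "C \<Y>" \<mu>
  proof unfold_locales
    show "\<exists>K. \<forall>t\<in>{0..T}. \<forall>x. norm (coef_b (C \<Y>) t x) \<le> K"
      "\<exists>K. \<forall>t\<in>{0..T}. \<forall>x. norm (coef_\<sigma> (C \<Y>) t x) \<le> K"
      "\<exists>\<beta>. controlled_vf T \<alpha> \<beta> (fst \<Y>) (coef_f (C \<Y>)) (coef_f' (C \<Y>))"
      "\<exists>\<beta>. controlled_vf T \<alpha> \<beta> (fst \<Y>) (coef_h (C \<Y>)) (coef_h' (C \<Y>))"
      using assms(4,5) unfolding assumption_E_def bounded_uniformly_lipschitz_def by blast+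
  qed (use assms in auto)
  show ?thesis
    using kushner_stratonovich integral_\<zeta> by (auto simp: mean_def)
qed

end
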